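(* Let $(A,\mathfrak{m})$ be a local $F$-finite ring of characteristic $p>0$ which is a homomorphic image of a regular local $F$-finite ring, and let $I$ be an ideal of $A$. Then $$\operatorname{fgrade}(I,A)\leq \operatorname{depth} A\leq \operatorname{F-depth} A.$$
   Context: Rings are commutative Noetherian and contain a field of characteristic $p>0$; $e\ge 1$ is a fixed integer. $A^e$ denotes $A$ as an $A$-$A$-bimodule with the usual left action and right action $m\cdot a=a^{p^e}m$; $A$ is $F$-finite if $A^e$ is a finitely generated right $A$-module. The formal grade is $\operatorname{fgrade}(I,A)=\inf\{i\in\mathbb{Z} : \varprojlim_n H^i_{\mathfrak m}(A/I^n)\neq 0\}$, where the inverse limit of local cohomology modules is taken along the maps induced by the projections $A/I^{n+1}\to A/I^n$. The $e$th iterate of the Frobenius map of $A$ induces a map $F^e:H^i_{\mathfrak m}(A)\to H^i_{\mathfrak m}(A)$, with $r$-fold iterate $F^{er}$. The Frobenius depth $\operatorname{F-depth} A$ is the smallest $i$ such that $F^{er}$ does not send $H^i_{\mathfrak m}(A)$ to zero for any $r$ (i.e. $F^{er}(H^i_{\mathfrak m}(A))\neq 0$ for every $r$).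
   Formalization: The ideal I is assumed proper; for I = A all A/I^n vanish, so fgrade(I,A) = inf of the empty set = infinity, which exceeds the finite depth of A, and the first inequality fails. *)

theory Defs
  imports "HOL-Library.Extended_Nat" "HOL-Algebra.Algebra"
begin

section \<open>Rings\<close>

definition noetherian_local_ring :: "('a, 'm) ring_scheme \<Rightarrow> 'a set \<Rightarrow> bool" where
  "noetherian_local_ring R \<mm> \<longleftrightarrow>
     cring R \<and> noetherian_ring R \<and> maximalideal \<mm> R \<and> (\<forall>J. maximalideal J R \<longrightarrow> J = \<mm>)"

text \<open>A subfield shares the unit of the ring, so for a prime \<open>p\<close> it has characteristic \<open>p\<close>
  iff \<open>p \<cdot> 1 = 0\<close> holds in the ring.\<close>

definition contains_field_of_char :: "('a, 'm) ring_scheme \<Rightarrow> nat \<Rightarrow> bool" where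
  "contains_field_of_char R p \<longleftrightarrow>
     (\<exists>K. subfield K R) \<and> Factorial_Ring.prime p \<and> [p] \<cdot>\<^bsub>R\<^esub> \<one>\<^bsub>R\<^esub> = \<zero>\<^bsub>R\<^esub>"

definition krull_dim :: "('a, 'm) ring_scheme \<Rightarrow> enat" where
  "krull_dim R = Sup {enat n | n.
     \<exists>P. (\<forall>i\<le>n. primeideal (P i) R) \<and> (\<forall>i<n. P i \<subset> P (Suc i))}"

definition regular_local_ring :: "('a, 'm) ring_scheme \<Rightarrow> 'a set \<Rightarrow> bool" where
  "regular_local_ring R \<mm> \<longleftrightarrow> noetherian_local_ring R \<mm> \<and>
     (\<exists>S \<subseteq> carrier R. finite S \<and> enat (card S) = krull_dim R \<and> genideal R S = \<mm>)"

definition regular_sequence :: "('a, 'm) ring_scheme \<Rightarrow> 'a list \<Rightarrow> bool" where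
  "regular_sequence R xs \<longleftrightarrow> set xs \<subseteq> carrier R \<and> genideal R (set xs) \<noteq> carrier R \<and>
     (\<forall>i<length xs. \<forall>a\<in>carrier R.
        xs ! i \<otimes>\<^bsub>R\<^esub> a \<in> genideal R (set (take i xs)) \<longrightarrow> a \<in> genideal R (set (take i xs)))"

definition depth :: "('a, 'm) ring_scheme \<Rightarrow> 'a set \<Rightarrow> enat" where
  "depth R \<mm> = Sup {enat (length xs) | xs. regular_sequence R xs \<and> set xs \<subseteq> \<mm>}"


section \<open>Modules\<close>

text \<open>The fields \<open>mult\<close> and \<open>one\<close> of a module record have no meaning and are left undefined
  unless the carrier is a ring.\<close>

definition ring_module :: "('a, 'm) ring_scheme \<Rightarrow> ('a, 'a) module" where
  "ring_module R = \<lparr>carrier = carrier R, monoid.mult = monoid.mult R, monoid.one = monoid.one R,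
     ring.zero = ring.zero R, ring.add = ring.add R, smult = monoid.mult R\<rparr>"

text \<open>The right module structure of the bimodule \<open>A\<^sup>e\<close>: \<open>m \<cdot> a = a\<^sup>q m\<close> with \<open>q = p\<^sup>e\<close>.\<close>

definition frobenius_module :: "('a, 'm) ring_scheme \<Rightarrow> nat \<Rightarrow> nat \<Rightarrow> ('a, 'a) module" where
  "frobenius_module R p e =
     (ring_module R)\<lparr>smult := \<lambda>a m. (a [^]\<^bsub>R\<^esub> (p ^ e)) \<otimes>\<^bsub>R\<^esub> m\<rparr>"

definition finitely_generated_module ::
  "('a, 'm) ring_scheme \<Rightarrow> ('a, 'b, 'n) module_scheme \<Rightarrow> bool" where
  "finitely_generated_module R M \<longleftrightarrow> (\<exists>S \<subseteq> carrier M. finite S \<and>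
     (\<forall>x\<in>carrier M. \<exists>a \<in> S \<rightarrow> carrier R. x = (\<Oplus>\<^bsub>M\<^esub>s\<in>S. a s \<odot>\<^bsub>M\<^esub> s)))"

definition F_finite :: "('a, 'm) ring_scheme \<Rightarrow> nat \<Rightarrow> nat \<Rightarrow> bool" where
  "F_finite R p e \<longleftrightarrow> finitely_generated_module R (frobenius_module R p e)"

text \<open>For a subgroup \<open>N\<close> of \<open>M\<close> and a map \<open>f\<close> sending \<open>N'\<close> into \<open>N\<close>, \<open>coset_map M N f\<close> is the
  induced map of cosets \<open>N' + x \<mapsto> N + f x\<close> (all members of the union coincide).\<close>

definition coset_map :: "('b, 'n) ring_scheme \<Rightarrow> 'b set \<Rightarrow> ('c \<Rightarrow> 'b) \<Rightarrow> 'c set \<Rightarrow> 'b set" where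
  "coset_map M N f U = (\<Union>x\<in>U. N +>\<^bsub>M\<^esub> f x)"

definition quotient_module :: "('a, 'b, 'n) module_scheme \<Rightarrow> 'b set \<Rightarrow> ('a, 'b set) module" where
  "quotient_module M N = \<lparr>carrier = a_rcosets\<^bsub>M\<^esub> N, monoid.mult = undefined, monoid.one = undefined,
     ring.zero = N, ring.add = set_add M, smult = \<lambda>a. coset_map M N (\<lambda>x. a \<odot>\<^bsub>M\<^esub> x)\<rparr>"


section \<open>Localization of modules\<close>

text \<open>\<open>fraction R W M m w\<close> is \<open>m / w\<close> in the localization of \<open>M\<close> at the multiplicative set \<open>W\<close>,
  as an equivalence class of pairs. The operations below are unions over representatives, all
  members of which coincide.\<close>

definition fraction :: "('a, 'm) ring_scheme \<Rightarrow> 'a set \<Rightarrow> ('a, 'b, 'n) module_scheme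
    \<Rightarrow> 'b \<Rightarrow> 'a \<Rightarrow> ('b \<times> 'a) set" where
  "fraction R W M m w = {(m', w'). m' \<in> carrier M \<and> w' \<in> W \<and>
     (\<exists>u\<in>W. u \<odot>\<^bsub>M\<^esub> (w' \<odot>\<^bsub>M\<^esub> m) = u \<odot>\<^bsub>M\<^esub> (w \<odot>\<^bsub>M\<^esub> m'))}"

text \<open>\<open>fraction_map R W M g h\<close> is the map \<open>m / w \<mapsto> g m / h w\<close> with values in the localization
  of \<open>M\<close> at \<open>W\<close>.\<close>

definition fraction_map :: "('a, 'm) ring_scheme \<Rightarrow> 'a set \<Rightarrow> ('a, 'b, 'n) module_scheme
    \<Rightarrow> ('c \<Rightarrow> 'b) \<Rightarrow> ('a \<Rightarrow> 'a) \<Rightarrow> ('c \<times> 'a) set \<Rightarrow> ('b \<times> 'a) set" where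
  "fraction_map R W M g h U = (\<Union>(m, w)\<in>U. fraction R W M (g m) (h w))"

definition localization :: "('a, 'm) ring_scheme \<Rightarrow> 'a set \<Rightarrow> ('a, 'b, 'n) module_scheme
    \<Rightarrow> ('a, ('b \<times> 'a) set) module" where
  "localization R W M = \<lparr>
     carrier = {fraction R W M m w | m w. m \<in> carrier M \<and> w \<in> W},
     monoid.mult = undefined, monoid.one = undefined,
     ring.zero = fraction R W M \<zero>\<^bsub>M\<^esub> \<one>\<^bsub>R\<^esub>,
     ring.add = (\<lambda>U V. \<Union>(m, w)\<in>U. \<Union>(m', w')\<in>V.
              fraction R W M (w' \<odot>\<^bsub>M\<^esub> m \<oplus>\<^bsub>M\<^esub> w \<odot>\<^bsub>M\<^esub> m') (w \<otimes>\<^bsub>R\<^esub> w')),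
     smult = (\<lambda>a. fraction_map R W M (\<lambda>m. a \<odot>\<^bsub>M\<^esub> m) id)\<rparr>"


section \<open>Local cohomology\<close>

text \<open>Local cohomology is the cohomology of the Cech complex on a finite sequence \<open>xs\<close> of
  generators of the ideal. Its term in degree \<open>i\<close> is the product, over all sets \<open>S\<close> of \<open>i\<close>
  indices, of the localizations of \<open>M\<close> at the monoid generated by the \<open>xs ! s\<close> with
  \<open>s \<in> S\<close>, i.e. of \<open>M\<close> with the product of these elements inverted.\<close>

definition monomials :: "('a, 'm) ring_scheme \<Rightarrow> 'a list \<Rightarrow> nat set \<Rightarrow> 'a set" where
  "monomials R xs S = {(\<Otimes>\<^bsub>R\<^esub>s\<in>S. (xs ! s) [^]\<^bsub>R\<^esub> k s) | k :: nat \<Rightarrow> nat. True}"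

definition cech_index :: "'a list \<Rightarrow> nat \<Rightarrow> nat set set" where
  "cech_index xs i = {S. S \<subseteq> {..<length xs} \<and> card S = i}"

abbreviation cech_loc :: "('a, 'm) ring_scheme \<Rightarrow> 'a list \<Rightarrow> ('a, 'b, 'n) module_scheme
    \<Rightarrow> nat set \<Rightarrow> ('a, ('b \<times> 'a) set) module" where
  "cech_loc R xs M S \<equiv> localization R (monomials R xs S) M"

definition cech_module :: "('a, 'm) ring_scheme \<Rightarrow> 'a list \<Rightarrow> ('a, 'b, 'n) module_scheme
    \<Rightarrow> nat \<Rightarrow> ('a, nat set \<Rightarrow> ('b \<times> 'a) set) module" where
  "cech_module R xs M i = \<lparr>
     carrier = (\<Pi>\<^sub>E S\<in>cech_index xs i. carrier (cech_loc R xs M S)),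
     monoid.mult = undefined, monoid.one = undefined,
     ring.zero = (\<lambda>S\<in>cech_index xs i. \<zero>\<^bsub>cech_loc R xs M S\<^esub>),
     ring.add = (\<lambda>c d. \<lambda>S\<in>cech_index xs i. c S \<oplus>\<^bsub>cech_loc R xs M S\<^esub> d S),
     smult = (\<lambda>a c. \<lambda>S\<in>cech_index xs i. a \<odot>\<^bsub>cech_loc R xs M S\<^esub> c S)\<rparr>"

definition cech_diff :: "('a, 'm) ring_scheme \<Rightarrow> 'a list \<Rightarrow> ('a, 'b, 'n) module_scheme
    \<Rightarrow> nat \<Rightarrow> (nat set \<Rightarrow> ('b \<times> 'a) set) \<Rightarrow> (nat set \<Rightarrow> ('b \<times> 'a) set)" where
  "cech_diff R xs M i c = (\<lambda>S\<in>cech_index xs (Suc i).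
     \<Oplus>\<^bsub>cech_loc R xs M S\<^esub>s\<in>S.
       (let y = fraction_map R (monomials R xs S) M id id (c (S - {s}))
        in if even (card {t\<in>S. t < s}) then y else \<ominus>\<^bsub>cech_loc R xs M S\<^esub> y))"

definition cech_cocycles :: "('a, 'm) ring_scheme \<Rightarrow> 'a list \<Rightarrow> ('a, 'b, 'n) module_scheme
    \<Rightarrow> nat \<Rightarrow> (nat set \<Rightarrow> ('b \<times> 'a) set) set" where
  "cech_cocycles R xs M i =
     {c \<in> carrier (cech_module R xs M i). cech_diff R xs M i c = \<zero>\<^bsub>cech_module R xs M (Suc i)\<^esub>}"

definition cech_coboundaries :: "('a, 'm) ring_scheme \<Rightarrow> 'a list \<Rightarrow> ('a, 'b, 'n) module_scheme
    \<Rightarrow> nat \<Rightarrow> (nat set \<Rightarrow> ('b \<times> 'a) set) set" where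
  "cech_coboundaries R xs M i = (case i of
       0 \<Rightarrow> {\<zero>\<^bsub>cech_module R xs M 0\<^esub>}
     | Suc j \<Rightarrow> cech_diff R xs M j ` carrier (cech_module R xs M j))"

definition cech_cohomology :: "('a, 'm) ring_scheme \<Rightarrow> 'a list \<Rightarrow> ('a, 'b, 'n) module_scheme
    \<Rightarrow> nat \<Rightarrow> ('a, (nat set \<Rightarrow> ('b \<times> 'a) set) set) module" where
  "cech_cohomology R xs M i =
     quotient_module ((cech_module R xs M i)\<lparr>carrier := cech_cocycles R xs M i\<rparr>)
       (cech_coboundaries R xs M i)"

text \<open>The map into the cohomology of \<open>M\<close> induced by \<open>m / w \<mapsto> g m / h w\<close> on all localizations.\<close>

definition cech_cohomology_map :: "('a, 'm) ring_scheme \<Rightarrow> 'a list \<Rightarrow> ('a, 'b, 'n) module_scheme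
    \<Rightarrow> ('c \<Rightarrow> 'b) \<Rightarrow> ('a \<Rightarrow> 'a) \<Rightarrow> nat
    \<Rightarrow> (nat set \<Rightarrow> ('c \<times> 'a) set) set \<Rightarrow> (nat set \<Rightarrow> ('b \<times> 'a) set) set" where
  "cech_cohomology_map R xs M g h i =
     coset_map (cech_module R xs M i) (cech_coboundaries R xs M i)
       (\<lambda>c. \<lambda>S\<in>cech_index xs i. fraction_map R (monomials R xs S) M g h (c S))"

text \<open>Over a Noetherian ring a generating sequence exists, and up to canonical isomorphism the
  local cohomology modules do not depend on it. The sequence depends on the ring and the ideal only,
  hence the modules \<open>H\<^sup>i(A / I\<^sup>n)\<close> for all \<open>n\<close> use the same one.\<close>

definition ideal_gens :: "('a, 'm) ring_scheme \<Rightarrow> 'a set \<Rightarrow> 'a list" where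
  "ideal_gens R J = (SOME xs. set xs \<subseteq> carrier R \<and> genideal R (set xs) = J)"

definition local_cohomology :: "('a, 'm) ring_scheme \<Rightarrow> 'a set \<Rightarrow> ('a, 'b, 'n) module_scheme
    \<Rightarrow> nat \<Rightarrow> ('a, (nat set \<Rightarrow> ('b \<times> 'a) set) set) module" where
  "local_cohomology R J M i = cech_cohomology R (ideal_gens R J) M i"

definition local_cohomology_map :: "('a, 'm) ring_scheme \<Rightarrow> 'a set \<Rightarrow> ('a, 'b, 'n) module_scheme
    \<Rightarrow> ('c \<Rightarrow> 'b) \<Rightarrow> nat
    \<Rightarrow> (nat set \<Rightarrow> ('c \<times> 'a) set) set \<Rightarrow> (nat set \<Rightarrow> ('b \<times> 'a) set) set" where
  "local_cohomology_map R J M g i = cech_cohomology_map R (ideal_gens R J) M g id i"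


section \<open>Formal grade\<close>

definition quotient_power :: "('a, 'm) ring_scheme \<Rightarrow> 'a set \<Rightarrow> nat \<Rightarrow> ('a, 'a set) module" where
  "quotient_power A I n = quotient_module (ring_module A) (I [^]\<^bsub>ideals_set A\<^esub> n)"

definition power_projection :: "('a, 'm) ring_scheme \<Rightarrow> 'a set \<Rightarrow> nat \<Rightarrow> 'a set \<Rightarrow> 'a set" where
  "power_projection A I n = coset_map (ring_module A) (I [^]\<^bsub>ideals_set A\<^esub> n) id"

definition formal_local_cohomology :: "('a, 'm) ring_scheme \<Rightarrow> 'a set \<Rightarrow> 'a set \<Rightarrow> nat
    \<Rightarrow> (nat \<Rightarrow> (nat set \<Rightarrow> ('a set \<times> 'a) set) set) set" where
  "formal_local_cohomology A \<mm> I i =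
     {\<xi>. (\<forall>n. \<xi> n \<in> carrier (local_cohomology A \<mm> (quotient_power A I n) i)) \<and>
         (\<forall>n. local_cohomology_map A \<mm> (quotient_power A I n) (power_projection A I n) i
                (\<xi> (Suc n)) = \<xi> n)}"

text \<open>Local cohomology vanishes in negative degrees, so the infimum is taken over the naturals;
  the infimum of the empty set is \<open>\<infinity>\<close>.\<close>

definition fgrade :: "('a, 'm) ring_scheme \<Rightarrow> 'a set \<Rightarrow> 'a set \<Rightarrow> enat" where
  "fgrade A \<mm> I = Inf {enat i | i.
     formal_local_cohomology A \<mm> I i \<noteq> {\<lambda>n. \<zero>\<^bsub>local_cohomology A \<mm> (quotient_power A I n) i\<^esub>}}"


section \<open>Frobenius depth\<close>

text \<open>The map induced by \<open>a / w \<mapsto> a\<^sup>q / w\<^sup>q\<close> with \<open>q = p\<^sup>e\<close>.\<close>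

definition frobenius_action :: "('a, 'm) ring_scheme \<Rightarrow> 'a set \<Rightarrow> nat \<Rightarrow> nat \<Rightarrow> nat
    \<Rightarrow> (nat set \<Rightarrow> ('a \<times> 'a) set) set \<Rightarrow> (nat set \<Rightarrow> ('a \<times> 'a) set) set" where
  "frobenius_action A \<mm> p e i =
     cech_cohomology_map A (ideal_gens A \<mm>) (ring_module A)
       (\<lambda>a. a [^]\<^bsub>A\<^esub> (p ^ e)) (\<lambda>w. w [^]\<^bsub>A\<^esub> (p ^ e)) i"

definition F_depth :: "('a, 'm) ring_scheme \<Rightarrow> 'a set \<Rightarrow> nat \<Rightarrow> nat \<Rightarrow> enat" where
  "F_depth A \<mm> p e = Inf {enat i | i. \<forall>r.
     (frobenius_action A \<mm> p e i ^^ r) ` carrier (local_cohomology A \<mm> (ring_module A) i)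
       \<noteq> {\<zero>\<^bsub>local_cohomology A \<mm> (ring_module A) i\<^esub>}}"

end

theory Submission
  imports Defs "HOL-Library.Function_Algebras"
begin

text \<open>Write \<open>A\<close> as a quotient of a ring \<open>P\<close> with kernel \<open>K\<close>. For all ideals \<open>L \<supseteq> K\<close> of \<open>P\<close> the
  cohomology \<open>H\<^sup>i(P / L)\<close> is the quotient \<open>Z i L / B i L\<close> of two submodules of one and the same module
  of Cech cochains, and it is \<open>\<mm>\<close>-torsion.

  If \<open>x \<in> \<mm>\<close> is regular modulo \<open>J\<close> and \<open>H\<^sup>i(P / (J + x P)) = 0\<close>, then \<open>x\<close> is injective on the torsion
  module \<open>H\<^sup>i\<^sup>+\<^sup>1(P / J)\<close>, which therefore vanishes. Hence \<open>H\<^sup>i(A) = 0\<close> below the depth, so that already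
  the power \<open>r = 0\<close> of Frobenius has image zero there.

  For the other inequality let \<open>J\<close> be generated by a maximal regular sequence, of length \<open>t\<close>; by prime
  avoidance some \<open>a \<notin> J\<close> satisfies \<open>\<mm> a \<subseteq> J\<close>. If the limits of \<open>H\<^sup>i(A / I\<^sup>n)\<close> were zero for all \<open>i \<le> t\<close>,
  then, these modules being Artinian, the inverse systems would be pro-zero. By a weak form of the
  Artin--Rees lemma this property passes from \<open>J'\<close> to \<open>J' + x P\<close>, at the cost of one degree, so the
  system \<open>H\<^sup>0(P / (I\<^sup>n + J))\<close> would be pro-zero. Then \<open>a\<close> lies in the intersection of the \<open>I\<^sup>n + J\<close>,
  which contradicts the intersection theorem of Krull.\<close>

section \<open>Ideals of a commutative ring type\<close>

text \<open>The type class of \<open>P\<close> lets ideals and cochains be handled without carrier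
  sets. Since \<open>P\<close> has a variable for every element of the type, it need not be
  Noetherian, and every chain condition therefore speaks of ideals above the kernel \<open>K\<close>
  only. Fractions are replaced by sequences of numerators in \<open>P\<close>, one for each power of
  the denominator, and an ideal \<open>L\<close> enters only through the phrase "eventually in
  \<open>L\<close>". Thus a projection \<open>P / L\<close> to \<open>P / L'\<close> is the identity
  on representatives, a connecting map is division by \<open>x\<close>, and long exact sequences
  become chases between subsets of one group. Two obstacles shape the argument. Mittag-Leffler needs
  the Artinian property of every cohomology module of \<open>P / L\<close>; it is obtained without
  duality, by Noetherian induction on \<open>L\<close> that starts at the residue field and treats
  zero divisors and nonzerodivisors \<open>x\<close> separately. And an \<open>x\<close> that is
  regular modulo \<open>J\<close> need not be regular modulo \<open>J + I^n\<close>, so the exact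
  sequences for the quotients by powers hold only up to a shift of \<open>n\<close>; the Artin-Rees
  argument supplies that shift.\<close>

definition idl :: "'p::comm_ring_1 set \<Rightarrow> bool" where
  "idl L \<longleftrightarrow> 0 \<in> L \<and> (\<forall>a\<in>L. \<forall>b\<in>L. a + b \<in> L) \<and> (\<forall>a\<in>L. \<forall>r. r * a \<in> L)"

definition adjoin :: "'p::comm_ring_1 set \<Rightarrow> 'p \<Rightarrow> 'p set" where
  "adjoin L x = {l + x * a | l a. l \<in> L}"

definition colon :: "'p::comm_ring_1 set \<Rightarrow> 'p \<Rightarrow> 'p set" where
  "colon L x = {a. x * a \<in> L}"

definition idl_plus :: "'p::comm_ring_1 set \<Rightarrow> 'p set \<Rightarrow> 'p set" where
  "idl_plus J L = {a + b | a b. a \<in> J \<and> b \<in> L}"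

lemma idl_0: "idl L \<Longrightarrow> 0 \<in> L"
  and idl_add: "idl L \<Longrightarrow> a \<in> L \<Longrightarrow> b \<in> L \<Longrightarrow> a + b \<in> L"
  and idl_mult: "idl L \<Longrightarrow> a \<in> L \<Longrightarrow> r * a \<in> L"
  by (auto simp: idl_def)

lemma idl_mult2: "idl L \<Longrightarrow> a \<in> L \<Longrightarrow> a * r \<in> L"
  by (metis idl_mult mult.commute)

lemma idl_minus: "idl L \<Longrightarrow> a \<in> L \<Longrightarrow> - a \<in> L"
  using idl_mult[of L a "-1"] by simp

lemma idl_diff: "idl L \<Longrightarrow> a \<in> L \<Longrightarrow> b \<in> L \<Longrightarrow> a - b \<in> L"
  using idl_add[of L a "- b"] idl_minus by auto

lemma idl_sum: "idl L \<Longrightarrow> (\<And>s. s \<in> S \<Longrightarrow> f s \<in> L) \<Longrightarrow> sum f S \<in> L"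
  by (induction S rule: infinite_finite_induct) (auto intro: idl_0 idl_add)

lemma idl_one_imp: "idl L \<Longrightarrow> 1 \<in> L \<Longrightarrow> L = UNIV"
  using idl_mult[of L 1] by auto

lemma idl_add_cancel: "idl L \<Longrightarrow> b \<in> L \<Longrightarrow> a + b \<in> L \<longleftrightarrow> a \<in> L"
  by (metis add_diff_cancel_right' idl_add idl_diff)

lemma idl_UNIV: "idl UNIV"
  by (simp add: idl_def)

lemma idl_adjoin: assumes "idl L" shows "idl (adjoin L x)"
  unfolding idl_def
proof (intro conjI ballI allI)
  have "0 + x * 0 \<in> adjoin L x" using idl_0[OF assms] unfolding adjoin_def by blast
  thus "0 \<in> adjoin L x" by simp
next
  fix a b assume "a \<in> adjoin L x" "b \<in> adjoin L x"
  then obtain l l' u u' where "a = l + x * u" "b = l' + x * u'" "l \<in> L" "l' \<in> L"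
    by (auto simp: adjoin_def)
  hence "a + b = (l + l') + x * (u + u')" "l + l' \<in> L"
    using assms by (auto simp: algebra_simps idl_add)
  thus "a + b \<in> adjoin L x" unfolding adjoin_def by blast
next
  fix a r assume "a \<in> adjoin L x"
  then obtain l u where "a = l + x * u" "l \<in> L" by (auto simp: adjoin_def)
  hence "r * a = r * l + x * (r * u)" "r * l \<in> L"
    using assms by (auto simp: distrib_left mult.left_commute idl_mult)
  thus "r * a \<in> adjoin L x" unfolding adjoin_def by blast
qed

lemma subset_adjoin: "L \<subseteq> adjoin L x"
proof
  fix l assume "l \<in> L"
  hence "l + x * 0 \<in> adjoin L x" unfolding adjoin_def by blast
  thus "l \<in> adjoin L x" by simp
qed

lemma mem_adjoin: assumes "idl L" shows "x * a \<in> adjoin L x"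
proof -
  have "0 + x * a \<in> adjoin L x" unfolding adjoin_def using idl_0[OF assms] by blast
  thus ?thesis by simp
qed

lemma self_mem_adjoin: assumes "idl L" shows "x \<in> adjoin L x"
  using mem_adjoin[OF assms, of x 1] by simp

lemma idl_colon: "idl L \<Longrightarrow> idl (colon L x)"
  by (auto simp: idl_def colon_def distrib_left mult.left_commute[of x])

lemma subset_colon: "idl L \<Longrightarrow> L \<subseteq> colon L x"
  by (auto simp: colon_def intro: idl_mult)

lemma idl_INT: "(\<And>c. c \<in> C \<Longrightarrow> idl (f c)) \<Longrightarrow> idl (\<Inter>c\<in>C. f c)"
  by (auto simp: idl_def)

lemma idl_idl_plus: assumes "idl J" "idl L" shows "idl (idl_plus J L)"
  unfolding idl_def
proof (intro conjI ballI allI)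
  have "0 + 0 \<in> idl_plus J L" using assms[THEN idl_0] unfolding idl_plus_def by blast
  thus "0 \<in> idl_plus J L" by simp
next
  fix a b assume "a \<in> idl_plus J L" "b \<in> idl_plus J L"
  then obtain l l' u u' where "a = l + u" "b = l' + u'" "l \<in> J" "l' \<in> J" "u \<in> L" "u' \<in> L"
    by (auto simp: idl_plus_def)
  hence "a + b = (l + l') + (u + u')" "l + l' \<in> J" "u + u' \<in> L"
    using assms by (auto simp: algebra_simps idl_add)
  thus "a + b \<in> idl_plus J L" unfolding idl_plus_def by blast
next
  fix a r assume "a \<in> idl_plus J L"
  then obtain l u where "a = l + u" "l \<in> J" "u \<in> L" by (auto simp: idl_plus_def)
  hence "r * a = r * l + r * u" "r * l \<in> J" "r * u \<in> L"
    using assms by (auto simp: distrib_left idl_mult)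
  thus "r * a \<in> idl_plus J L" unfolding idl_plus_def by blast
qed

lemma idl_plus_memI: "a \<in> J \<Longrightarrow> b \<in> L \<Longrightarrow> a + b \<in> idl_plus J L"
  unfolding idl_plus_def by blast

lemma idl_plus_sub1: "idl L \<Longrightarrow> J \<subseteq> idl_plus J L"
  using idl_plus_memI[of _ J 0 L] by (auto dest: idl_0)

lemma idl_plus_sub2: "idl J \<Longrightarrow> L \<subseteq> idl_plus J L"
  using idl_plus_memI[of 0 J _ L] by (auto dest: idl_0)

lemma idl_plus_mono: "J \<subseteq> J' \<Longrightarrow> L \<subseteq> L' \<Longrightarrow> idl_plus J L \<subseteq> idl_plus J' L'"
  by (auto simp: idl_plus_def)

lemma idl_plus_absorb: "idl L \<Longrightarrow> J \<subseteq> L \<Longrightarrow> idl J \<Longrightarrow> idl_plus J L = L"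
  using idl_plus_sub2[of J L] by (auto simp: idl_plus_def intro: idl_add)

lemma idl_plus_adjoin: "idl_plus (adjoin J x) L = adjoin (idl_plus J L) x"
proof (intro Set.set_eqI iffI)
  fix a assume "a \<in> idl_plus (adjoin J x) L"
  then obtain j b l where "a = j + x * b + l" "j \<in> J" "l \<in> L"
    by (auto simp: idl_plus_def adjoin_def)
  hence "a = (j + l) + x * b" "j + l \<in> idl_plus J L" by (auto simp: idl_plus_def algebra_simps)
  thus "a \<in> adjoin (idl_plus J L) x" unfolding adjoin_def by blast
next
  fix a assume "a \<in> adjoin (idl_plus J L) x"
  then obtain j b l where "a = j + l + x * b" "j \<in> J" "l \<in> L"
    by (auto simp: idl_plus_def adjoin_def)
  hence "a = (j + x * b) + l" "j + x * b \<in> adjoin J x" "l \<in> L"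
    by (auto simp: adjoin_def algebra_simps)
  thus "a \<in> idl_plus (adjoin J x) L" unfolding idl_plus_def by blast
qed

lemma foldl_adjoin: "idl J \<Longrightarrow> idl (foldl adjoin J ys) \<and> J \<union> set ys \<subseteq> foldl adjoin J ys"
proof (induction ys arbitrary: J)
  case (Cons y ys)
  have "idl (adjoin J y)" "J \<subseteq> adjoin J y" "y \<in> adjoin J y"
    using Cons.prems idl_adjoin subset_adjoin self_mem_adjoin by blast+
  thus ?case using Cons.IH[of "adjoin J y"] by auto
qed simp

lemma foldl_adjoin_least: "idl Q \<Longrightarrow> J \<subseteq> Q \<Longrightarrow> set ys \<subseteq> Q \<Longrightarrow> foldl adjoin J ys \<subseteq> Q"
proof (induction ys arbitrary: J)
  case (Cons y ys)
  have "adjoin J y \<subseteq> Q"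
    using Cons.prems unfolding adjoin_def by (auto intro!: idl_add idl_mult2)
  thus ?case using Cons by simp
qed simp

text \<open>This is weak regularity: the quotient by the whole sequence may be zero, so the
  recursion carries no properness condition.\<close>

fun regseq :: "'p::comm_ring_1 set \<Rightarrow> 'p list \<Rightarrow> bool" where
  "regseq J [] \<longleftrightarrow> True"
| "regseq J (y # ys) \<longleftrightarrow> colon J y = J \<and> regseq (adjoin J y) ys"

lemma regseqI:
  "(\<And>i. i < length ys \<Longrightarrow> colon (foldl adjoin J (take i ys)) (ys ! i) = foldl adjoin J (take i ys)) \<Longrightarrow> regseq J ys"
proof (induction ys arbitrary: J)
  case (Cons y ys)
  have "colon J y = J" using Cons.prems[of 0] by simp
  moreover have "regseq (adjoin J y) ys" by (rule Cons.IH) (use Cons.prems[of "Suc _"] in simp)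
  ultimately show ?case by simp
qed simp

text \<open>The ascending chain condition for the ideals above \<open>K\<close>, that is, for the
  ideals of the quotient by \<open>K\<close>. It is stated as well-foundedness so that it yields
  both maximal elements and induction from larger ideals to smaller ones.\<close>

definition noeth :: "'p::comm_ring_1 set \<Rightarrow> bool" where
  "noeth K \<longleftrightarrow> wf {(L', L). idl L \<and> idl L' \<and> K \<subseteq> L \<and> L \<subset> L'}"

lemma noeth_max:
  assumes "noeth K" "L0 \<in> F" "\<And>L. L \<in> F \<Longrightarrow> idl L \<and> K \<subseteq> L"
  obtains L where "L \<in> F" "\<And>L'. L' \<in> F \<Longrightarrow> L \<subseteq> L' \<Longrightarrow> L' = L"
proof -
  obtain L where "L \<in> F" "\<And>L'. (L', L) \<in> {(L', L). idl L \<and> idl L' \<and> K \<subseteq> L \<and> L \<subset> L'} \<Longrightarrow> L' \<notin> F"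
    using assms(1,2) unfolding noeth_def by (meson wfE_min)
  with assms(3) have "L' = L" if "L' \<in> F" "L \<subseteq> L'" for L'
    using that by blast
  with \<open>L \<in> F\<close> show thesis using that by blast
qed

lemma noeth_induct [consumes 3, case_names less]:
  assumes "noeth K" "idl L" "K \<subseteq> L"
    and step: "\<And>L. idl L \<Longrightarrow> K \<subseteq> L \<Longrightarrow> (\<And>L'. idl L' \<Longrightarrow> L \<subset> L' \<Longrightarrow> P L') \<Longrightarrow> P L"
  shows "P L"
proof (rule ccontr)
  assume nP: "\<not> P L"
  obtain Q where Q: "Q \<in> {L. idl L \<and> K \<subseteq> L \<and> \<not> P L}"
      "\<And>L'. L' \<in> {L. idl L \<and> K \<subseteq> L \<and> \<not> P L} \<Longrightarrow> Q \<subseteq> L' \<Longrightarrow> L' = Q"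
    by (rule noeth_max[OF assms(1), of L "{L. idl L \<and> K \<subseteq> L \<and> \<not> P L}"])
      (use assms(2,3) nP in auto)
  have "P Q"
  proof (rule step)
    show "P L'" if "idl L'" "Q \<subset> L'" for L'
      using Q(1) Q(2)[of L'] that by auto
  qed (use Q(1) in auto)
  with Q show False by simp
qed

text \<open>\<open>In n\<close> stands for the power \<open>I\<^sup>n\<close> of the ideal \<open>I = In 1\<close>, up to the ideal \<open>K\<close>.\<close>

locale powers =
  fixes K :: "'p::comm_ring_1 set" and In :: "nat \<Rightarrow> 'p set"
  assumes noeth: "noeth K"
    and idl_In: "idl (In n)" and K_In: "K \<subseteq> In n"
    and In_0: "In 0 = UNIV"
    and In_mult: "a \<in> In m \<Longrightarrow> b \<in> In n \<Longrightarrow> a * b \<in> In (m + n)"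
    and In_least: "idl Q \<Longrightarrow> K \<subseteq> Q \<Longrightarrow> (\<And>a b. a \<in> In m \<Longrightarrow> b \<in> In n \<Longrightarrow> a * b \<in> Q) \<Longrightarrow> In (m + n) \<subseteq> Q"
begin

lemma In_antimono: "m \<le> n \<Longrightarrow> In n \<subseteq> In m"
  using In_least[OF idl_In K_In, of m "n - m" m] idl_mult2[OF idl_In] by auto

lemma power_mem_In: "y \<in> In 1 \<Longrightarrow> y ^ n \<in> In n"
proof (induction n)
  case (Suc n)
  then show ?case using In_mult[of y 1 "y ^ n" n] by simp
qed (simp add: In_0)

text \<open>Noetherian induction on \<open>Q\<close> replaces the count of exponents of finitely
  many generators. If \<open>y0\<close> in \<open>I\<close> is outside \<open>Q\<close> and
  \<open>y\<close> is its last power outside \<open>Q\<close>, then \<open>adjoin Q y\<close> and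
  \<open>colon Q y\<close> are both strictly larger than \<open>Q\<close>, the latter because it
  contains \<open>y0\<close>. By induction they contain powers of \<open>I\<close>, and the product
  of the two ideals lies in \<open>Q\<close>.\<close>

lemma In_subset_of_radical:
  assumes "idl Q" "K \<subseteq> Q" "\<And>y. y \<in> In 1 \<Longrightarrow> \<exists>k. y ^ k \<in> Q"
  shows "\<exists>n. In n \<subseteq> Q"
  using noeth assms(1,2) assms(3)
proof (induction rule: noeth_induct)
  case (less Q)
  show ?case
  proof (cases "In 1 \<subseteq> Q")
    case False
    then obtain y0 where y0: "y0 \<in> In 1" "y0 \<notin> Q" by auto
    define k where "k = (LEAST k. y0 ^ k \<in> Q)"
    have k: "y0 ^ k \<in> Q" unfolding k_def by (rule LeastI_ex) (use less.prems y0 in blast)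
    show ?thesis
    proof (cases "k = 0")
      case True
      hence "Q = UNIV" using k idl_one_imp[OF less.hyps(1)] by simp
      thus ?thesis by blast
    next
      case k0: False
      define y where "y = y0 ^ (k - 1)"
      have y: "y \<notin> Q" unfolding y_def
        using k0 not_less_Least[of "k - 1" "\<lambda>k. y0 ^ k \<in> Q"] by (auto simp: k_def)
      have yy: "y0 * y \<in> Q" using k k0 by (simp add: y_def flip: power_Suc)
      have "\<exists>n. In n \<subseteq> adjoin Q y"
      proof (rule less.IH)
        show "idl (adjoin Q y)" by (rule idl_adjoin[OF less.hyps(1)])
        show "Q \<subset> adjoin Q y"
          using y self_mem_adjoin[OF less.hyps(1), of y] subset_adjoin[of Q y] by auto
        show "\<exists>k. z ^ k \<in> adjoin Q y" if "z \<in> In 1" for z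
          using less.prems[OF that] subset_adjoin[of Q y] by blast
      qed
      moreover have "\<exists>n. In n \<subseteq> colon Q y"
      proof (rule less.IH)
        show "idl (colon Q y)" by (rule idl_colon[OF less.hyps(1)])
        have "y0 \<in> colon Q y" using yy by (simp add: colon_def mult.commute)
        thus "Q \<subset> colon Q y" using y0 subset_colon[OF less.hyps(1), of y] by auto
        show "\<exists>k. z ^ k \<in> colon Q y" if "z \<in> In 1" for z
          using less.prems[OF that] subset_colon[OF less.hyps(1), of y] by blast
      qed
      ultimately obtain m n where mn: "In m \<subseteq> adjoin Q y" "In n \<subseteq> colon Q y" by blast
      have "a * b \<in> Q" if ab: "a \<in> In m" "b \<in> In n" for a b
      proof -
        obtain q u where "a = q + y * u" "q \<in> Q" using mn ab by (auto simp: adjoin_def)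
        moreover have "y * b \<in> Q" using mn ab by (auto simp: colon_def)
        moreover have "(q + y * u) * b = b * q + u * (y * b)" by (simp add: algebra_simps)
        ultimately show ?thesis using less.hyps(1) by (simp add: idl_add idl_mult)
      qed
      from In_least[OF less.hyps(1,2) this] show ?thesis by blast
    qed
  qed blast
qed

text \<open>A weak form of the Artin--Rees lemma. Choose \<open>Q\<close> maximal with \<open>Q \<inter> N \<subseteq> T\<close>; then every
  element of \<open>I\<close> has a power in \<open>Q\<close>.\<close>

lemma weak_artin_rees:
  assumes N: "idl N" and T: "idl T" "K \<subseteq> T"
    and pow: "\<And>y u. y \<in> In 1 \<Longrightarrow> u \<in> N \<Longrightarrow> \<exists>k. y ^ k * u \<in> T"
  shows "\<exists>n. \<forall>u \<in> idl_plus T (In n). u \<in> N \<longrightarrow> u \<in> T"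
proof -
  obtain Q where Q: "idl Q" "T \<subseteq> Q" "Q \<inter> N \<subseteq> T"
    and max: "\<And>Q'. idl Q' \<Longrightarrow> T \<subseteq> Q' \<Longrightarrow> Q' \<inter> N \<subseteq> T \<Longrightarrow> Q \<subseteq> Q' \<Longrightarrow> Q' = Q"
    by (rule noeth_max[OF noeth, of T "{Q. idl Q \<and> T \<subseteq> Q \<and> Q \<inter> N \<subseteq> T}"]) (use T in auto)
  have KQ: "K \<subseteq> Q" using T Q by blast
  have "\<exists>n. In n \<subseteq> Q"
  proof (rule In_subset_of_radical[OF Q(1) KQ])
    fix y assume y: "y \<in> In 1"
    \<comment> \<open>The ideals \<open>colon Q (y ^ k)\<close> ascend with \<open>k\<close>, so a
      maximal one among them is the value from which the chain is constant.\<close>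
    obtain L where L: "L \<in> range (\<lambda>k. colon Q (y ^ k))"
      and Lmax: "\<And>L'. L' \<in> range (\<lambda>k. colon Q (y ^ k)) \<Longrightarrow> L \<subseteq> L' \<Longrightarrow> L' = L"
    proof (rule noeth_max[OF noeth, of "colon Q (y ^ 0)" "range (\<lambda>k. colon Q (y ^ k))"])
      show "idl L \<and> K \<subseteq> L" if "L \<in> range (\<lambda>k. colon Q (y ^ k))" for L
        using that idl_colon[OF Q(1)] order.trans[OF KQ subset_colon[OF Q(1)]] by blast
    qed (rule rangeI, rule that)
    then obtain k where k: "L = colon Q (y ^ k)" by blast
    have chain: "colon Q (y ^ (n + k)) = colon Q (y ^ k)" for n
      unfolding k[symmetric]
      by (rule Lmax[OF rangeI]) (auto simp: k colon_def power_add mult.assoc idl_mult[OF Q(1)])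
    \<comment> \<open>For \<open>u = q + y ^ k * b\<close> in \<open>N\<close>, some
      \<open>y ^ n * u\<close> lies in \<open>T \<subseteq> Q\<close>. Hence
      \<open>y ^ (n + k) * b\<close> lies in \<open>Q\<close>, and by stability so does
      \<open>y ^ k * b\<close>. Thus \<open>u\<close> is in
      \<open>Q \<inter> N \<subseteq> T\<close>, and maximality of \<open>Q\<close> applies to the
      enlarged ideal.\<close>
    have "adjoin Q (y ^ k) = Q"
    proof (rule max)
      show "idl (adjoin Q (y ^ k))" by (rule idl_adjoin[OF Q(1)])
      show "T \<subseteq> adjoin Q (y ^ k)" "Q \<subseteq> adjoin Q (y ^ k)" using Q(2) subset_adjoin by blast+
      show "adjoin Q (y ^ k) \<inter> N \<subseteq> T"
      proof
        fix u assume u: "u \<in> adjoin Q (y ^ k) \<inter> N"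
        then obtain q b where qb: "u = q + y ^ k * b" "q \<in> Q" by (auto simp: adjoin_def)
        obtain n where "y ^ n * u \<in> T" using pow y u by blast
        hence "y ^ n * u - y ^ n * q \<in> Q" using Q qb by (auto intro: idl_diff idl_mult)
        hence "b \<in> colon Q (y ^ (n + k))" by (simp add: qb colon_def power_add algebra_simps)
        hence "y ^ k * b \<in> Q" by (simp only: chain) (simp add: colon_def)
        thus "u \<in> T" using u qb Q by (auto intro: idl_add)
      qed
    qed
    thus "\<exists>k. y ^ k \<in> Q" using self_mem_adjoin[OF Q(1)] by metis
  qed
  then obtain n where "In n \<subseteq> Q" by blast
  hence "idl_plus T (In n) \<subseteq> Q" using Q by (auto simp: idl_plus_def intro!: idl_add)
  thus ?thesis using Q by blast
qed

text \<open>Multiplication by \<open>x\<close> is injective on the inverse system of the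
  \<open>P / (J + I^n)\<close> up to a shift. The weak Artin-Rees property is applied to
  \<open>N = J + x P\<close> and \<open>T = J + x I^n\<close>: if \<open>x * a\<close> lies in
  \<open>J + I^m\<close>, then \<open>x * a = j + x * b\<close> with \<open>b\<close> in
  \<open>I^n\<close>, and regularity of \<open>x\<close> modulo \<open>J\<close> puts
  \<open>a - b\<close> into \<open>J\<close>.\<close>

lemma colon_plus_powers:
  assumes J: "idl J" "K \<subseteq> J" and reg: "colon J x = J"
  shows "\<exists>m\<ge>n. colon (idl_plus J (In m)) x \<subseteq> idl_plus J (In n)"
proof -
  define T where "T = {j + x * b | j b. j \<in> J \<and> b \<in> In n}"
  have T: "idl T" unfolding idl_def
  proof (intro conjI ballI allI)
    have "0 + x * 0 \<in> T" using idl_0[OF J(1)] idl_0[OF idl_In] unfolding T_def by blast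
    thus "0 \<in> T" by simp
  next
    fix a b assume "a \<in> T" "b \<in> T"
    then obtain l l' u u' where "a = l + x * u" "b = l' + x * u'" "l \<in> J" "l' \<in> J" "u \<in> In n" "u' \<in> In n"
      by (auto simp: T_def)
    hence "a + b = (l + l') + x * (u + u')" "l + l' \<in> J" "u + u' \<in> In n"
      using J idl_In by (auto simp: algebra_simps idl_add)
    thus "a + b \<in> T" unfolding T_def by blast
  next
    fix a r assume "a \<in> T"
    then obtain l u where "a = l + x * u" "l \<in> J" "u \<in> In n" by (auto simp: T_def)
    hence "r * a = r * l + x * (r * u)" "r * l \<in> J" "r * u \<in> In n"
      using J idl_In by (auto simp: algebra_simps idl_mult idl_mult2)
    thus "r * a \<in> T" unfolding T_def by blast
  qed
  have JT: "J \<subseteq> T"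
  proof
    fix j assume "j \<in> J"
    hence "j + x * 0 \<in> T" unfolding T_def using idl_0[OF idl_In, of n] by blast
    thus "j \<in> T" by simp
  qed
  have "\<exists>m. \<forall>u \<in> idl_plus T (In m). u \<in> adjoin J x \<longrightarrow> u \<in> T"
  proof (rule weak_artin_rees[OF idl_adjoin[OF J(1)] T])
    show "K \<subseteq> T" using J JT by blast
    fix y u assume y: "y \<in> In 1" and "u \<in> adjoin J x"
    then obtain j a where "u = j + x * a" "j \<in> J" by (auto simp: adjoin_def)
    hence "y ^ n * u = y ^ n * j + x * (y ^ n * a)" "y ^ n * j \<in> J" "y ^ n * a \<in> In n"
      using y power_mem_In J idl_In by (auto simp: algebra_simps idl_mult idl_mult2)
    thus "\<exists>k. y ^ k * u \<in> T" unfolding T_def by blast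
  qed
  then obtain m where m: "\<And>u. u \<in> idl_plus T (In m) \<Longrightarrow> u \<in> adjoin J x \<Longrightarrow> u \<in> T" by blast
  have "colon (idl_plus J (In (max m n))) x \<subseteq> idl_plus J (In n)"
  proof
    fix a assume "a \<in> colon (idl_plus J (In (max m n))) x"
    hence "x * a \<in> idl_plus J (In (max m n))" by (simp add: colon_def)
    moreover have "idl_plus J (In (max m n)) \<subseteq> idl_plus T (In m)"
      using JT In_antimono[of m "max m n"] by (intro idl_plus_mono) auto
    moreover have "x * a \<in> adjoin J x" by (rule mem_adjoin[OF J(1)])
    ultimately have "x * a \<in> T" using m by blast
    then obtain j b where jb: "x * a = j + x * b" "j \<in> J" "b \<in> In n" by (auto simp: T_def)
    hence "a - b \<in> colon J x" by (simp add: colon_def algebra_simps)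
    hence "a - b \<in> J" using reg by simp
    moreover have "a = (a - b) + b" by simp
    ultimately show "a \<in> idl_plus J (In n)" using jb unfolding idl_plus_def by blast
  qed
  thus ?thesis by (intro exI[of _ "max m n"]) auto
qed

text \<open>Since \<open>I\<close> kills \<open>a\<close> modulo \<open>J\<close>, the weak
  Artin-Rees property holds for \<open>N = J + a P\<close> and \<open>T = J\<close> with exponent
  one, and \<open>a\<close> itself is an element of \<open>N\<close> in every
  \<open>J + I^n\<close>.\<close>

lemma krull_intersection:
  assumes J: "idl J" "K \<subseteq> J" and a: "\<And>x. x \<in> In 1 \<Longrightarrow> x * a \<in> J"
    and inter: "\<And>n. a \<in> idl_plus J (In n)"
  shows "a \<in> J"
proof -
  have "\<exists>n. \<forall>u \<in> idl_plus J (In n). u \<in> adjoin J a \<longrightarrow> u \<in> J"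
  proof (rule weak_artin_rees[OF idl_adjoin[OF J(1)] J])
    fix y u assume "y \<in> In 1" "u \<in> adjoin J a"
    then obtain j b where "u = j + a * b" "j \<in> J" "y * a \<in> J" using a by (auto simp: adjoin_def)
    hence "y * j + b * (y * a) \<in> J" by (simp add: idl_add idl_mult J(1))
    moreover have "y ^ 1 * u = y * j + b * (y * a)" using \<open>u = _\<close> by (simp add: algebra_simps)
    ultimately show "\<exists>k. y ^ k * u \<in> J" by metis
  qed
  thus ?thesis using inter self_mem_adjoin[OF J(1)] by blast
qed

end

section \<open>Prime avoidance and zero divisors modulo an ideal\<close>

definition prm :: "'p::comm_ring_1 set \<Rightarrow> bool" where
  "prm q \<longleftrightarrow> idl q \<and> 1 \<notin> q \<and> (\<forall>a b. a * b \<in> q \<longrightarrow> a \<in> q \<or> b \<in> q)"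

lemma prm_prod: "finite F \<Longrightarrow> prm q \<Longrightarrow> prod f F \<in> q \<Longrightarrow> \<exists>b\<in>F. f b \<in> q"
  by (induction F rule: finite_induct) (auto simp: prm_def)

text \<open>If the \<open>x\<close> found for \<open>F\<close> falls into the new prime
  \<open>q\<close>, it is corrected by an element \<open>y\<close> of \<open>M\<close> that lies in
  all primes of \<open>F\<close> but not in \<open>q\<close>. Incomparability supplies the factors
  of \<open>y\<close>: each \<open>q'\<close> in \<open>F\<close> has an element outside
  \<open>q\<close>.\<close>

lemma prime_avoidance:
  assumes "finite F" "\<And>q. q \<in> F \<Longrightarrow> prm q \<and> \<not> M \<subseteq> q"
    and "\<And>q q'. q \<in> F \<Longrightarrow> q' \<in> F \<Longrightarrow> q \<subseteq> q' \<Longrightarrow> q = q'" and M: "idl M"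
  shows "\<exists>x\<in>M. \<forall>q\<in>F. x \<notin> q"
  using assms(1-3)
proof (induction F rule: finite_induct)
  case empty
  then show ?case using idl_0[OF M] by blast
next
  case (insert q F)
  then obtain x where x: "x \<in> M" "\<And>q'. q' \<in> F \<Longrightarrow> x \<notin> q'" by (metis insertCI)
  show ?case
  proof (cases "x \<in> q")
    case True
    obtain w where w: "w \<in> M" "w \<notin> q" using insert.prems(1) by blast
    have "\<exists>z. z \<in> q' \<and> z \<notin> q" if "q' \<in> F" for q'
      using insert.prems(2)[of q' q] insert.hyps that by blast
    then obtain z where z: "\<And>q'. q' \<in> F \<Longrightarrow> z q' \<in> q' \<and> z q' \<notin> q" by metis
    define y where "y = w * prod z F"
    have q: "prm q" "idl q" using insert.prems by (auto simp: prm_def)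
    have "prod z F \<notin> q" using prm_prod[OF insert.hyps(1) q(1)] z by blast
    hence yq: "y \<notin> q" using q w by (auto simp: prm_def y_def)
    have yq': "y \<in> q'" if "q' \<in> F" for q'
    proof -
      have "idl q'" using insert.prems that by (auto simp: prm_def)
      moreover have "y = (w * prod z (F - {q'})) * z q'"
        by (simp add: y_def prod.remove[OF insert.hyps(1) that] algebra_simps)
      ultimately show ?thesis using z[OF that] by (metis idl_mult)
    qed
    have "x + y \<in> M" using x w M by (auto simp: y_def intro: idl_add idl_mult2)
    moreover have "x + y \<notin> q" using True yq q(2) by (metis add.commute idl_add_cancel)
    moreover have "x + y \<notin> q'" if "q' \<in> F" for q'
      using x(2)[OF that] yq'[OF that] insert.prems(1)[of q'] that by (auto simp: prm_def idl_add_cancel)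
    ultimately show ?thesis by blast
  qed (use x in blast)
qed

text \<open>The maximal ideals among the \<open>colon J a\<close> with \<open>a \<notin> J\<close> are prime, cover the zero divisors
  modulo \<open>J\<close>, and are finitely many; so prime avoidance applies to them.\<close>

lemma common_annihilator:
  assumes K: "noeth K" and J: "idl J" "K \<subseteq> J" and M: "idl M"
    and zd: "\<And>x. x \<in> M \<Longrightarrow> \<exists>a. a \<notin> J \<and> x * a \<in> J"
  shows "\<exists>a. a \<notin> J \<and> (\<forall>x\<in>M. x * a \<in> J)"
proof -
  define A0 where "A0 = {a. a \<notin> J \<and> (\<forall>b. b \<notin> J \<longrightarrow> colon J a \<subseteq> colon J b \<longrightarrow> colon J b = colon J a)}"
  have prime: "prm (colon J a)" if a: "a \<in> A0" for a
    unfolding prm_def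
  proof (intro conjI allI impI)
    show "idl (colon J a)" by (rule idl_colon[OF J(1)])
    show "1 \<notin> colon J a" using a by (simp add: A0_def colon_def)
    fix x y assume xy: "x * y \<in> colon J a"
    show "x \<in> colon J a \<or> y \<in> colon J a"
    proof (cases "y * a \<in> J")
      case False
      have "colon J a \<subseteq> colon J (y * a)" using J by (auto simp: colon_def mult.assoc idl_mult)
      hence "colon J (y * a) = colon J a" using a False by (auto simp: A0_def)
      moreover have "x \<in> colon J (y * a)" using xy by (simp add: colon_def algebra_simps)
      ultimately show ?thesis by simp
    qed (simp add: colon_def mult.commute)
  qed
  have cover: "\<exists>a\<in>A0. x \<in> colon J a" if c: "c \<notin> J" "x * c \<in> J" for x c
  proof -
    have sub: "idl (colon J b) \<and> K \<subseteq> colon J b" for b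
      using idl_colon[OF J(1)] order.trans[OF J(2) subset_colon[OF J(1)]] by blast
    obtain L where L: "L \<in> {colon J b | b. b \<notin> J \<and> colon J c \<subseteq> colon J b}"
      and max: "\<And>L'. L' \<in> {colon J b | b. b \<notin> J \<and> colon J c \<subseteq> colon J b} \<Longrightarrow> L \<subseteq> L' \<Longrightarrow> L' = L"
      by (rule noeth_max[OF K, of "colon J c" "{colon J b | b. b \<notin> J \<and> colon J c \<subseteq> colon J b}"])
        (use sub c in blast)+
    then obtain b where b: "L = colon J b" "b \<notin> J" "colon J c \<subseteq> colon J b" by blast
    have "b \<in> A0" unfolding A0_def using max b by blast
    moreover have "x \<in> colon J b" using b c by (auto simp: colon_def mult.commute)
    ultimately show ?thesis by blast
  qed
  \<comment> \<open>\<open>ann F\<close> is the double annihilator of \<open>F\<close> modulo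
    \<open>J\<close>: everything killed by all elements that kill \<open>F\<close>. It is an ideal
    that grows with \<open>F\<close>, so the chain condition singles out a finite \<open>F\<close>
    whose \<open>ann F\<close> already contains all of \<open>A0\<close>.\<close>
  define ann where "ann = (\<lambda>F. {x. \<forall>c. (\<forall>b\<in>F. c * b \<in> J) \<longrightarrow> c * x \<in> J})"
  have idl_ann: "idl (ann F)" "J \<subseteq> ann F" for F
  proof -
    have "ann F = (\<Inter>c\<in>{c. \<forall>b\<in>F. c * b \<in> J}. colon J c)" by (auto simp: ann_def colon_def)
    thus "idl (ann F)" using idl_INT[of "{c. \<forall>b\<in>F. c * b \<in> J}" "colon J"] idl_colon[OF J(1)] by simp
    show "J \<subseteq> ann F" by (auto simp: ann_def idl_mult[OF J(1)])
  qed
  obtain F where F: "finite F" "F \<subseteq> A0"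
    and Fmax: "\<And>F'. finite F' \<Longrightarrow> F' \<subseteq> A0 \<Longrightarrow> ann F \<subseteq> ann F' \<Longrightarrow> ann F' = ann F"
  proof -
    obtain L where L: "L \<in> ann ` {F. finite F \<and> F \<subseteq> A0}"
      "\<And>L'. L' \<in> ann ` {F. finite F \<and> F \<subseteq> A0} \<Longrightarrow> L \<subseteq> L' \<Longrightarrow> L' = L"
    proof (rule noeth_max[OF K, of "ann {}" "ann ` {F. finite F \<and> F \<subseteq> A0}"])
      show "idl L \<and> K \<subseteq> L" if "L \<in> ann ` {F. finite F \<and> F \<subseteq> A0}" for L
        using that idl_ann(1) order.trans[OF J(2) idl_ann(2)] by blast
    qed (simp, rule that)
    then obtain F where "L = ann F" "finite F" "F \<subseteq> A0" by blast
    moreover have "ann F' = L" if "finite F'" "F' \<subseteq> A0" "L \<subseteq> ann F'" for F'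
      using that by (intro L(2)) auto
    ultimately show thesis using that[of F] by simp
  qed
  \<comment> \<open>If \<open>colon J a\<close> differed from every \<open>colon J b\<close>,
    maximality would give each \<open>colon J b\<close> an element \<open>z b\<close> outside
    \<open>colon J a\<close>. The product of the \<open>z b\<close> kills \<open>F\<close>, hence
    also \<open>a\<close> because \<open>a\<close> is in \<open>ann F\<close>; this contradicts
    primality of \<open>colon J a\<close>.\<close>
  have inF: "\<exists>b\<in>F. colon J a = colon J b" if a: "a \<in> A0" for a
  proof (rule ccontr)
    assume contra: "\<not> ?thesis"
    have "ann (insert a F) = ann F"
      by (rule Fmax) (use F a in \<open>auto simp: ann_def\<close>)
    moreover have "a \<in> ann (insert a F)" by (simp add: ann_def)
    ultimately have aF: "a \<in> ann F" by simp
    have "\<exists>z. z \<in> colon J b \<and> z \<notin> colon J a" if "b \<in> F" for b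
    proof (rule ccontr)
      assume "\<not> ?thesis"
      hence "colon J b \<subseteq> colon J a" by blast
      hence "colon J a = colon J b" using F a that by (auto simp: A0_def)
      thus False using contra that by blast
    qed
    then obtain z where z: "\<And>b. b \<in> F \<Longrightarrow> z b \<in> colon J b \<and> z b \<notin> colon J a" by metis
    have "prod z F * b \<in> J" if b: "b \<in> F" for b
    proof -
      have "prod z F * b = prod z (F - {b}) * (b * z b)"
        by (simp add: prod.remove[OF F(1) b] algebra_simps)
      thus ?thesis using z[OF b] J by (simp add: colon_def idl_mult)
    qed
    hence "prod z F * a \<in> J" using aF by (simp add: ann_def)
    hence "prod z F \<in> colon J a" by (simp add: colon_def mult.commute)
    thus False using prm_prod[OF F(1) prime[OF a]] z by blast
  qed
  have "\<exists>b\<in>F. M \<subseteq> colon J b"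
  proof (rule ccontr)
    assume "\<not> ?thesis"
    moreover have "colon J a = colon J b" if "a \<in> A0" "b \<in> A0" "colon J a \<subseteq> colon J b" for a b
      using that by (simp add: A0_def)
    ultimately have "\<exists>x\<in>M. \<forall>q\<in>colon J ` F. x \<notin> q"
      using F prime M by (intro prime_avoidance finite_imageI) blast+
    then obtain x where x: "x \<in> M" "\<And>b. b \<in> F \<Longrightarrow> x \<notin> colon J b" by blast
    obtain c where "c \<notin> J" "x * c \<in> J" using zd x(1) by blast
    then obtain a where "a \<in> A0" "x \<in> colon J a" using cover by blast
    thus False using inF x(2) by metis
  qed
  then obtain b where "b \<in> F" "M \<subseteq> colon J b" by blast
  thus ?thesis using F by (intro exI[of _ b]) (auto simp: A0_def colon_def mult.commute)
qed

section \<open>The Cech complex as germs of Koszul cochains\<close>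

type_synonym 'p cochain = "nat \<Rightarrow> nat set \<Rightarrow> 'p"

definition sc :: "'p::comm_ring_1 \<Rightarrow> 'p cochain \<Rightarrow> 'p cochain" where
  "sc x c = (\<lambda>k S. x * c k S)"

definition subm :: "'p::comm_ring_1 cochain set \<Rightarrow> bool" where
  "subm W \<longleftrightarrow> 0 \<in> W \<and> (\<forall>a\<in>W. \<forall>b\<in>W. a + b \<in> W) \<and> (\<forall>a\<in>W. \<forall>x. sc x a \<in> W)"

lemma sc_add: "sc x (a + b) = sc x a + sc x b"
  and sc_diff: "sc x (a - b) = sc x a - sc x b"
  and sc_sc: "sc x (sc y a) = sc (x * y) a"
  and sc_add_left: "sc (x + y) a = sc x a + sc y a"
  and sc_0_left: "sc 0 a = 0"
  and sc_0: "sc x 0 = 0"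
  and sc_1: "sc 1 a = a"
  and sc_m1: "sc (-1) a = - a"
  by (auto simp: sc_def fun_eq_iff algebra_simps)

lemma subm_0: "subm W \<Longrightarrow> 0 \<in> W"
  and subm_add: "subm W \<Longrightarrow> a \<in> W \<Longrightarrow> b \<in> W \<Longrightarrow> a + b \<in> W"
  and subm_sc: "subm W \<Longrightarrow> a \<in> W \<Longrightarrow> sc x a \<in> W"
  by (simp_all add: subm_def)

lemma subm_minus: "subm W \<Longrightarrow> a \<in> W \<Longrightarrow> - a \<in> W"
  using subm_sc[of W a "-1"] by (simp add: sc_m1)

lemma subm_diff: "subm W \<Longrightarrow> a \<in> W \<Longrightarrow> b \<in> W \<Longrightarrow> a - b \<in> W"
  using subm_add[of W a "- b"] subm_minus[of W b] by simp

lemma subm_plus: assumes "subm V" "subm W" shows "subm {a + b | a b. a \<in> V \<and> b \<in> W}" (is "subm ?X")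
  unfolding subm_def
proof (intro conjI ballI allI)
  have "0 + 0 \<in> ?X" using assms[THEN subm_0] by blast
  thus "0 \<in> ?X" by simp
next
  fix u v assume "u \<in> ?X" "v \<in> ?X"
  then obtain a b a' b' where *: "u = a + b" "v = a' + b'" "a \<in> V" "b \<in> W" "a' \<in> V" "b' \<in> W" by blast
  have "(a + a') + (b + b') \<in> ?X" using * assms subm_add by blast
  thus "u + v \<in> ?X" by (simp add: * algebra_simps)
next
  fix u x assume "u \<in> ?X"
  then obtain a b where *: "u = a + b" "a \<in> V" "b \<in> W" by blast
  have "sc x a + sc x b \<in> ?X" using * assms subm_sc by blast
  thus "sc x u \<in> ?X" by (simp add: * sc_add)
qed

definition sg :: "nat set \<Rightarrow> nat \<Rightarrow> 'p::comm_ring_1" where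
  "sg S s = (-1) ^ card {t\<in>S. t < s}"

lemma sg_sq: "sg S s * sg S s = 1"
  by (simp add: sg_def flip: power_mult_distrib)

lemma sg_remove_less:
  assumes "finite S" "s \<in> S" "s < t"
  shows "sg (S - {s}) t = - sg S t"
proof -
  have "{u\<in>S. u < t} = insert s {u\<in>S - {s}. u < t}" using assms by auto
  hence "card {u\<in>S. u < t} = Suc (card {u\<in>S - {s}. u < t})" using assms by simp
  thus ?thesis by (simp add: sg_def)
qed

lemma sg_remove_greater:
  assumes "t < s"
  shows "sg (S - {s}) t = sg S t"
proof -
  have "{u\<in>S. u < t} = {u\<in>S - {s}. u < t}" using assms by auto
  thus ?thesis by (simp add: sg_def)
qed

lemma sg_swap:
  assumes "finite S" "s \<in> S" "t \<in> S" "s \<noteq> t"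
  shows "sg (S - {t}) s * sg (S - {s}) t = - (sg S t * sg S s)"
proof (cases "s < t")
  case True
  thus ?thesis using assms by (simp add: sg_remove_less sg_remove_greater)
next
  case False
  hence "t < s" using assms by simp
  thus ?thesis using assms by (simp add: sg_remove_less sg_remove_greater)
qed

locale cech =
  fixes g :: "nat \<Rightarrow> 'p::comm_ring_1" and r :: nat
begin

definition idx :: "nat \<Rightarrow> nat set set" where
  "idx i = {S. S \<subseteq> {..<r} \<and> card S = i}"

text \<open>The Cech differential after clearing denominators: passing from the denominator
  \<open>prod g (S - {s}) ^ k\<close> to \<open>prod g S ^ k\<close> multiplies the numerator by
  \<open>g s ^ k\<close>. At level \<open>k\<close> this is the Koszul cochain complex on the powers
  \<open>g s ^ k\<close>, and the Cech complex is the colimit of these over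
  \<open>k\<close>.\<close>

definition koszul :: "nat \<Rightarrow> (nat set \<Rightarrow> 'p) \<Rightarrow> nat set \<Rightarrow> 'p" where
  "koszul k a S = (\<Sum>s\<in>S. sg S s * g s ^ k * a (S - {s}))"

definition dd :: "'p cochain \<Rightarrow> 'p cochain" where
  "dd c = (\<lambda>k. koszul k (c k))"

text \<open>A cochain \<open>c\<close> that is regular from level \<open>k\<close> on has the components \<open>c k S / (\<Prod>s\<in>S. g s)\<^sup>k\<close>
  in the Cech complex, and these do not depend on \<open>k\<close>.\<close>

definition reg :: "nat \<Rightarrow> nat \<Rightarrow> 'p cochain \<Rightarrow> bool" where
  "reg i k0 c \<longleftrightarrow> (\<forall>k\<ge>k0. \<forall>S\<in>idx i. c (Suc k) S = prod g S * c k S)"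

definition E :: "nat \<Rightarrow> 'p cochain set" where
  "E i = {c. \<exists>k0. reg i k0 c}"

text \<open>The representatives of zero in the Cech complex of \<open>P / L\<close>. One level up
  means one more factor \<open>prod g S\<close> in the numerators, so eventual membership in
  \<open>L\<close> is exactly vanishing in the localizations.\<close>

definition CC :: "nat \<Rightarrow> 'p set \<Rightarrow> 'p cochain set" where
  "CC i L = {c. \<exists>k0. reg i k0 c \<and> (\<forall>k\<ge>k0. \<forall>S\<in>idx i. c k S \<in> L)}"

text \<open>The full preimage in \<open>E i\<close> of the cocycles of \<open>P / L\<close>, and
  \<open>B\<close> below is that of the coboundaries. Both grow with \<open>L\<close>, and the map
  to the cohomology of a further quotient is induced by the inclusion.\<close>

definition Z :: "nat \<Rightarrow> 'p set \<Rightarrow> 'p cochain set" where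
  "Z i L = {c \<in> E i. dd c \<in> CC (Suc i) L}"

definition bd :: "nat \<Rightarrow> 'p cochain set" where
  "bd i = (case i of 0 \<Rightarrow> {0} | Suc j \<Rightarrow> dd ` E j)"

definition B :: "nat \<Rightarrow> 'p set \<Rightarrow> 'p cochain set" where
  "B i L = {b + u | b u. b \<in> bd i \<and> u \<in> CC i L}"

lemma idx_finite: "S \<in> idx i \<Longrightarrow> finite S"
  by (auto simp: idx_def intro: finite_subset)

lemma idx_remove: "S \<in> idx (Suc i) \<Longrightarrow> s \<in> S \<Longrightarrow> S - {s} \<in> idx i"
  using idx_finite[of S] by (auto simp: idx_def)

lemma idx_insert: "S \<in> idx i \<Longrightarrow> j < r \<Longrightarrow> j \<notin> S \<Longrightarrow> insert j S \<in> idx (Suc i)"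
  using idx_finite[of S] by (auto simp: idx_def)

lemma idx_0: "idx 0 = {{}}"
  by (auto simp: idx_def dest: finite_subset)

lemma koszul_add: "koszul k (a + b) S = koszul k a S + koszul k b S"
  and koszul_diff: "koszul k (a - b) S = koszul k a S - koszul k b S"
  and koszul_mult: "koszul k (\<lambda>S. x * a S) S = x * koszul k a S"
  by (simp_all add: koszul_def sum.distrib sum_subtractf sum_distrib_left algebra_simps)

lemma dd_add: "dd (a + b) = dd a + dd b"
  by (intro ext) (simp add: dd_def koszul_add)

lemma dd_diff: "dd (a - b) = dd a - dd b"
  by (intro ext) (simp add: dd_def koszul_diff)

lemma dd_sc: "dd (sc x a) = sc x (dd a)"
  by (intro ext) (simp add: dd_def sc_def koszul_mult)

lemma dd_0: "dd 0 = 0"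
  by (intro ext) (simp add: dd_def koszul_def)

lemma koszul_koszul: "koszul k (koszul k a) S = 0"
proof (cases "finite S")
  case True
  define f where "f = (\<lambda>s t. sg S s * g s ^ k * (sg (S - {s}) t * g t ^ k * a (S - {s} - {t})))"
  have anti: "f s t + f t s = 0" if "s \<in> S" "t \<in> S" "s < t" for s t
  proof -
    have "S - {t} - {s} = S - {s} - {t}" by auto
    moreover have "sg (S - {s}) t = (- sg S t :: 'p)" "sg (S - {t}) s = (sg S s :: 'p)"
      using sg_remove_less[OF True that(1,3)] sg_remove_greater[OF that(3)] by auto
    ultimately show ?thesis by (simp add: f_def algebra_simps)
  qed
  define T where "T = {(s, t). s \<in> S \<and> t \<in> S \<and> s < t}"
  have "T \<subseteq> S \<times> S" by (auto simp: T_def)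
  hence "finite T" using True by (meson finite_SigmaI finite_subset)
  moreover have "T \<inter> prod.swap ` T = {}" by (auto simp: T_def)
  ultimately have T: "finite T" "T \<inter> prod.swap ` T = {}" by auto
  have "koszul k (koszul k a) S = (\<Sum>s\<in>S. \<Sum>t\<in>S - {s}. f s t)"
    by (simp add: koszul_def f_def sum_distrib_left)
  also have "\<dots> = (\<Sum>(s, t)\<in>Sigma S (\<lambda>s. S - {s}). f s t)"
    using True by (simp add: sum.Sigma)
  also have "Sigma S (\<lambda>s. S - {s}) = T \<union> prod.swap ` T"
    by (auto simp: T_def image_iff)
  also have "(\<Sum>(s, t)\<in>\<dots>. f s t) = (\<Sum>(s, t)\<in>T. f s t) + (\<Sum>(s, t)\<in>prod.swap ` T. f s t)"
    by (rule sum.union_disjoint) (use T in auto)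
  also have "(\<Sum>(s, t)\<in>prod.swap ` T. f s t) = (\<Sum>(s, t)\<in>T. f t s)"
    by (subst sum.reindex) (auto simp: case_prod_unfold)
  also have "(\<Sum>(s, t)\<in>T. f s t) + \<dots> = (\<Sum>(s, t)\<in>T. f s t + f t s)"
    by (simp add: sum.distrib case_prod_unfold)
  also have "\<dots> = 0" using anti by (intro sum.neutral) (auto simp: T_def)
  finally show ?thesis .
qed (simp add: koszul_def)

lemma dd_dd: "dd (dd c) = 0"
  by (simp add: dd_def fun_eq_iff koszul_koszul)

lemma reg_mono: "reg i k0 c \<Longrightarrow> k0 \<le> k1 \<Longrightarrow> reg i k1 c"
  by (auto simp: reg_def)

lemma reg_add: "reg i k a \<Longrightarrow> reg i k b \<Longrightarrow> reg i k (a + b)"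
  and reg_diff: "reg i k a \<Longrightarrow> reg i k b \<Longrightarrow> reg i k (a - b)"
  and reg_sc: "reg i k a \<Longrightarrow> reg i k (sc x a)"
  and reg_0: "reg i k 0"
  by (auto simp: reg_def sc_def algebra_simps)

lemma reg_dd: assumes "reg i k c" shows "reg (Suc i) k (dd c)"
  unfolding reg_def
proof (intro allI impI ballI)
  fix k' S assume *: "k \<le> k'" "S \<in> idx (Suc i)"
  have "dd c (Suc k') S = (\<Sum>s\<in>S. prod g S * (sg S s * g s ^ k' * c k' (S - {s})))"
    unfolding dd_def koszul_def
  proof (rule sum.cong)
    fix s assume s: "s \<in> S"
    have "c (Suc k') (S - {s}) = prod g (S - {s}) * c k' (S - {s})"
      using assms * idx_remove[OF *(2) s] by (auto simp: reg_def)
    moreover have "prod g S = g s * prod g (S - {s})"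
      using s idx_finite[OF *(2)] by (simp add: prod.remove)
    ultimately show "sg S s * g s ^ Suc k' * c (Suc k') (S - {s})
        = prod g S * (sg S s * g s ^ k' * c k' (S - {s}))"
      by (simp add: algebra_simps)
  qed simp
  thus "dd c (Suc k') S = prod g S * dd c k' S"
    by (simp add: dd_def koszul_def sum_distrib_left)
qed

lemma reg_power: "reg i k0 c \<Longrightarrow> k0 \<le> k \<Longrightarrow> S \<in> idx i \<Longrightarrow> c k S = prod g S ^ (k - k0) * c k0 S"
proof (induction k)
  case (Suc k)
  show ?case
  proof (cases "k0 = Suc k")
    case False
    hence "k0 \<le> k" using Suc by simp
    thus ?thesis using Suc by (simp add: reg_def Suc_diff_le mult.assoc)
  qed simp
qed simp

lemma E_regI: "reg i k c \<Longrightarrow> c \<in> E i"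
  by (auto simp: E_def)

text \<open>By regularity all later values are multiples of the one at level \<open>k\<close>, so a
  single level decides.\<close>

lemma CC_regI: "reg i k c \<Longrightarrow> idl L \<Longrightarrow> (\<And>S. S \<in> idx i \<Longrightarrow> c k S \<in> L) \<Longrightarrow> c \<in> CC i L"
  unfolding CC_def mem_Collect_eq
proof (intro exI[of _ k] conjI allI impI ballI)
  fix k' S assume "reg i k c" "idl L" "\<And>S. S \<in> idx i \<Longrightarrow> c k S \<in> L" "k \<le> k'" "S \<in> idx i"
  thus "c k' S \<in> L" using reg_power[of i k c k' S] idl_mult[of L] by metis
qed

lemma CC_subset_E: "CC i L \<subseteq> E i"
  by (auto simp: CC_def E_def)

lemma CC_mono: "L \<subseteq> L' \<Longrightarrow> CC i L \<subseteq> CC i L'"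
  unfolding CC_def by blast

lemma CC_UNIV: "CC i UNIV = E i"
  by (auto simp: CC_def E_def)

lemma subm_CC: assumes "idl L" shows "subm (CC i L)"
  unfolding subm_def
proof (intro conjI ballI allI)
  show "0 \<in> CC i L" using reg_0 idl_0[OF assms] by (auto simp: CC_def)
next
  fix a b assume "a \<in> CC i L" "b \<in> CC i L"
  then obtain k k' where *: "reg i k a" "reg i k' b"
    "\<And>l S. l \<ge> k \<Longrightarrow> S \<in> idx i \<Longrightarrow> a l S \<in> L" "\<And>l S. l \<ge> k' \<Longrightarrow> S \<in> idx i \<Longrightarrow> b l S \<in> L"
    by (auto simp: CC_def)
  have "reg i (max k k') (a + b)" using * by (intro reg_add) (auto intro: reg_mono)
  thus "a + b \<in> CC i L" by (rule CC_regI[OF _ assms]) (auto simp: * idl_add[OF assms])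
next
  fix a x assume "a \<in> CC i L"
  then obtain k where "reg i k a" "\<And>l S. l \<ge> k \<Longrightarrow> S \<in> idx i \<Longrightarrow> a l S \<in> L" by (auto simp: CC_def)
  thus "sc x a \<in> CC i L"
    by (intro CC_regI[OF reg_sc assms]) (auto simp: sc_def idl_mult[OF assms])
qed

lemma subm_E: "subm (E i)"
  using subm_CC[OF idl_UNIV] by (simp add: CC_UNIV)

lemma dd_E: "c \<in> E i \<Longrightarrow> dd c \<in> E (Suc i)"
  by (auto simp: E_def dest: reg_dd)

lemma dd_CC: assumes "idl L" "c \<in> CC i L" shows "dd c \<in> CC (Suc i) L"
proof -
  obtain k where k: "reg i k c" "\<And>l S. l \<ge> k \<Longrightarrow> S \<in> idx i \<Longrightarrow> c l S \<in> L"
    using assms by (auto simp: CC_def)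
  have "dd c k S \<in> L" if "S \<in> idx (Suc i)" for S
    unfolding dd_def koszul_def
    using k(2)[of k] idx_remove[OF that] by (intro idl_sum idl_mult assms) auto
  thus ?thesis by (rule CC_regI[OF reg_dd[OF k(1)] assms(1)])
qed

lemma CC_colon: assumes "c \<in> E i" "sc x c \<in> CC i L" shows "c \<in> CC i (colon L x)"
proof -
  obtain k k' where *: "reg i k c" "\<And>l S. l \<ge> k' \<Longrightarrow> S \<in> idx i \<Longrightarrow> sc x c l S \<in> L"
    using assms by (auto simp: CC_def E_def)
  have "reg i (max k k') c" using * by (auto intro: reg_mono)
  thus ?thesis using *(2) unfolding CC_def by (auto simp: colon_def sc_def)
qed

lemma CC_colonD: assumes "idl L" "c \<in> CC i (colon L x)" shows "sc x c \<in> CC i L"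
proof -
  obtain k where *: "reg i k c" "\<And>l S. l \<ge> k \<Longrightarrow> S \<in> idx i \<Longrightarrow> c l S \<in> colon L x"
    using assms by (auto simp: CC_def)
  thus ?thesis by (intro CC_regI[OF reg_sc assms(1)]) (auto simp: colon_def sc_def)
qed

lemma sc_mem_CC: assumes "idl L" "x \<in> L" "c \<in> E i" shows "sc x c \<in> CC i L"
proof -
  obtain k where "reg i k c" using assms by (auto simp: E_def)
  thus ?thesis using assms by (intro CC_regI[OF reg_sc]) (auto simp: sc_def intro: idl_mult2)
qed

text \<open>The cochain of the fractions \<open>a S / prod g S ^ k0\<close>. Below \<open>k0\<close>
  truncated subtraction leaves the value \<open>a S\<close>, which is harmless because regularity is
  only claimed from \<open>k0\<close> on.\<close>

definition ext :: "nat \<Rightarrow> (nat set \<Rightarrow> 'p) \<Rightarrow> 'p cochain" where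
  "ext k0 a = (\<lambda>k S. prod g S ^ (k - k0) * a S)"

lemma reg_ext: "reg i k0 (ext k0 a)"
  by (auto simp: reg_def ext_def Suc_diff_le algebra_simps)

lemma ext_self: "ext k a k = a"
  by (simp add: ext_def)

text \<open>It is enough to split the numerators at one level \<open>k\<close>. The chosen cofactors
  of \<open>x\<close> are continued by \<open>ext\<close>, and the remainder is then regular and
  lies in \<open>L\<close> at level \<open>k\<close>.\<close>

lemma CC_adjoin:
  assumes "idl L" "u \<in> CC i (adjoin L x)"
  obtains v w where "v \<in> CC i L" "w \<in> E i" "u = v + sc x w"
proof -
  obtain k where k: "reg i k u" "\<And>l S. l \<ge> k \<Longrightarrow> S \<in> idx i \<Longrightarrow> u l S \<in> adjoin L x"
    using assms by (auto simp: CC_def)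
  have "\<exists>a. u k S - x * a \<in> L" if S: "S \<in> idx i" for S
  proof -
    obtain l a where "u k S = l + x * a" "l \<in> L" using k(2)[OF order.refl S] by (auto simp: adjoin_def)
    thus ?thesis by (intro exI[of _ a]) simp
  qed
  then obtain a where a: "\<And>S. S \<in> idx i \<Longrightarrow> u k S - x * a S \<in> L" by metis
  have "u - sc x (ext k a) \<in> CC i L"
    using k(1) reg_ext a by (intro CC_regI[OF reg_diff[OF _ reg_sc] assms(1)]) (auto simp: sc_def ext_self)
  thus thesis by (rule that[OF _ E_regI[OF reg_ext]]) simp
qed

lemma subm_bd: "subm (bd i)"
proof (cases i)
  case 0
  thus ?thesis by (simp add: bd_def subm_def sc_0)
next
  case (Suc j)
  show ?thesis unfolding subm_def Suc bd_def nat.case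
  proof (intro conjI ballI allI)
    show "0 \<in> dd ` E j" using subm_0[OF subm_E] dd_0 by (metis imageI)
    show "a + b \<in> dd ` E j" if "a \<in> dd ` E j" "b \<in> dd ` E j" for a b
      using that subm_add[OF subm_E] by (auto simp flip: dd_add)
    show "sc x a \<in> dd ` E j" if "a \<in> dd ` E j" for a x
      using that subm_sc[OF subm_E] by (auto simp flip: dd_sc)
  qed
qed

lemma bd_E: "b \<in> bd i \<Longrightarrow> b \<in> E i"
  using subm_0[OF subm_E] by (auto simp: bd_def dd_E split: nat.splits)

lemma dd_bd: "b \<in> bd i \<Longrightarrow> dd b = 0"
  by (auto simp: bd_def dd_0 dd_dd split: nat.splits)

lemma dd_mem_bd: "b \<in> E i \<Longrightarrow> dd b \<in> bd (Suc i)"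
  by (simp add: bd_def)

lemma subm_B: "idl L \<Longrightarrow> subm (B i L)"
  unfolding B_def by (intro subm_plus subm_bd subm_CC)

lemma subm_Z: assumes "idl L" shows "subm (Z i L)"
  unfolding subm_def
  by (simp add: Z_def dd_0 dd_add dd_sc subm_0[OF subm_E] subm_0[OF subm_CC[OF assms]]
      subm_add[OF subm_E] subm_add[OF subm_CC[OF assms]] subm_sc[OF subm_E] subm_sc[OF subm_CC[OF assms]])

lemma B_memI: "b \<in> bd i \<Longrightarrow> u \<in> CC i L \<Longrightarrow> b + u \<in> B i L"
  by (auto simp: B_def)

lemma CC_subset_B: "CC i L \<subseteq> B i L"
  using B_memI[OF subm_0[OF subm_bd]] by auto

lemma bd_subset_B: "idl L \<Longrightarrow> bd i \<subseteq> B i L"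
  using B_memI[OF _ subm_0[OF subm_CC]] by force

lemma B_mono: "L \<subseteq> L' \<Longrightarrow> B i L \<subseteq> B i L'"
  using CC_mono[of L L' i] unfolding B_def by blast

lemma Z_mono: "L \<subseteq> L' \<Longrightarrow> Z i L \<subseteq> Z i L'"
  using CC_mono[of L L' "Suc i"] by (auto simp: Z_def)

lemma Z_E: "c \<in> Z i L \<Longrightarrow> c \<in> E i"
  by (simp add: Z_def)

lemma B_subset_Z: assumes "idl L" shows "B i L \<subseteq> Z i L"
proof
  fix c assume "c \<in> B i L"
  then obtain b u where bu: "c = b + u" "b \<in> bd i" "u \<in> CC i L" by (auto simp: B_def)
  have "dd c \<in> CC (Suc i) L" using bu dd_CC[OF assms bu(3)] by (simp add: dd_add dd_bd)
  moreover have "c \<in> E i" using bu bd_E CC_subset_E subm_add[OF subm_E] by blast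
  ultimately show "c \<in> Z i L" by (simp add: Z_def)
qed

section \<open>The contracting homotopy and torsion of the cohomology\<close>

definition homotopy :: "nat \<Rightarrow> (nat set \<Rightarrow> 'p) \<Rightarrow> nat set \<Rightarrow> 'p" where
  "homotopy j a S = (if j \<in> S then 0 else sg (insert j S) j * a (insert j S))"

text \<open>\<open>homotopy j\<close> is contraction with the \<open>j\<close>-th basis vector. If
  \<open>j\<close> is in \<open>S\<close>, only the summand that removes \<open>j\<close> survives;
  otherwise the remaining sums cancel, because removing \<open>s\<close> and inserting
  \<open>j\<close> anticommute by \<open>sg_swap\<close>.\<close>

lemma koszul_homotopy:
  assumes S: "finite S"
  shows "koszul k (homotopy j a) S + homotopy j (koszul k a) S = g j ^ k * a S"
proof (cases "j \<in> S")
  case True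
  have "koszul k (homotopy j a) S = sg S j * g j ^ k * homotopy j a (S - {j})"
    unfolding koszul_def using True S by (subst sum.remove[of _ j]) (auto simp: homotopy_def intro!: sum.neutral)
  also have "\<dots> = (sg S j * sg S j) * (g j ^ k * a S)"
    using True by (simp add: homotopy_def insert_absorb algebra_simps)
  finally show ?thesis using True by (simp add: sg_sq) (simp add: homotopy_def)
next
  case False
  define U where "U = insert j S"
  have U: "finite U" "j \<in> U" "S = U - {j}" using S False by (auto simp: U_def)
  have "koszul k a U = sg U j * g j ^ k * a S + (\<Sum>s\<in>S. sg U s * g s ^ k * a (U - {s}))"
    unfolding koszul_def using U by (subst sum.remove[of _ j]) auto
  hence "homotopy j (koszul k a) S
      = (sg U j * sg U j) * (g j ^ k * a S) + sg U j * (\<Sum>s\<in>S. sg U s * g s ^ k * a (U - {s}))"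
    using False by (simp add: homotopy_def algebra_simps flip: U_def)
  moreover have "koszul k (homotopy j a) S = - (sg U j * (\<Sum>s\<in>S. sg U s * g s ^ k * a (U - {s})))"
    unfolding koszul_def sum_distrib_left sum_negf[symmetric]
  proof (rule sum.cong)
    fix s assume s: "s \<in> S"
    have "s \<noteq> j" "s \<in> U" using s False U by auto
    hence "insert j (S - {s}) = U - {s}" by (auto simp: U_def)
    hence "sg S s * g s ^ k * homotopy j a (S - {s}) = (sg S s * sg (U - {s}) j) * (g s ^ k * a (U - {s}))"
      using False by (simp add: homotopy_def mult_ac)
    moreover have "sg S s * sg (U - {s}) j = - (sg U j * sg U s :: 'p)"
      using sg_swap[OF U(1) \<open>s \<in> U\<close> U(2) \<open>s \<noteq> j\<close>] U(3) by simp
    ultimately show "sg S s * g s ^ k * homotopy j a (S - {s}) = - (sg U j * (sg U s * g s ^ k * a (U - {s})))"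
      by (simp add: mult_ac)
  qed simp
  ultimately show ?thesis by (simp add: sg_sq)
qed

text \<open>At a level \<open>k\<close> where \<open>c\<close> is regular and \<open>dd c\<close>
  has values in \<open>L\<close>, the homotopy exhibits \<open>g j ^ k * c\<close> as the
  differential of \<open>homotopy j (c k)\<close> up to values in \<open>L\<close>. In degree 0 that
  differential is an empty sum.\<close>

lemma torsion_generator:
  assumes L: "idl L" and c: "c \<in> Z i L" and j: "j < r"
  shows "\<exists>k. sc (g j ^ k) c \<in> B i L"
proof -
  obtain k1 k2 where k: "reg i k1 c" "\<And>k S. k \<ge> k2 \<Longrightarrow> S \<in> idx (Suc i) \<Longrightarrow> dd c k S \<in> L"
    using c by (auto simp: Z_def CC_def E_def)
  define k where "k = max k1 k2"
  have reg: "reg i k c" using reg_mono[OF k(1)] by (simp add: k_def)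
  have "homotopy j (koszul k (c k)) S \<in> L" if "S \<in> idx i" for S
    using k(2)[of k "insert j S"] idx_insert[OF that j] idl_0[OF L] idl_mult[OF L]
    by (auto simp: homotopy_def k_def dd_def)
  hence hom: "g j ^ k * c k S - koszul k (homotopy j (c k)) S \<in> L" if "S \<in> idx i" for S
    using koszul_homotopy[OF idx_finite[OF that], of k j "c k"] that by (metis add_diff_cancel_left')
  show ?thesis
  proof (cases i)
    case 0
    have "sc (g j ^ k) c \<in> CC i L"
      using hom by (intro CC_regI[OF reg_sc[OF reg] L]) (auto simp: sc_def 0 idx_0 koszul_def)
    thus ?thesis using CC_subset_B by blast
  next
    case (Suc i')
    define b where "b = ext k (homotopy j (c k))"
    have "sc (g j ^ k) c - dd b \<in> CC i L"
    proof (rule CC_regI[OF reg_diff[OF reg_sc[OF reg]] L])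
      show "reg i k (dd b)" unfolding b_def Suc by (intro reg_dd reg_ext)
      show "(sc (g j ^ k) c - dd b) k S \<in> L" if "S \<in> idx i" for S
        using hom[OF that] by (simp add: sc_def b_def dd_def ext_self)
    qed
    moreover have "dd b \<in> bd i" unfolding Suc b_def by (intro dd_mem_bd E_regI[OF reg_ext])
    ultimately show ?thesis using B_memI[of "dd b" i "sc (g j ^ k) c - dd b" L] by auto
  qed
qed

text \<open>Instead of the binomial theorem, one factor is split off:
  \<open>(a + b) ^ (m + n) * c\<close> is the sum of \<open>(a + b) ^ (m + n - 1)\<close> applied to
  \<open>a * c\<close> and to \<open>b * c\<close>, and in each summand one of the two exponents
  \<open>m\<close>, \<open>n\<close> has dropped.\<close>

lemma torsion_add:
  assumes "subm W"
  shows "sc (a ^ m) c \<in> W \<Longrightarrow> sc (b ^ n) c \<in> W \<Longrightarrow> sc ((a + b) ^ (m + n)) c \<in> W"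
proof (induction "m + n" arbitrary: m n c)
  case 0
  thus ?case by simp
next
  case (Suc l)
  show ?case
  proof (cases "m = 0 \<or> n = 0")
    case True
    hence "c \<in> W" using Suc.prems by (auto simp: sc_1)
    thus ?thesis using subm_sc[OF assms] by blast
  next
    case False
    then obtain m' n' where mn: "m = Suc m'" "n = Suc n'" by (metis not0_implies_Suc)
    have "sc (a ^ m) (sc b c) \<in> W" "sc (b ^ n) (sc a c) \<in> W"
      using subm_sc[OF assms Suc.prems(1), of b] subm_sc[OF assms Suc.prems(2), of a]
      by (simp_all add: sc_sc mult.commute)
    moreover have "sc (a ^ m') (sc a c) \<in> W" "sc (b ^ n') (sc b c) \<in> W"
      using Suc.prems by (simp_all add: sc_sc mn mult.commute)
    ultimately have "sc ((a + b) ^ (m' + n)) (sc a c) \<in> W" "sc ((a + b) ^ (m + n')) (sc b c) \<in> W"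
      using Suc.hyps(1)[of m' n "sc a c"] Suc.hyps(1)[of m n' "sc b c"] Suc.hyps(2) mn by auto
    moreover have "m' + n = l" "m + n' = l" using Suc.hyps(2) mn by auto
    ultimately have "sc ((a + b) ^ l) (sc a c) + sc ((a + b) ^ l) (sc b c) \<in> W"
      using subm_add[OF assms] by simp
    hence "sc ((a + b) ^ Suc l) c \<in> W" by (simp add: sc_sc algebra_simps flip: sc_add_left)
    thus ?thesis using Suc.hyps(2) by simp
  qed
qed

end

section \<open>Local cohomology is Artinian\<close>

text \<open>Let the diagonal be constant from \<open>D\<close> on. For \<open>l \<ge> D\<close> and
  \<open>n \<ge> D\<close> the set \<open>V n l\<close> lies between two diagonal entries beyond
  \<open>D\<close>, hence equals \<open>V D D\<close>. Only the finitely many \<open>l < D\<close>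
  remain, and their own bounds have a maximum.\<close>

lemma stable_double_chain:
  fixes V :: "nat \<Rightarrow> nat \<Rightarrow> 's set"
  assumes dec1: "\<And>n l. V (Suc n) l \<subseteq> V n l" and dec2: "\<And>n l. V n (Suc l) \<subseteq> V n l"
    and rows: "\<And>l. \<exists>N. \<forall>n\<ge>N. V n l = V N l" and diag: "\<exists>N. \<forall>n\<ge>N. V n n = V N N"
  shows "\<exists>N. \<forall>l. \<forall>n\<ge>N. V n l = V N l"
proof -
  obtain D where D: "\<And>n. n \<ge> D \<Longrightarrow> V n n = V D D" using diag by blast
  obtain R where R: "\<And>l n. n \<ge> R l \<Longrightarrow> V n l = V (R l) l" using rows by metis
  have mono: "V n' l' \<subseteq> V n l" if "n \<le> n'" "l \<le> l'" for n n' l l'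
    using lift_Suc_antimono_le[of "\<lambda>n. V n l", OF dec1 that(1)]
      lift_Suc_antimono_le[of "\<lambda>l. V n' l", OF dec2 that(2)] by blast
  define N where "N = Max (insert D (R ` {..<D}))"
  have N: "D \<le> N" "\<And>l. l < D \<Longrightarrow> R l \<le> N" by (auto simp: N_def)
  have "V n l = V N l" if "n \<ge> N" for n l
  proof (cases "l < D")
    case True
    thus ?thesis using R[of l n] R[of l N] N(2)[OF True] that by simp
  next
    case False
    have "V n l = V D D" if "D \<le> n" for n
    proof
      show "V n l \<subseteq> V D D" using False that by (intro mono) auto
      have "V D D = V (max n l) (max n l)" using D[of "max n l"] that by simp
      also have "\<dots> \<subseteq> V n l" by (intro mono) auto
      finally show "V D D \<subseteq> V n l" .
    qed
    thus ?thesis using N that by simp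
  qed
  thus ?thesis by blast
qed

context cech
begin

definition artinian :: "nat \<Rightarrow> 'p set \<Rightarrow> bool" where
  "artinian i L \<longleftrightarrow> (\<forall>W. (\<forall>n. subm (W n) \<and> B i L \<subseteq> W n \<and> W n \<subseteq> Z i L \<and> W (Suc n) \<subseteq> W n)
     \<longrightarrow> (\<exists>N. \<forall>n\<ge>N. W n = W N))"

lemma artinianD:
  assumes "artinian i L" "\<And>n. subm (W n)" "\<And>n. B i L \<subseteq> W n" "\<And>n. W n \<subseteq> Z i L"
    "\<And>n. W (Suc n) \<subseteq> W n"
  shows "\<exists>N. \<forall>n\<ge>N. W n = W N"
  using assms unfolding artinian_def by blast

lemma artinianI:
  assumes "\<And>W. (\<And>n::nat. subm (W n)) \<Longrightarrow> (\<And>n. B i L \<subseteq> W n) \<Longrightarrow> (\<And>n. W n \<subseteq> Z i L)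
    \<Longrightarrow> (\<And>m n. m \<le> n \<Longrightarrow> W n \<subseteq> W m) \<Longrightarrow> \<exists>N. \<forall>n\<ge>N. W N \<subseteq> W n"
  shows "artinian i L"
  unfolding artinian_def
proof (intro allI impI)
  fix W :: "nat \<Rightarrow> 'p cochain set" assume *: "\<forall>n. subm (W n) \<and> B i L \<subseteq> W n \<and> W n \<subseteq> Z i L \<and> W (Suc n) \<subseteq> W n"
  have mono: "W n \<subseteq> W m" if "m \<le> n" for m n
    using lift_Suc_antimono_le[of W, OF _ that] * by blast
  obtain N where "\<And>n. n \<ge> N \<Longrightarrow> W N \<subseteq> W n" using assms[of W] * mono by blast
  thus "\<exists>N. \<forall>n\<ge>N. W n = W N" using mono by blast
qed

lemma sc_B_colon: assumes "idl L" "c \<in> B i (colon L x)" shows "sc x c \<in> B i L"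
proof -
  obtain b u where "c = b + u" "b \<in> bd i" "u \<in> CC i (colon L x)" using assms by (auto simp: B_def)
  thus ?thesis using subm_sc[OF subm_bd] CC_colonD[OF assms(1)] by (auto simp: sc_add intro!: B_memI)
qed

lemma Z_colonI: assumes "c \<in> E i" "sc x (dd c) \<in> CC (Suc i) L" shows "c \<in> Z i (colon L x)"
  unfolding Z_def using assms CC_colon[OF dd_E[OF assms(1)]] by simp

text \<open>Exactness in the middle of the cohomology sequence of \<open>P / (L : x)\<close>,
  \<open>P / L\<close> and \<open>P / (L + x P)\<close>, where the first map is multiplication by
  \<open>x\<close>.\<close>

lemma middle_exact:
  assumes L: "idl L" and c: "c \<in> Z i L" "c \<in> B i (adjoin L x)"
  shows "\<exists>c'\<in>Z i (colon L x). c - sc x c' \<in> B i L"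
proof -
  obtain b u where bu: "c = b + u" "b \<in> bd i" "u \<in> CC i (adjoin L x)" using c by (auto simp: B_def)
  obtain v w where vw: "v \<in> CC i L" "w \<in> E i" "u = v + sc x w" using CC_adjoin[OF L bu(3)] by blast
  have "sc x (dd w) = dd c - dd v" by (simp add: bu vw dd_add dd_bd[OF bu(2)] dd_sc)
  also have "\<dots> \<in> CC (Suc i) L"
    using c dd_CC[OF L vw(1)] subm_diff[OF subm_CC[OF L]] by (simp add: Z_def)
  finally have "w \<in> Z i (colon L x)" by (rule Z_colonI[OF vw(2)])
  moreover have "c - sc x w \<in> B i L" using B_memI[OF bu(2) vw(1)] by (simp add: bu vw)
  ultimately show ?thesis by blast
qed

text \<open>A chain \<open>W\<close> is controlled by its preimages \<open>V\<close> under
  multiplication by \<open>x\<close> and its images \<open>U\<close> modulo \<open>x\<close>. Once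
  both are constant, an element of \<open>W N\<close> is corrected by one of \<open>W n\<close> to
  have image zero; by \<open>middle_exact\<close> the difference then comes from
  \<open>V N = V n\<close>.\<close>

lemma artinian_middle:
  assumes L: "idl L" and a1: "artinian i (colon L x)" and a2: "artinian i (adjoin L x)"
  shows "artinian i L"
proof (rule artinianI)
  fix W :: "nat \<Rightarrow> 'p cochain set" assume W: "\<And>n. subm (W n)" "\<And>n. B i L \<subseteq> W n" "\<And>n. W n \<subseteq> Z i L"
    "\<And>m n. m \<le> n \<Longrightarrow> W n \<subseteq> W m"
  define V where "V n = {c \<in> Z i (colon L x). sc x c \<in> W n}" for n
  define U where "U n = {a + b | a b. a \<in> W n \<and> b \<in> B i (adjoin L x)}" for n
  have Lx: "idl (adjoin L x)" "idl (colon L x)" by (rule idl_adjoin[OF L], rule idl_colon[OF L])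
  have "\<exists>N. \<forall>n\<ge>N. V n = V N"
  proof (rule artinianD[OF a1, of V])
    fix n
    show "subm (V n)" unfolding subm_def
    proof (intro conjI ballI allI)
      show "0 \<in> V n" using subm_0[OF subm_Z[OF Lx(2)]] subm_0[OF W(1)] by (simp add: V_def sc_0)
      show "a + b \<in> V n" if "a \<in> V n" "b \<in> V n" for a b
        using that subm_add[OF subm_Z[OF Lx(2)]] subm_add[OF W(1)] by (simp add: V_def sc_add)
      show "sc y a \<in> V n" if "a \<in> V n" for a y
        using that subm_sc[OF subm_Z[OF Lx(2)]] subm_sc[OF W(1), of "sc x a" n y]
        by (simp add: V_def sc_sc mult.commute)
    qed
    show "B i (colon L x) \<subseteq> V n"
      using B_subset_Z[OF Lx(2)] sc_B_colon[OF L] W(2) unfolding V_def by blast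
    show "V n \<subseteq> Z i (colon L x)" "V (Suc n) \<subseteq> V n" using W(4)[of n "Suc n"] by (auto simp: V_def)
  qed
  then obtain N1 where N1: "\<And>n. n \<ge> N1 \<Longrightarrow> V n = V N1" by blast
  have "\<exists>N. \<forall>n\<ge>N. U n = U N"
  proof (rule artinianD[OF a2, of U])
    fix n
    show "subm (U n)" unfolding U_def by (intro subm_plus W subm_B Lx)
    show "B i (adjoin L x) \<subseteq> U n" using subm_0[OF W(1)] by (force simp: U_def)
    show "U n \<subseteq> Z i (adjoin L x)"
      using W(3)[of n] Z_mono[OF subset_adjoin[of L x], of i] B_subset_Z[OF Lx(1), of i]
        subm_add[OF subm_Z[OF Lx(1)]] unfolding U_def by blast
    show "U (Suc n) \<subseteq> U n" using W(4)[of n "Suc n"] unfolding U_def by fastforce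
  qed
  then obtain N2 where N2: "\<And>n. n \<ge> N2 \<Longrightarrow> U n = U N2" by blast
  define N where "N = max N1 N2"
  have "W N \<subseteq> W n" if n: "N \<le> n" for n
  proof
    fix w assume w: "w \<in> W N"
    have "w + 0 \<in> U N" unfolding U_def using w subm_0[OF subm_B[OF Lx(1)]] by blast
    hence "w \<in> U n" using N2[of n] N2[of N] n by (simp add: N_def)
    then obtain w1 b where wb: "w = w1 + b" "w1 \<in> W n" "b \<in> B i (adjoin L x)" unfolding U_def by blast
    have "w1 \<in> W N" using wb W(4)[OF n] by blast
    hence b: "b \<in> W N" using subm_diff[OF W(1) w] wb by (metis add_diff_cancel_left')
    obtain c where c: "c \<in> Z i (colon L x)" "b - sc x c \<in> B i L"
      using middle_exact[OF L _ wb(3)] b W(3)[of N] by blast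
    have "sc x c = b - (b - sc x c)" by simp
    hence "sc x c \<in> W N" using subm_diff[OF W(1) b] c(2) W(2)[of N] by (metis subsetD)
    hence "c \<in> V N" using c by (simp add: V_def)
    hence "c \<in> V n" using N1[of n] N1[of N] n by (simp add: N_def)
    hence "sc x c \<in> W n" by (simp add: V_def)
    hence "(b - sc x c) + sc x c \<in> W n" using c(2) W(2)[of n] subm_add[OF W(1)] by blast
    thus "w \<in> W n" using subm_add[OF W(1) wb(2)] wb(1) by simp
  qed
  thus "\<exists>N. \<forall>n\<ge>N. W N \<subseteq> W n" by blast
qed

text \<open>The argument of Melkersson: \<open>H\<close> is \<open>x\<close>-torsion and its \<open>x\<close>-socle is a quotient of the
  cohomology of \<open>A / (L + x A)\<close> in the previous degree. The two-parameter chain \<open>V\<close> consists of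
  preimages of \<open>x\<^sup>l W n \<inter> (0 : x)\<close>.\<close>

lemma artinian_nonzerodivisor:
  assumes L: "idl L" and reg: "colon L x = L" and a: "artinian i (adjoin L x)"
    and torsion: "\<And>c. c \<in> Z (Suc i) L \<Longrightarrow> \<exists>l. sc (x ^ l) c \<in> B (Suc i) L"
  shows "artinian (Suc i) L"
proof (rule artinianI)
  fix W :: "nat \<Rightarrow> 'p cochain set" assume W: "\<And>n. subm (W n)" "\<And>n. B (Suc i) L \<subseteq> W n" "\<And>n. W n \<subseteq> Z (Suc i) L"
    "\<And>m n. m \<le> n \<Longrightarrow> W n \<subseteq> W m"
  have Lx: "idl (adjoin L x)" by (rule idl_adjoin[OF L])
  \<comment> \<open>The condition says that the connecting map, which divides \<open>dd b\<close> by
    \<open>x\<close> modulo \<open>L\<close>, sends the class of \<open>b\<close> to that of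
    \<open>x ^ l * w\<close> for some \<open>w\<close> in \<open>W n\<close>; the boundary
    \<open>\<beta>\<close> makes this independent of representatives.\<close>
  define V where "V n l = {b \<in> E i. \<exists>w\<in>W n. \<exists>\<beta>\<in>B (Suc i) L. dd b - sc x (sc (x ^ l) w + \<beta>) \<in> CC (Suc i) L}" for n l
  have VI: "b \<in> V n l" if "b \<in> E i" "w \<in> W n" "\<beta> \<in> B (Suc i) L" "dd b - sc x (sc (x ^ l) w + \<beta>) \<in> CC (Suc i) L"
    for b w \<beta> n l using that unfolding V_def by blast
  have V: "subm (V n l) \<and> B i (adjoin L x) \<subseteq> V n l \<and> V n l \<subseteq> Z i (adjoin L x)" for n l
  proof (intro conjI)
    show "subm (V n l)" unfolding subm_def
    proof (intro conjI ballI allI)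
      show "0 \<in> V n l"
        by (rule VI[of 0 0 n 0]) (simp_all add: sc_0 dd_0 subm_0[OF subm_E] subm_0[OF W(1)]
            subm_0[OF subm_B[OF L]] subm_0[OF subm_CC[OF L]])
    next
      fix a b assume "a \<in> V n l" "b \<in> V n l"
      then obtain w \<beta> w' \<beta>' where *: "a \<in> E i" "b \<in> E i" "w \<in> W n" "w' \<in> W n" "\<beta> \<in> B (Suc i) L" "\<beta>' \<in> B (Suc i) L"
        "dd a - sc x (sc (x ^ l) w + \<beta>) \<in> CC (Suc i) L" "dd b - sc x (sc (x ^ l) w' + \<beta>') \<in> CC (Suc i) L"
        unfolding V_def by blast
      have "dd (a + b) - sc x (sc (x ^ l) (w + w') + (\<beta> + \<beta>'))
        = (dd a - sc x (sc (x ^ l) w + \<beta>)) + (dd b - sc x (sc (x ^ l) w' + \<beta>'))"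
        by (simp add: dd_add sc_add)
      also have "\<dots> \<in> CC (Suc i) L" using * subm_add[OF subm_CC[OF L]] by blast
      finally show "a + b \<in> V n l"
        using * by (intro VI[of "a + b" "w + w'" n "\<beta> + \<beta>'"] subm_add[OF W(1)] subm_add[OF subm_B[OF L]] subm_add[OF subm_E])
    next
      fix a y assume "a \<in> V n l"
      then obtain w \<beta> where *: "a \<in> E i" "w \<in> W n" "\<beta> \<in> B (Suc i) L"
        "dd a - sc x (sc (x ^ l) w + \<beta>) \<in> CC (Suc i) L"
        unfolding V_def by blast
      have "dd (sc y a) - sc x (sc (x ^ l) (sc y w) + sc y \<beta>) = sc y (dd a - sc x (sc (x ^ l) w + \<beta>))"
        by (simp add: dd_sc sc_add sc_diff sc_sc mult_ac)
      also have "\<dots> \<in> CC (Suc i) L" using * subm_sc[OF subm_CC[OF L]] by blast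
      finally show "sc y a \<in> V n l"
        using * by (intro VI[of "sc y a" "sc y w" n "sc y \<beta>"] subm_sc[OF W(1)] subm_sc[OF subm_B[OF L]] subm_sc[OF subm_E])
    qed
    show "B i (adjoin L x) \<subseteq> V n l"
    proof
      fix c assume c: "c \<in> B i (adjoin L x)"
      then obtain b u where bu: "c = b + u" "b \<in> bd i" "u \<in> CC i (adjoin L x)" by (auto simp: B_def)
      obtain v w where vw: "v \<in> CC i L" "w \<in> E i" "u = v + sc x w" using CC_adjoin[OF L bu(3)] by blast
      have "dd w \<in> B (Suc i) L" using vw bd_subset_B[OF L] dd_mem_bd by blast
      moreover have "dd c - sc x (sc (x ^ l) 0 + dd w) = dd v"
        by (simp add: bu vw dd_add dd_bd[OF bu(2)] dd_sc sc_0)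
      ultimately show "c \<in> V n l"
        using c Z_E[of c] B_subset_Z[OF Lx, of i] subm_0[OF W(1)] dd_CC[OF L vw(1)]
        by (intro VI[of c 0 n "dd w"]) auto
    qed
    show "V n l \<subseteq> Z i (adjoin L x)"
    proof
      fix b assume "b \<in> V n l"
      then obtain w \<beta> where *: "b \<in> E i" "w \<in> W n" "\<beta> \<in> B (Suc i) L"
        "dd b - sc x (sc (x ^ l) w + \<beta>) \<in> CC (Suc i) L" unfolding V_def by blast
      have "sc (x ^ l) w + \<beta> \<in> E (Suc i)"
        using * W(3) B_subset_Z[OF L] Z_E subm_add[OF subm_E] subm_sc[OF subm_E] by (meson subsetD)
      hence "sc x (sc (x ^ l) w + \<beta>) \<in> CC (Suc i) (adjoin L x)"
        by (intro sc_mem_CC Lx self_mem_adjoin L)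
      moreover have "dd b - sc x (sc (x ^ l) w + \<beta>) \<in> CC (Suc i) (adjoin L x)"
        using * CC_mono[OF subset_adjoin] by blast
      ultimately have "dd b - sc x (sc (x ^ l) w + \<beta>) + sc x (sc (x ^ l) w + \<beta>) \<in> CC (Suc i) (adjoin L x)"
        using subm_add[OF subm_CC[OF Lx]] by blast
      thus "b \<in> Z i (adjoin L x)" using * by (simp add: Z_def)
    qed
  qed
  have dec1: "V (Suc n) l \<subseteq> V n l" for n l
    using W(4)[of n "Suc n"] unfolding V_def by fastforce
  have dec2: "V n (Suc l) \<subseteq> V n l" for n l
  proof
    fix b assume "b \<in> V n (Suc l)"
    then obtain w \<beta> where *: "b \<in> E i" "w \<in> W n" "\<beta> \<in> B (Suc i) L"
      "dd b - sc x (sc (x ^ Suc l) w + \<beta>) \<in> CC (Suc i) L" unfolding V_def by blast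
    moreover have "sc (x ^ Suc l) w = sc (x ^ l) (sc x w)" by (simp add: sc_sc mult.commute)
    ultimately show "b \<in> V n l" using subm_sc[OF W(1)] by (intro VI[of b "sc x w" n \<beta>]) simp_all
  qed
  obtain N where N: "\<And>l n. N \<le> n \<Longrightarrow> V n l = V N l"
  proof -
    have "\<exists>N. \<forall>n\<ge>N. V n l = V N l" for l
      by (rule artinianD[OF a, of "\<lambda>n. V n l"]) (use V dec1 in auto)
    moreover have "\<exists>N. \<forall>n\<ge>N. V n n = V N N"
      by (rule artinianD[OF a, of "\<lambda>n. V n n"]) (use V dec1 dec2 in blast)+
    ultimately have "\<exists>N. \<forall>l. \<forall>n\<ge>N. V n l = V N l"
      using stable_double_chain[of V, OF dec1 dec2] by blast
    thus thesis using that by blast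
  qed
  \<comment> \<open>The torsion exponents \<open>l\<close> are unbounded, which is why
    \<open>N\<close> had to be independent of \<open>l\<close>. If \<open>x ^ Suc l * w\<close> is
    \<open>dd b\<close> up to \<open>L\<close>, then \<open>b\<close> is in
    \<open>V N l = V n l\<close>, so some \<open>w'\<close> in \<open>W n\<close> satisfies
    \<open>x ^ l * w = x ^ l * w'\<close> in cohomology. The difference \<open>w - w'\<close> is
    killed by the smaller power \<open>x ^ l\<close>.\<close>
  have "w \<in> W n" if n: "N \<le> n" and "w \<in> W N" "sc (x ^ l) w \<in> B (Suc i) L" for n w l
    using that(2,3)
  proof (induction l arbitrary: w)
    case 0
    thus ?case using W(2) by (auto simp: sc_1)
  next
    case (Suc l)
    then obtain b u where bu: "sc (x ^ Suc l) w = dd b + u" "b \<in> E i" "u \<in> CC (Suc i) L"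
      by (auto simp: B_def bd_def)
    have "dd b - sc x (sc (x ^ l) w + 0) = - u" using bu by (simp add: sc_sc)
    hence "b \<in> V N l"
      using bu Suc.prems subm_minus[OF subm_CC[OF L]] subm_0[OF subm_B[OF L]] by (intro VI[of b w N 0]) auto
    hence "b \<in> V n l" using N[OF n] by simp
    then obtain w' \<beta> where *: "w' \<in> W n" "\<beta> \<in> B (Suc i) L"
      "dd b - sc x (sc (x ^ l) w' + \<beta>) \<in> CC (Suc i) L" unfolding V_def by blast
    have E: "sc (x ^ l) (w - w') - \<beta> \<in> E (Suc i)"
      using * Suc.prems(1) W(3) B_subset_Z[OF L] Z_E subm_diff[OF subm_E] subm_sc[OF subm_E] by (meson subsetD)
    have "sc x (sc (x ^ l) (w - w') - \<beta>) = (dd b - sc x (sc (x ^ l) w' + \<beta>)) + u"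
      using bu(1) by (simp add: sc_add sc_diff sc_sc algebra_simps)
    also have "\<dots> \<in> CC (Suc i) L" using *(3) bu(3) subm_add[OF subm_CC[OF L]] by blast
    finally have "sc (x ^ l) (w - w') - \<beta> \<in> CC (Suc i) L" using CC_colon[OF E, of x L] reg by simp
    hence "(sc (x ^ l) (w - w') - \<beta>) + \<beta> \<in> B (Suc i) L"
      using CC_subset_B *(2) subm_add[OF subm_B[OF L]] by blast
    moreover have "w - w' \<in> W N" using Suc.prems(1) *(1) W(4)[OF n] subm_diff[OF W(1)] by blast
    ultimately have "w - w' \<in> W n" using Suc.IH by simp
    thus ?case using subm_add[OF W(1) _ *(1)] by (metis diff_add_cancel)
  qed
  hence "W N \<subseteq> W n" if "N \<le> n" for n
    using that torsion W(3)[of N] by blast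
  thus "\<exists>N. \<forall>n\<ge>N. W N \<subseteq> W n" by blast
qed

lemma artinian_trivial: assumes "Z i L \<subseteq> B i L" shows "artinian i L"
proof (rule artinianI)
  fix W :: "nat \<Rightarrow> 'p cochain set" assume W: "\<And>n. B i L \<subseteq> W n" "\<And>n. W n \<subseteq> Z i L"
  have "W n = Z i L" for n using W[of n] assms by blast
  thus "\<exists>N. \<forall>n\<ge>N. W N \<subseteq> W n" by blast
qed

text \<open>In degree 0 there are no boundaries to account for, so the factors \<open>x\<close> can
  be cancelled one at a time from the values in \<open>L\<close>.\<close>

lemma Z0_regular:
  assumes L: "idl L" "colon L x = L" and c: "c \<in> Z 0 L" "sc (x ^ l) c \<in> B 0 L"
  shows "c \<in> B 0 L"
proof -
  have "c \<in> CC 0 L" if "c \<in> E 0" "sc (x ^ l) c \<in> CC 0 L" for c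
    using that
  proof (induction l arbitrary: c)
    case (Suc l)
    have "sc (x ^ l) (sc x c) \<in> CC 0 L" using Suc.prems(2) by (simp add: sc_sc mult.commute)
    hence "sc x c \<in> CC 0 L" by (rule Suc.IH[OF subm_sc[OF subm_E Suc.prems(1)]])
    thus ?case using CC_colon[OF Suc.prems(1), of x L] L(2) by simp
  qed (simp add: sc_1)
  moreover have "B 0 L = CC 0 L" by (auto simp: B_def bd_def)
  ultimately show ?thesis using c Z_E by blast
qed

end

text \<open>\<open>M\<close> is the maximal ideal, generated by \<open>K\<close> and the \<open>g j\<close>; the ideal \<open>K\<close> is the kernel of the
  presentation of the local ring.\<close>

locale local_cech = cech g r + powers K In
  for g :: "nat \<Rightarrow> 'p::comm_ring_1" and r :: nat and K :: "'p set" and In :: "nat \<Rightarrow> 'p set" +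
  fixes M :: "'p set"
  assumes idl_K: "idl K" and idl_M: "idl M" and In_M: "In 1 \<subseteq> M" and g_M: "j < r \<Longrightarrow> g j \<in> M"
    and M_least: "idl Q \<Longrightarrow> K \<subseteq> Q \<Longrightarrow> (\<And>j. j < r \<Longrightarrow> g j \<in> Q) \<Longrightarrow> M \<subseteq> Q"
    and M_max: "a \<notin> M \<Longrightarrow> \<exists>b. b * a - 1 \<in> M"
begin

text \<open>The elements with a power that kills the class of \<open>c\<close> form an ideal, sums
  being covered by \<open>torsion_add\<close>. It contains the generators \<open>g j\<close> by the
  homotopy and \<open>K\<close> because \<open>K \<subseteq> L\<close>, hence all of
  \<open>M\<close>.\<close>

lemma torsion:
  assumes L: "idl L" "K \<subseteq> L" and x: "x \<in> M" and c: "c \<in> Z i L"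
  shows "\<exists>k. sc (x ^ k) c \<in> B i L"
proof -
  define Q where "Q = {x. \<exists>k. sc (x ^ k) c \<in> B i L}"
  note W = subm_B[OF L(1), of i]
  have "M \<subseteq> Q"
  proof (rule M_least)
    show "idl Q" unfolding idl_def
    proof (intro conjI ballI allI)
      have "sc (0 ^ 1) c \<in> B i L" using subm_0[OF W] by (simp add: sc_0_left)
      thus "0 \<in> Q" unfolding Q_def by blast
      show "a + b \<in> Q" if "a \<in> Q" "b \<in> Q" for a b
        using that torsion_add[OF W] unfolding Q_def by blast
      show "y * a \<in> Q" if "a \<in> Q" for a y
      proof -
        obtain k where "sc (a ^ k) c \<in> B i L" using \<open>a \<in> Q\<close> by (auto simp: Q_def)
        hence "sc (y ^ k) (sc (a ^ k) c) \<in> B i L" by (rule subm_sc[OF W])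
        hence "sc ((y * a) ^ k) c \<in> B i L" by (simp add: sc_sc power_mult_distrib)
        thus ?thesis unfolding Q_def by blast
      qed
    qed
    show "K \<subseteq> Q"
    proof
      fix y assume "y \<in> K"
      hence "sc (y ^ 1) c \<in> CC i L" using sc_mem_CC[OF L(1) _ Z_E[OF c]] L(2) by auto
      thus "y \<in> Q" using CC_subset_B unfolding Q_def by blast
    qed
    show "g j \<in> Q" if "j < r" for j
      using torsion_generator[OF L(1) c that] unfolding Q_def by blast
  qed
  thus ?thesis using x unfolding Q_def by blast
qed

text \<open>Here \<open>P / L\<close> is the residue field or zero. In positive degree an element of
  \<open>L\<close> is inverted, so every cochain represents zero; in degree 0 a field has no proper
  nonzero submodules.\<close>

lemma artinian_residue_field:
  assumes L: "idl L" "M \<subseteq> L"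
  shows "artinian i L"
proof (cases i)
  case (Suc i')
  have "E i \<subseteq> CC i L"
  proof
    fix c assume "c \<in> E i"
    then obtain k where k: "reg i k c" by (auto simp: E_def)
    \<comment> \<open>Level \<open>Suc k\<close> and not \<open>k\<close>: the step up contributes
      the factor \<open>prod g S\<close>, which lies in \<open>L\<close> since \<open>S\<close> is
      nonempty.\<close>
    have "c (Suc k) S \<in> L" if S: "S \<in> idx i" for S
    proof -
      have "S \<noteq> {}" using S Suc by (auto simp: idx_def)
      then obtain s where s: "s \<in> S" "s < r" "finite S"
        using S idx_finite[OF S] by (auto simp: idx_def)
      hence "prod g S = prod g (S - {s}) * g s" by (simp add: prod.remove mult.commute)
      hence "prod g S \<in> L" using g_M[OF s(2)] L by (metis idl_mult subsetD)
      thus ?thesis using k S idl_mult2[OF L(1)] by (auto simp: reg_def)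
    qed
    thus "c \<in> CC i L" using reg_mono[OF k] L(1) by (intro CC_regI[of i "Suc k"]) auto
  qed
  hence "Z i L \<subseteq> B i L" using CC_subset_B Z_E by blast
  thus ?thesis by (rule artinian_trivial)
next
  case 0
  have B: "B 0 L' = CC 0 L'" for L' by (auto simp: B_def bd_def)
  show ?thesis unfolding 0
  proof (rule artinianI)
    fix W :: "nat \<Rightarrow> 'p cochain set"
    assume W: "\<And>n. subm (W n)" "\<And>n. B 0 L \<subseteq> W n" "\<And>n. W n \<subseteq> Z 0 L" "\<And>m n. m \<le> n \<Longrightarrow> W n \<subseteq> W m"
    show "\<exists>N. \<forall>n\<ge>N. W N \<subseteq> W n"
    proof (cases "\<exists>N. W N \<subseteq> CC 0 L")
      case True
      then obtain N where "W N \<subseteq> CC 0 L" by blast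
      thus ?thesis using W(2) by (intro exI[of _ N]) (auto simp: B)
    next
      case False
      have "E 0 \<subseteq> W n" for n
      proof
        fix c assume c: "c \<in> E 0"
        obtain u where u: "u \<in> W n" "u \<notin> CC 0 L" using False by blast
        have uE: "u \<in> E 0" using u W(3) Z_E by blast
        then obtain k where k: "reg 0 k u" by (auto simp: E_def)
        have "u k {} \<notin> L" using u(2) CC_regI[OF k L(1)] by (auto simp: idx_0)
        hence "u k {} \<notin> M" using L by blast
        then obtain b where b: "b * u k {} - 1 \<in> M" using M_max by blast
        obtain k' where k': "reg 0 k' c" using c by (auto simp: E_def)
        define l where "l = max k k'"
        have reg: "reg 0 l c" "reg 0 l u" using k k' by (auto simp: l_def intro: reg_mono)
        have ul: "u l {} = u k {}" using reg_power[OF k, of l "{}"] by (simp add: l_def idx_0)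
        \<comment> \<open>\<open>b\<close> inverts the value of \<open>u\<close> modulo
          \<open>M\<close>, so this multiple of \<open>u\<close> has the same residue as
          \<open>c\<close>.\<close>
        have "c - sc (c l {} * b) u \<in> CC 0 L"
        proof (rule CC_regI[OF reg_diff[OF reg(1) reg_sc[OF reg(2)]] L(1)])
          fix S assume "S \<in> idx 0"
          hence S: "S = {}" by (simp add: idx_0)
          have "(c - sc (c l {} * b) u) l S = - (c l {} * (b * u k {} - 1))"
            by (simp add: S sc_def ul algebra_simps)
          also have "\<dots> \<in> L" using b L by (intro idl_minus idl_mult) auto
          finally show "(c - sc (c l {} * b) u) l S \<in> L" .
        qed
        hence "(c - sc (c l {} * b) u) + sc (c l {} * b) u \<in> W n"
          using W(2)[of n] u(1) subm_sc[OF W(1)] subm_add[OF W(1)] unfolding B by blast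
        thus "c \<in> W n" by simp
      qed
      thus ?thesis using W(3) Z_E by blast
    qed
  qed
qed

text \<open>For \<open>x\<close> in \<open>M\<close> outside \<open>L\<close> the ideal
  \<open>L + x P\<close> is strictly larger. If \<open>x\<close> is a zero divisor modulo
  \<open>L\<close>, so is \<open>colon L x\<close>, and the three-term sequence reduces
  \<open>L\<close> to larger ideals. Otherwise \<open>x\<close> is regular, and the torsion property
  allows the passage from degree \<open>j\<close> modulo \<open>L + x P\<close> to degree
  \<open>Suc j\<close> modulo \<open>L\<close>.\<close>

theorem artinian_cohomology:
  assumes "idl L" "K \<subseteq> L"
  shows "artinian i L"
  using noeth assms
proof (induction arbitrary: i rule: noeth_induct)
  case (less L)
  show ?case
  proof (cases "M \<subseteq> L")
    case True
    thus ?thesis by (rule artinian_residue_field[OF less.hyps(1)])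
  next
    case False
    then obtain x where x: "x \<in> M" "x \<notin> L" by blast
    have "L \<subset> adjoin L x"
      using x self_mem_adjoin[OF less.hyps(1), of x] subset_adjoin[of L x] by blast
    hence a: "artinian j (adjoin L x)" for j by (rule less.IH[OF idl_adjoin[OF less.hyps(1)]])
    show ?thesis
    proof (cases "colon L x = L")
      case False
      hence "L \<subset> colon L x" using subset_colon[OF less.hyps(1), of x] by blast
      thus ?thesis using artinian_middle[OF less.hyps(1) less.IH[OF idl_colon[OF less.hyps(1)]] a] by blast
    next
      case reg: True
      show ?thesis
      proof (cases i)
        case 0
        have "Z 0 L \<subseteq> B 0 L"
          using torsion[OF less.hyps x(1)] Z0_regular[OF less.hyps(1) reg] by blast
        thus ?thesis unfolding 0 by (rule artinian_trivial)
      next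
        case (Suc j)
        show ?thesis unfolding Suc
          by (rule artinian_nonzerodivisor[OF less.hyps(1) reg a torsion[OF less.hyps x(1)]])
      qed
    qed
  qed
qed

section \<open>Regular sequences and formal cohomology\<close>

lemma vanish_step:
  assumes J: "idl J" "K \<subseteq> J" and x: "x \<in> M" and reg: "colon J x = J"
    and van: "Z i (adjoin J x) \<subseteq> B i (adjoin J x)"
  shows "Z (Suc i) J \<subseteq> B (Suc i) J"
proof
  fix c assume "c \<in> Z (Suc i) J"
  moreover obtain l where "sc (x ^ l) c \<in> B (Suc i) J" using torsion[OF J x \<open>c \<in> Z (Suc i) J\<close>] by blast
  ultimately show "c \<in> B (Suc i) J"
  proof (induction l arbitrary: c)
    case (Suc l)
    have "sc (x ^ l) (sc x c) \<in> B (Suc i) J" using Suc.prems by (simp add: sc_sc mult.commute)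
    hence "sc x c \<in> B (Suc i) J" using Suc.IH subm_sc[OF subm_Z[OF J(1)]] Suc.prems by blast
    then obtain b u where bu: "sc x c = dd b + u" "b \<in> E i" "u \<in> CC (Suc i) J"
      by (auto simp: B_def bd_def)
    have "u \<in> CC (Suc i) (adjoin J x)" using CC_mono[OF subset_adjoin] bu(3) by blast
    moreover have "sc x c \<in> CC (Suc i) (adjoin J x)"
      using Suc.prems by (intro sc_mem_CC idl_adjoin self_mem_adjoin J Z_E)
    ultimately have "sc x c - u \<in> CC (Suc i) (adjoin J x)"
      using subm_diff[OF subm_CC[OF idl_adjoin[OF J(1)]]] by blast
    \<comment> \<open>Now \<open>b\<close> is a cocycle modulo \<open>J + x P\<close>, and vanishing
      there writes it as a boundary plus \<open>v + x * w\<close> with \<open>v\<close> in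
      \<open>J\<close>. Hence \<open>dd b\<close> is \<open>x * dd w\<close> up to \<open>J\<close>,
      and the factor \<open>x\<close> in \<open>x * (c - dd w)\<close> can be cancelled.\<close>
    hence "dd b \<in> CC (Suc i) (adjoin J x)" by (simp add: bu)
    hence "b \<in> B i (adjoin J x)" using van bu(2) by (auto simp: Z_def)
    then obtain b' u' where bu': "b = b' + u'" "b' \<in> bd i" "u' \<in> CC i (adjoin J x)" by (auto simp: B_def)
    obtain v w where vw: "v \<in> CC i J" "w \<in> E i" "u' = v + sc x w" using CC_adjoin[OF J(1) bu'(3)] by blast
    have "sc x (c - dd w) = dd v + u"
      by (simp add: sc_diff bu bu' vw dd_add dd_bd[OF bu'(2)] dd_sc)
    hence "sc x (c - dd w) \<in> CC (Suc i) J"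
      using dd_CC[OF J(1) vw(1)] bu(3) subm_add[OF subm_CC[OF J(1)]] by simp
    moreover have "c - dd w \<in> E (Suc i)"
      using Suc.prems Z_E dd_E[OF vw(2)] subm_diff[OF subm_E] by blast
    ultimately have "c - dd w \<in> CC (Suc i) J" using CC_colon[of "c - dd w" "Suc i" x J] reg by simp
    thus ?case using B_memI[OF dd_mem_bd[OF vw(2)], of "c - dd w" J] by simp
  qed (simp add: sc_1)
qed

theorem vanishing:
  assumes "idl J" "K \<subseteq> J" "regseq J ys" "set ys \<subseteq> M" "i < length ys"
  shows "Z i J \<subseteq> B i J"
  using assms
proof (induction ys arbitrary: J i)
  case (Cons y ys)
  show ?case
  proof (cases i)
    case 0
    show ?thesis unfolding 0
      using torsion[OF Cons.prems(1,2)] Z0_regular[OF Cons.prems(1)] Cons.prems(3,4) by fastforce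
  next
    case (Suc j)
    have "Z j (adjoin J y) \<subseteq> B j (adjoin J y)"
      using Cons.prems Suc subset_adjoin[of J y] by (intro Cons.IH idl_adjoin) auto
    thus ?thesis unfolding Suc using Cons.prems by (intro vanish_step) auto
  qed
qed simp

text \<open>The inverse system of the \<open>i\<close>-th cohomology of \<open>P / (J + I^n)\<close>
  is zero as a pro-object. The transition map from stage \<open>m\<close> to stage \<open>n\<close>
  is the identity on representatives, so its vanishing is an inclusion.\<close>

definition pro_zero :: "nat \<Rightarrow> 'p set \<Rightarrow> bool" where
  "pro_zero i J \<longleftrightarrow> (\<forall>n. \<exists>m. Z i (idl_plus J (In m)) \<subseteq> B i (idl_plus J (In n)))"

lemma idl_plus_In_antimono: "m \<le> n \<Longrightarrow> idl_plus J (In n) \<subseteq> idl_plus J (In m)"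
  by (intro idl_plus_mono In_antimono) auto

text \<open>The sequence from degree \<open>i\<close> modulo \<open>J\<close> through degree
  \<open>i\<close> modulo \<open>J + x P\<close> to degree \<open>Suc i\<close> modulo
  \<open>J\<close>, read in pro-modules. At a finite stage the connecting map only produces a
  cocycle \<open>w\<close> modulo the colon ideal of \<open>J + I^m\<close>;
  \<open>colon_plus_powers\<close> turns it into one modulo \<open>J + I^m2\<close>.\<close>

lemma pro_zero_step:
  assumes J: "idl J" "K \<subseteq> J" and reg: "colon J x = J" and pz: "pro_zero i J" "pro_zero (Suc i) J"
  shows "pro_zero i (adjoin J x)"
  unfolding pro_zero_def
proof
  fix n
  note idl = idl_idl_plus[OF J(1) idl_In]
  obtain m1 where m1: "Z i (idl_plus J (In m1)) \<subseteq> B i (idl_plus J (In n))" using pz(1) by (auto simp: pro_zero_def)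
  obtain m2 where m2: "Z (Suc i) (idl_plus J (In m2)) \<subseteq> B (Suc i) (idl_plus J (In m1))"
    using pz(2) by (auto simp: pro_zero_def)
  obtain m3 where m3: "colon (idl_plus J (In m3)) x \<subseteq> idl_plus J (In m2)"
    using colon_plus_powers[OF J reg, of m2] by blast
  \<comment> \<open>\<open>m3\<close> makes the connecting cocycle land at stage \<open>m2\<close>,
    where degree \<open>Suc i\<close> vanishes on the way to \<open>m1\<close>. The bound
    \<open>m1 \<le> m\<close> keeps the error term \<open>v\<close> at stage \<open>m1\<close>, from
    which degree \<open>i\<close> vanishes on the way to \<open>n\<close>.\<close>
  define m where "m = max m1 m3"
  have "Z i (idl_plus (adjoin J x) (In m)) \<subseteq> B i (idl_plus (adjoin J x) (In n))"
  proof
    fix c assume "c \<in> Z i (idl_plus (adjoin J x) (In m))"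
    hence c: "c \<in> E i" "dd c \<in> CC (Suc i) (adjoin (idl_plus J (In m)) x)"
      by (auto simp: Z_def idl_plus_adjoin)
    obtain v w where vw: "v \<in> CC (Suc i) (idl_plus J (In m))" "w \<in> E (Suc i)" "dd c = v + sc x w"
      using CC_adjoin[OF idl c(2)] by blast
    have "dd (v + sc x w) = 0" using dd_dd[of c] by (simp add: vw(3))
    hence "sc x (dd w) = - dd v" by (simp add: dd_add dd_sc add_eq_0_iff)
    also have "\<dots> \<in> CC (Suc (Suc i)) (idl_plus J (In m))"
      by (intro subm_minus subm_CC idl dd_CC vw)
    finally have "w \<in> Z (Suc i) (colon (idl_plus J (In m)) x)" by (rule Z_colonI[OF vw(2)])
    moreover have "colon (idl_plus J (In m)) x \<subseteq> idl_plus J (In m2)"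
      using m3 idl_plus_In_antimono[of m3 m J] by (auto simp: m_def colon_def)
    ultimately have "w \<in> B (Suc i) (idl_plus J (In m1))" using Z_mono m2 by blast
    then obtain b u where bu: "w = dd b + u" "b \<in> E i" "u \<in> CC (Suc i) (idl_plus J (In m1))"
      by (auto simp: B_def bd_def)
    have "dd (c - sc x b) = v + sc x u" by (simp add: dd_diff dd_sc vw(3) bu(1) sc_add)
    moreover have "v \<in> CC (Suc i) (idl_plus J (In m1))"
      using vw(1) CC_mono[OF idl_plus_In_antimono[of m1 m J]] by (auto simp: m_def)
    ultimately have "dd (c - sc x b) \<in> CC (Suc i) (idl_plus J (In m1))"
      using subm_add[OF subm_CC[OF idl]] subm_sc[OF subm_CC[OF idl]] bu(3) by simp
    hence "c - sc x b \<in> Z i (idl_plus J (In m1))"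
      using c(1) bu(2) subm_diff[OF subm_E] subm_sc[OF subm_E] by (simp add: Z_def)
    hence "c - sc x b \<in> B i (adjoin (idl_plus J (In n)) x)"
      using m1 B_mono[OF subset_adjoin[of "idl_plus J (In n)" x]] by blast
    moreover have "sc x b \<in> B i (adjoin (idl_plus J (In n)) x)"
      using CC_subset_B sc_mem_CC[OF idl_adjoin[OF idl] self_mem_adjoin[OF idl] bu(2)] by blast
    ultimately have "(c - sc x b) + sc x b \<in> B i (adjoin (idl_plus J (In n)) x)"
      using subm_add[OF subm_B[OF idl_adjoin[OF idl]]] by blast
    thus "c \<in> B i (idl_plus (adjoin J x) (In n))" by (simp add: idl_plus_adjoin)
  qed
  thus "\<exists>m. Z i (idl_plus (adjoin J x) (In m)) \<subseteq> B i (idl_plus (adjoin J x) (In n))" by blast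
qed

lemma pro_zero_regseq:
  assumes "idl J" "K \<subseteq> J" "regseq J ys" "\<And>i. i \<le> length ys + d \<Longrightarrow> pro_zero i J"
  shows "i \<le> d \<Longrightarrow> pro_zero i (foldl adjoin J ys)"
  using assms
proof (induction ys arbitrary: J)
  case (Cons y ys)
  have "pro_zero i (adjoin J y)" if "i \<le> length ys + d" for i
    using Cons.prems that by (intro pro_zero_step) auto
  moreover have "idl (adjoin J y)" "K \<subseteq> adjoin J y"
    using Cons.prems subset_adjoin[of J y] idl_adjoin by blast+
  ultimately show ?case using Cons.prems by (simp add: Cons.IH)
qed simp

text \<open>Mittag-Leffler: the images of the transition maps stabilise, and the stable images form a
  system of surjections.\<close>

lemma pro_zero_of_trivial_limit:
  assumes lim: "\<And>z. (\<And>n. z n \<in> Z i (In n)) \<Longrightarrow> (\<And>n. z (Suc n) - z n \<in> B i (In n))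
    \<Longrightarrow> (\<And>n. z n \<in> B i (In n))"
  shows "\<exists>m. Z i (In m) \<subseteq> B i (In n0)"
proof -
  \<comment> \<open>\<open>Y n m\<close> is the preimage in the cocycles of the image of stage
    \<open>m\<close> in stage \<open>n\<close>, for \<open>n \<le> m\<close>.\<close>
  define Y where "Y n m = {a + b | a b. a \<in> Z i (In m) \<and> b \<in> B i (In n)}" for n m
  have sub: "subm (Y n m)" for n m unfolding Y_def by (intro subm_plus subm_Z subm_B idl_In)
  have mono: "Y n m' \<subseteq> Y n m" if "m \<le> m'" for n m m'
    using Z_mono[OF In_antimono[OF that], of i] unfolding Y_def by blast
  have YI: "a + b \<in> Y n m" if "a \<in> Z i (In m)" "b \<in> B i (In n)" for a b n m
    using that unfolding Y_def by blast
  have ZY: "Z i (In m) \<subseteq> Y n m" for n m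
  proof
    fix a assume "a \<in> Z i (In m)"
    from YI[OF this subm_0[OF subm_B[OF idl_In]]] show "a \<in> Y n m" by simp
  qed
  have BY: "B i (In n) \<subseteq> Y n m" for n m
  proof
    fix b assume "b \<in> B i (In n)"
    from YI[OF subm_0[OF subm_Z[OF idl_In]] this] show "b \<in> Y n m" by simp
  qed
  have YZ: "Y n m \<subseteq> Z i (In n)" if "n \<le> m" for n m
  proof
    fix c assume "c \<in> Y n m"
    then obtain a b where "c = a + b" "a \<in> Z i (In m)" "b \<in> B i (In n)" unfolding Y_def by blast
    thus "c \<in> Z i (In n)"
      using Z_mono[OF In_antimono[OF that], of i] B_subset_Z[OF idl_In, of i n]
        subm_add[OF subm_Z[OF idl_In]] by blast
  qed
  have "\<exists>N\<ge>n. \<forall>m\<ge>N. Y n m = Y n N" for n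
  proof -
    have "\<exists>N. \<forall>m\<ge>N. Y n (n + m) = Y n (n + N)"
    proof (rule artinianD[OF artinian_cohomology[OF idl_In[of n] K_In], of "\<lambda>m. Y n (n + m)" i])
      fix m
      show "B i (In n) \<subseteq> Y n (n + m)" by (rule BY)
      show "Y n (n + m) \<subseteq> Z i (In n)" by (rule YZ) simp
      show "Y n (n + Suc m) \<subseteq> Y n (n + m)" by (rule mono) simp
    qed (rule sub)
    then obtain N where "\<And>m. m \<ge> N \<Longrightarrow> Y n (n + m) = Y n (n + N)" by blast
    hence "\<forall>m\<ge>n + N. Y n m = Y n (n + N)" by (metis add_leD1 le_Suc_ex nat_add_left_cancel_le)
    thus ?thesis using le_add1[of n N] by blast
  qed
  then obtain f where f: "\<And>n. f n \<ge> n" "\<And>n m. m \<ge> f n \<Longrightarrow> Y n m = Y n (f n)" by metis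
  \<comment> \<open>The stable image at \<open>n\<close> is also the image of a stage
    \<open>m\<close> beyond both stability bounds, and the image of that stage at
    \<open>Suc n\<close> is stable too.\<close>
  have surj: "\<exists>e'\<in>Y (Suc n) (f (Suc n)). e' - e \<in> B i (In n)" if e: "e \<in> Y n (f n)" for e n
  proof -
    define m where "m = max (f n) (f (Suc n))"
    have "e \<in> Y n m" using e f(2)[of n m] by (simp add: m_def)
    then obtain a b where ab: "e = a + b" "a \<in> Z i (In m)" "b \<in> B i (In n)" unfolding Y_def by blast
    have "a \<in> Y (Suc n) (f (Suc n))" using ab ZY[of m "Suc n"] f(2)[of "Suc n" m] by (auto simp: m_def)
    moreover have "a - e = - b" by (simp add: ab)
    ultimately show ?thesis using ab subm_minus[OF subm_B[OF idl_In]] by metis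
  qed
  have "Y n0 (f n0) \<subseteq> B i (In n0)"
  proof
    fix e assume e: "e \<in> Y n0 (f n0)"
    note YZ = YZ[OF f(1)]
    obtain s where s: "s 0 = e" "\<And>k. s k \<in> Y (n0 + k) (f (n0 + k))" "\<And>k. s (Suc k) - s k \<in> B i (In (n0 + k))"
    proof -
      have "\<exists>s. \<forall>k. (s k \<in> Y (n0 + k) (f (n0 + k)) \<and> (k = 0 \<longrightarrow> s k = e)) \<and> s (Suc k) - s k \<in> B i (In (n0 + k))"
      proof (rule dependent_nat_choice[of "\<lambda>k x. x \<in> Y (n0 + k) (f (n0 + k)) \<and> (k = 0 \<longrightarrow> x = e)"
            "\<lambda>k x y. y - x \<in> B i (In (n0 + k))"])
        show "\<exists>x. x \<in> Y (n0 + 0) (f (n0 + 0)) \<and> (0 = (0::nat) \<longrightarrow> x = e)" using e by simp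
        fix x and k :: nat assume "x \<in> Y (n0 + k) (f (n0 + k)) \<and> (k = 0 \<longrightarrow> x = e)"
        thus "\<exists>y. (y \<in> Y (n0 + Suc k) (f (n0 + Suc k)) \<and> (Suc k = 0 \<longrightarrow> y = e)) \<and> y - x \<in> B i (In (n0 + k))"
          using surj[of x "n0 + k"] by auto
      qed
      thus thesis using that by auto
    qed
    \<comment> \<open>Below \<open>n0\<close> truncated subtraction makes \<open>z\<close>
      constantly equal to \<open>e\<close>, which is correct there because the transition maps are
      the identity on representatives.\<close>
    define z where "z n = s (n - n0)" for n
    have "z n0 \<in> B i (In n0)"
    proof (rule lim)
      fix n
      show "z n \<in> Z i (In n)"
      proof (cases "n0 \<le> n")
        case True
        thus ?thesis using s(2)[of "n - n0"] YZ[of n] by (auto simp: z_def)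
      next
        case False
        hence "Z i (In n0) \<subseteq> Z i (In n)" by (intro Z_mono In_antimono) simp
        thus ?thesis using False s(2)[of 0] YZ[of n0] by (auto simp: z_def)
      qed
      show "z (Suc n) - z n \<in> B i (In n)"
      proof (cases "n0 \<le> n")
        case True
        thus ?thesis using s(3)[of "n - n0"] by (simp add: z_def Suc_diff_le)
      next
        case False
        thus ?thesis using subm_0[OF subm_B[OF idl_In]] by (simp add: z_def)
      qed
    qed
    thus "e \<in> B i (In n0)" by (simp add: z_def s(1))
  qed
  thus ?thesis using ZY by blast
qed

theorem formal_cohomology_nontrivial:
  assumes ys: "regseq K ys" "set ys \<subseteq> M"
    and a: "a \<notin> foldl adjoin K ys" "\<And>x. x \<in> M \<Longrightarrow> x * a \<in> foldl adjoin K ys"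
  shows "\<exists>i\<le>length ys. \<exists>z n. (\<forall>n. z n \<in> Z i (In n)) \<and> (\<forall>n. z (Suc n) - z n \<in> B i (In n)) \<and> z n \<notin> B i (In n)"
proof (rule ccontr)
  assume contra: "\<not> ?thesis"
  define J where "J = foldl adjoin K ys"
  have J: "idl J" "K \<subseteq> J" using foldl_adjoin[OF idl_K, of ys] by (auto simp: J_def)
  have "pro_zero i K" if "i \<le> length ys + 0" for i
    unfolding pro_zero_def idl_plus_absorb[OF idl_In K_In idl_K]
  proof
    fix n show "\<exists>m. Z i (In m) \<subseteq> B i (In n)"
      using contra that by (intro pro_zero_of_trivial_limit) auto
  qed
  hence "pro_zero 0 J" unfolding J_def by (intro pro_zero_regseq[of K ys 0 0] idl_K ys) auto
  have "a \<in> J"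
  proof (rule krull_intersection[OF J])
    show "x * a \<in> J" if "x \<in> In 1" for x using a(2) In_M that by (auto simp: J_def)
    fix n
    obtain m where m: "Z 0 (idl_plus J (In m)) \<subseteq> B 0 (idl_plus J (In n))"
      using \<open>pro_zero 0 J\<close> by (auto simp: pro_zero_def)
    \<comment> \<open>The constant cochain represents \<open>a\<close> in degree 0, where the empty
      product makes it regular. Its differential is inspected at level 1, not 0, because the
      coefficient \<open>g s ^ 0 = 1\<close> would not bring \<open>a\<close> into
      \<open>J\<close>.\<close>
    define c :: "'p cochain" where "c = (\<lambda>k S. a)"
    have c: "reg 0 1 c" by (simp add: reg_def idx_0 c_def)
    have "dd c 1 S \<in> J" if S: "S \<in> idx 1" for S
      unfolding dd_def koszul_def c_def
    proof (rule idl_sum[OF J(1)])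
      fix s assume "s \<in> S"
      hence "s < r" using S by (auto simp: idx_def)
      hence "g s * a \<in> J" using a(2) g_M by (simp add: J_def)
      thus "sg S s * g s ^ 1 * a \<in> J" using idl_mult[OF J(1)] by (simp add: mult.assoc)
    qed
    hence "dd c \<in> CC 1 J" using CC_regI[OF reg_dd[OF c] J(1)] by simp
    hence "dd c \<in> CC 1 (idl_plus J (In m))" using CC_mono[OF idl_plus_sub1[OF idl_In]] by blast
    hence "c \<in> Z 0 (idl_plus J (In m))" using E_regI[OF c] by (simp add: Z_def)
    hence "c \<in> B 0 (idl_plus J (In n))" using m by blast
    hence "c \<in> CC 0 (idl_plus J (In n))" by (simp add: B_def bd_def)
    thus "a \<in> idl_plus J (In n)" by (auto simp: CC_def idx_0 c_def)
  qed
  thus False using a(1) by (simp add: J_def)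
qed

end

section \<open>Comparison with the Cech complex of fractions\<close>

lemma (in abelian_group) additive_finsum:
  assumes "\<And>a. f a \<in> carrier G" "f 0 = \<zero>" "\<And>a b. f (a + b) = f a \<oplus> f b" "finite S"
  shows "(\<Oplus>s\<in>S. f (h s)) = f (sum h S)"
  using assms(4)
proof (induction S rule: finite_induct)
  case (insert s S)
  thus ?case using assms(1,3) by (simp add: Pi_def)
qed (simp add: assms)

lemma (in abelian_group) additive_minus:
  fixes f :: "'x::ab_group_add \<Rightarrow> 'a"
  assumes "\<And>a. f a \<in> carrier G" "f 0 = \<zero>" "\<And>a b. f (a + b) = f a \<oplus> f b"
  shows "\<ominus> f a = f (- a)"
  using assms(2) assms(3)[of "- a" a] by (intro minus_equality assms(1)) simp

locale surjection = cring A
  for A :: "('a, 'm) ring_scheme" (structure) +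
  fixes ev :: "'p::comm_ring_1 \<Rightarrow> 'a"
  assumes ev_range: "range ev = carrier A" and ev_1: "ev 1 = \<one>"
    and ev_add: "ev (a + b) = ev a \<oplus> ev b" and ev_mult: "ev (a * b) = ev a \<otimes> ev b"
begin

lemma ev_closed: "ev a \<in> carrier A"
  using ev_range by blast

lemma ev_0: "ev 0 = \<zero>"
  using ev_add[of 0 0] by (metis add.right_neutral ev_closed r_zero add.l_cancel_one' zero_closed)

lemma ev_minus: "ev (- a) = \<ominus> ev a"
  by (rule additive_minus[OF ev_closed ev_0 ev_add, symmetric])

lemma ev_power: "ev (a ^ k) = ev a [^] (k :: nat)"
  by (induction k) (simp_all add: ev_1 ev_mult ev_closed nat_pow_Suc m_comm)

lemma ev_prod: "finite S \<Longrightarrow> ev (prod f S) = (\<Otimes>s\<in>S. ev (f s))"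
  by (induction S rule: finite_induct) (simp_all add: ev_1 ev_mult ev_closed Pi_def)

end

locale presentation = surjection A ev + cech g r
  for A :: "('a, 'm) ring_scheme" (structure) and ev :: "'p::comm_ring_1 \<Rightarrow> 'a"
    and g :: "nat \<Rightarrow> 'p" and r +
  fixes xs :: "'a list"
  assumes length_xs: "length xs = r" and nth_xs: "s < r \<Longrightarrow> xs ! s = ev (g s)"
begin

section \<open>Fractions with monomial denominators\<close>

definition mon :: "nat set \<Rightarrow> 'p set" where
  "mon S = {\<Prod>s\<in>S. g s ^ k s | k. True}"

lemma mon_I: "(\<Prod>s\<in>S. g s ^ k s) \<in> mon S"
  by (auto simp: mon_def)

lemma one_mon: "1 \<in> mon S"
  using mon_I[where k = "\<lambda>_. 0"] by simp

lemma power_mon: "prod g S ^ k \<in> mon S"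
  using mon_I[where k = "\<lambda>_. k"] by (simp add: prod_power_distrib)

lemma mult_mon: assumes "a \<in> mon S" "b \<in> mon S" shows "a * b \<in> mon S"
proof -
  obtain k l where "a = (\<Prod>s\<in>S. g s ^ k s)" "b = (\<Prod>s\<in>S. g s ^ l s)"
    using assms by (auto simp: mon_def)
  thus ?thesis using mon_I[where k = "\<lambda>s. k s + l s" and S = S] by (simp add: power_add prod.distrib)
qed

lemma mon_mono: assumes "T \<subseteq> S" "finite S" shows "mon T \<subseteq> mon S"
proof
  fix a assume "a \<in> mon T"
  then obtain k where "a = (\<Prod>s\<in>T. g s ^ k s)" by (auto simp: mon_def)
  also have "\<dots> = (\<Prod>s\<in>S. g s ^ (if s \<in> T then k s else 0))"
    using assms by (intro prod.mono_neutral_cong_left) auto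
  finally show "a \<in> mon S" using mon_I by metis
qed

text \<open>Allows every denominator to be normalised to a power of \<open>prod g S\<close>. The sum
  of the exponents serves as a common upper bound for them.\<close>

lemma mon_dvd_power: assumes "finite S" "a \<in> mon S" shows "\<exists>b\<in>mon S. \<exists>k. b * a = prod g S ^ k"
proof -
  obtain k where a: "a = (\<Prod>s\<in>S. g s ^ k s)" using assms by (auto simp: mon_def)
  have le: "k s \<le> sum k S" if "s \<in> S" for s using assms(1) that by (simp add: member_le_sum)
  have "(\<Prod>s\<in>S. g s ^ (sum k S - k s)) * a = (\<Prod>s\<in>S. g s ^ sum k S)"
    unfolding a by (simp add: le flip: prod.distrib power_add)
  thus ?thesis using mon_I[where k = "\<lambda>s. sum k S - k s" and S = S] by (metis prod_power_distrib)
qed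

lemma monomials_eq:
  assumes "S \<subseteq> {..<r}"
  shows "monomials A xs S = ev ` mon S"
proof -
  have fin: "finite S" using assms finite_subset by blast
  have "(\<Otimes>s\<in>S. (xs ! s) [^] k s) = ev (\<Prod>s\<in>S. g s ^ k s)" for k :: "nat \<Rightarrow> nat"
    unfolding ev_prod[OF fin] ev_power
    by (rule finprod_cong) (use assms in \<open>auto simp: nth_xs ev_closed Pi_def simp_implies_def\<close>)
  thus ?thesis unfolding monomials_def mon_def by auto
qed

text \<open>\<open>rep M \<pi> L\<close>: the map \<open>\<pi>\<close> presents the module \<open>M\<close> as a cyclic module \<open>P / L\<close>.\<close>

definition rep :: "('a, 'b, 'n) module_scheme \<Rightarrow> ('p \<Rightarrow> 'b) \<Rightarrow> 'p set \<Rightarrow> bool" where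
  "rep M \<pi> L \<longleftrightarrow> range \<pi> = carrier M \<and> \<pi> 0 = \<zero>\<^bsub>M\<^esub> \<and> (\<forall>a b. \<pi> (a + b) = \<pi> a \<oplus>\<^bsub>M\<^esub> \<pi> b)
     \<and> (\<forall>x a. ev x \<odot>\<^bsub>M\<^esub> \<pi> a = \<pi> (x * a)) \<and> (\<forall>a b. \<pi> a = \<pi> b \<longleftrightarrow> a - b \<in> L) \<and> idl L"

definition fr :: "('a, 'b, 'n) module_scheme \<Rightarrow> ('p \<Rightarrow> 'b) \<Rightarrow> nat set \<Rightarrow> 'p \<Rightarrow> 'p \<Rightarrow> ('b \<times> 'a) set" where
  "fr M \<pi> S a w = fraction A (monomials A xs S) M (\<pi> a) (ev w)"

lemma rep_idl: "rep M \<pi> L \<Longrightarrow> idl L"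
  by (simp add: rep_def)

lemma fr_mem:
  assumes "rep M \<pi> L" "S \<subseteq> {..<r}" "w' \<in> mon S"
  shows "(\<pi> a', ev w') \<in> fr M \<pi> S a w \<longleftrightarrow> (\<exists>u\<in>mon S. u * (w' * a - w * a') \<in> L)"
  using assms unfolding fr_def fraction_def monomials_eq[OF assms(2)] rep_def
  by (auto simp: right_diff_distrib)

lemma fr_cases:
  assumes "rep M \<pi> L" "S \<subseteq> {..<r}" "z \<in> fr M \<pi> S a w"
  obtains a' w' u where "z = (\<pi> a', ev w')" "w' \<in> mon S" "u \<in> mon S" "u * (w' * a - w * a') \<in> L"
proof -
  obtain m v where "z = (m, v)" by force
  moreover have "m \<in> range \<pi>" "v \<in> ev ` mon S"
    using assms \<open>z = (m, v)\<close> by (auto simp: fr_def fraction_def monomials_eq[OF assms(2)] rep_def)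
  ultimately obtain a' w' where z: "z = (\<pi> a', ev w')" "w' \<in> mon S" by blast
  with assms(3) fr_mem[OF assms(1,2) z(2)] show thesis using that by blast
qed

lemma fr_eq:
  assumes rep: "rep M \<pi> L" "S \<subseteq> {..<r}" and w: "w \<in> mon S" "w' \<in> mon S"
  shows "fr M \<pi> S a w = fr M \<pi> S a' w' \<longleftrightarrow> (\<exists>u\<in>mon S. u * (w' * a - w * a') \<in> L)"
proof -
  note L = rep_idl[OF rep(1)]
  have self: "(\<pi> a, ev w) \<in> fr M \<pi> S a w" if "w \<in> mon S" for a w
    using that one_mon idl_0[OF L] by (auto simp: fr_mem[OF rep that])
  have sub: "fr M \<pi> S a' w' \<subseteq> fr M \<pi> S a w"
    if w: "w \<in> mon S" "w' \<in> mon S" and u: "u \<in> mon S" "u * (w' * a - w * a') \<in> L" for a a' w w' u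
  proof
    fix z assume "z \<in> fr M \<pi> S a' w'"
    then obtain b v t where z: "z = (\<pi> b, ev v)" "v \<in> mon S" "t \<in> mon S" "t * (v * a' - w' * b) \<in> L"
      using fr_cases[OF rep] by blast
    \<comment> \<open>The first relation times \<open>t * v\<close> plus the second times
      \<open>u * w\<close> eliminates \<open>a'\<close>.\<close>
    have "(u * t * w') * (v * a - w * b) = (t * v) * (u * (w' * a - w * a')) + (u * w) * (t * (v * a' - w' * b))"
      by (simp add: algebra_simps)
    also have "\<dots> \<in> L" by (rule idl_add[OF L idl_mult[OF L u(2)] idl_mult[OF L z(4)]])
    finally show "z \<in> fr M \<pi> S a w"
      unfolding z(1) fr_mem[OF rep z(2)] using u(1) z(3) w(2) mult_mon by blast
  qed
  show ?thesis
  proof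
    assume "fr M \<pi> S a w = fr M \<pi> S a' w'"
    hence "(\<pi> a', ev w') \<in> fr M \<pi> S a w" using self[OF w(2)] by simp
    thus "\<exists>u\<in>mon S. u * (w' * a - w * a') \<in> L" by (simp add: fr_mem[OF rep w(2)])
  next
    assume "\<exists>u\<in>mon S. u * (w' * a - w * a') \<in> L"
    then obtain u where u: "u \<in> mon S" "u * (w' * a - w * a') \<in> L" by blast
    moreover have "u * (w * a' - w' * a) = - (u * (w' * a - w * a'))" by (simp add: algebra_simps)
    ultimately have "u * (w * a' - w' * a) \<in> L" using idl_minus[OF L] by metis
    thus "fr M \<pi> S a w = fr M \<pi> S a' w'" using sub w u by blast
  qed
qed

lemma fr_nonempty:
  assumes "rep M \<pi> L" "S \<subseteq> {..<r}" "w \<in> mon S"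
  shows "fr M \<pi> S a w \<noteq> {}"
proof -
  have "(\<pi> a, ev w) \<in> fr M \<pi> S a w"
    using one_mon idl_0[OF rep_idl[OF assms(1)]] by (auto simp: fr_mem[OF assms])
  thus ?thesis by blast
qed

lemma fr_cancel:
  assumes "rep M \<pi> L" "S \<subseteq> {..<r}" "w \<in> mon S" "v \<in> mon S"
  shows "fr M \<pi> S (v * a) (v * w) = fr M \<pi> S a w"
proof -
  have "1 * (w * (v * a) - v * w * a) \<in> L" using idl_0[OF rep_idl[OF assms(1)]] by (simp add: algebra_simps)
  thus ?thesis using assms by (subst fr_eq[OF assms(1,2)]) (auto intro: mult_mon one_mon)
qed

lemma fr_0: "rep M \<pi> L \<Longrightarrow> S \<subseteq> {..<r} \<Longrightarrow> w \<in> mon S \<Longrightarrow> fr M \<pi> S 0 w = fr M \<pi> S 0 1"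
  using one_mon idl_0[OF rep_idl] by (subst fr_eq) auto

lemma localization_zero: "rep M \<pi> L \<Longrightarrow> \<zero>\<^bsub>cech_loc A xs M S\<^esub> = fr M \<pi> S 0 1"
  by (simp add: localization_def fr_def ev_1 rep_def)

lemma localization_carrier:
  assumes "rep M \<pi> L" "S \<subseteq> {..<r}"
  shows "carrier (cech_loc A xs M S) = {fr M \<pi> S a (prod g S ^ k) | a k. True}"
proof -
  have "carrier (cech_loc A xs M S) = {fr M \<pi> S a w | a w. w \<in> mon S}"
  proof -
    have M: "carrier M = range \<pi>" using assms(1) by (simp add: rep_def)
    have "carrier (cech_loc A xs M S) =
        {fraction A (monomials A xs S) M m w | m w. m \<in> carrier M \<and> w \<in> monomials A xs S}"
      by (simp add: localization_def)
    also have "\<dots> = {fr M \<pi> S a w | a w. w \<in> mon S}"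
      unfolding M fr_def monomials_eq[OF assms(2)] by blast
    finally show ?thesis .
  qed
  also have "\<dots> = {fr M \<pi> S a (prod g S ^ k) | a k. True}"
  proof (intro equalityI subsetI)
    fix z assume "z \<in> {fr M \<pi> S a w | a w. w \<in> mon S}"
    then obtain a w where z: "z = fr M \<pi> S a w" "w \<in> mon S" by blast
    obtain b k where b: "b \<in> mon S" "b * w = prod g S ^ k"
      using mon_dvd_power[OF finite_subset[OF assms(2) finite_lessThan] z(2)] by blast
    have "z = fr M \<pi> S (b * a) (prod g S ^ k)" using fr_cancel[OF assms z(2) b(1)] b(2) z(1) by metis
    thus "z \<in> {fr M \<pi> S a (prod g S ^ k) | a k. True}" by blast
  qed (use power_mon in blast)
  finally show ?thesis .
qed

lemma fr_add:
  assumes rep: "rep M \<pi> L" "S \<subseteq> {..<r}" and w: "w \<in> mon S"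
  shows "fr M \<pi> S a w \<oplus>\<^bsub>cech_loc A xs M S\<^esub> fr M \<pi> S b w = fr M \<pi> S (a + b) w"
proof -
  note L = rep_idl[OF rep(1)]
  define F where "F = (\<lambda>z z'. fraction A (monomials A xs S) M
      (snd z' \<odot>\<^bsub>M\<^esub> fst z \<oplus>\<^bsub>M\<^esub> snd z \<odot>\<^bsub>M\<^esub> fst z') (snd z \<otimes> snd z'))"
  have F: "F z z' = fr M \<pi> S (a + b) w" if zz: "z \<in> fr M \<pi> S a w" "z' \<in> fr M \<pi> S b w" for z z'
  proof -
    obtain a1 w1 u where z: "z = (\<pi> a1, ev w1)" "w1 \<in> mon S" "u \<in> mon S" "u * (w1 * a - w * a1) \<in> L"
      using fr_cases[OF rep zz(1)] by blast
    obtain b1 v1 t where z': "z' = (\<pi> b1, ev v1)" "v1 \<in> mon S" "t \<in> mon S" "t * (v1 * b - w * b1) \<in> L"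
      using fr_cases[OF rep zz(2)] by blast
    have "F z z' = fr M \<pi> S (v1 * a1 + w1 * b1) (w1 * v1)"
      using rep(1) by (simp add: F_def z(1) z'(1) fr_def rep_def ev_mult)
    also have "\<dots> = fr M \<pi> S (a + b) w"
    proof -
      have "(u * t) * (w * (v1 * a1 + w1 * b1) - w1 * v1 * (a + b))
          = - ((t * v1) * (u * (w1 * a - w * a1)) + (u * w1) * (t * (v1 * b - w * b1)))"
        by (simp add: algebra_simps)
      also have "\<dots> \<in> L" by (rule idl_minus[OF L idl_add[OF L idl_mult[OF L z(4)] idl_mult[OF L z'(4)]]])
      finally show ?thesis
        using z(2,3) z'(2,3) w by (subst fr_eq[OF rep]) (auto intro: mult_mon)
    qed
    finally show ?thesis .
  qed
  have "fr M \<pi> S a w \<oplus>\<^bsub>cech_loc A xs M S\<^esub> fr M \<pi> S b w = (\<Union>z\<in>fr M \<pi> S a w. \<Union>z'\<in>fr M \<pi> S b w. F z z')"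
    by (simp add: localization_def F_def case_prod_unfold)
  also have "\<dots> = (\<Union>z\<in>fr M \<pi> S a w. \<Union>z'\<in>fr M \<pi> S b w. fr M \<pi> S (a + b) w)"
    using F by simp
  also have "\<dots> = fr M \<pi> S (a + b) w" using fr_nonempty[OF rep w] by simp
  finally show ?thesis .
qed

lemma fraction_map_fr:
  assumes rep: "rep M \<pi> L" "rep M' \<pi>' L'" and LL: "L \<subseteq> L'" and ST: "T \<subseteq> S" "S \<subseteq> {..<r}"
    and h: "\<And>a. h (\<pi> a) = \<pi>' a" and w: "w \<in> mon T"
  shows "fraction_map A (monomials A xs S) M' h id (fr M \<pi> T a w) = fr M' \<pi>' S a w"
proof -
  have T: "T \<subseteq> {..<r}" using ST by blast
  have mon: "mon T \<subseteq> mon S" using ST finite_subset[OF ST(2) finite_lessThan] by (intro mon_mono)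
  have F: "fraction A (monomials A xs S) M' (h (fst z)) (snd z) = fr M' \<pi>' S a w" if z: "z \<in> fr M \<pi> T a w" for z
  proof -
    obtain a1 w1 u where z: "z = (\<pi> a1, ev w1)" "w1 \<in> mon T" "u \<in> mon T" "u * (w1 * a - w * a1) \<in> L"
      using fr_cases[OF rep(1) T z] by blast
    have "fr M' \<pi>' S a w = fr M' \<pi>' S a1 w1"
      using z w mon LL by (subst fr_eq[OF rep(2) ST(2)]) auto
    thus ?thesis by (simp add: z(1) h fr_def)
  qed
  have "fraction_map A (monomials A xs S) M' h id (fr M \<pi> T a w) = (\<Union>z\<in>fr M \<pi> T a w. fr M' \<pi>' S a w)"
    using F by (simp add: fraction_map_def case_prod_unfold)
  thus ?thesis using fr_nonempty[OF rep(1) T w] by simp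
qed

text \<open>Every sufficiently large level serves as denominator, so finitely many elements can be
  brought to a common one and the group laws reduce to those of \<open>P\<close>.\<close>

lemma localization_common:
  assumes rep: "rep M \<pi> L" "S \<subseteq> {..<r}" and z: "z \<in> carrier (cech_loc A xs M S)"
  shows "\<exists>k0. \<forall>k\<ge>k0. \<exists>a. z = fr M \<pi> S a (prod g S ^ k)"
proof -
  obtain a k0 where a: "z = fr M \<pi> S a (prod g S ^ k0)" using z localization_carrier[OF rep] by auto
  have "z = fr M \<pi> S (prod g S ^ (k - k0) * a) (prod g S ^ k)" if "k0 \<le> k" for k
    using fr_cancel[OF rep power_mon power_mon, of "k - k0" a k0] a that by (simp flip: power_add)
  thus ?thesis by blast
qed

lemma localization_abelian_group:
  assumes rep: "rep M \<pi> L" "S \<subseteq> {..<r}"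
  shows "abelian_group (cech_loc A xs M S)"
proof (rule abelian_groupI)
  let ?G = "cech_loc A xs M S"
  have in_c: "fr M \<pi> S a (prod g S ^ k) \<in> carrier ?G" for a k
    using localization_carrier[OF rep] by blast
  note add = fr_add[OF rep power_mon]
  fix x y z assume x: "x \<in> carrier ?G" and y: "y \<in> carrier ?G"
  obtain k1 k2 where "\<And>k. k \<ge> k1 \<Longrightarrow> \<exists>a. x = fr M \<pi> S a (prod g S ^ k)"
    "\<And>k. k \<ge> k2 \<Longrightarrow> \<exists>a. y = fr M \<pi> S a (prod g S ^ k)"
    using localization_common[OF rep x] localization_common[OF rep y] by blast
  then obtain k0 where k0: "\<And>k. k \<ge> k0 \<Longrightarrow> \<exists>a b. x = fr M \<pi> S a (prod g S ^ k) \<and> y = fr M \<pi> S b (prod g S ^ k)"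
    by (metis max.bounded_iff)
  then obtain a b where ab: "x = fr M \<pi> S a (prod g S ^ k0)" "y = fr M \<pi> S b (prod g S ^ k0)" by blast
  show "x \<oplus>\<^bsub>?G\<^esub> y \<in> carrier ?G" "x \<oplus>\<^bsub>?G\<^esub> y = y \<oplus>\<^bsub>?G\<^esub> x"
    unfolding ab add by (rule in_c) (simp add: add.commute)
  assume z: "z \<in> carrier ?G"
  obtain k3 where "\<And>k. k \<ge> k3 \<Longrightarrow> \<exists>a. z = fr M \<pi> S a (prod g S ^ k)"
    using localization_common[OF rep z] by blast
  then obtain a b c where "x = fr M \<pi> S a (prod g S ^ max k0 k3)" "y = fr M \<pi> S b (prod g S ^ max k0 k3)"
    "z = fr M \<pi> S c (prod g S ^ max k0 k3)"
    using k0[of "max k0 k3"] by (metis max.cobounded1 max.cobounded2)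
  thus "x \<oplus>\<^bsub>?G\<^esub> y \<oplus>\<^bsub>?G\<^esub> z = x \<oplus>\<^bsub>?G\<^esub> (y \<oplus>\<^bsub>?G\<^esub> z)"
    by (simp add: add add.assoc)
next
  let ?G = "cech_loc A xs M S"
  have in_c: "fr M \<pi> S a (prod g S ^ k) \<in> carrier ?G" for a k
    using localization_carrier[OF rep] by blast
  note add = fr_add[OF rep power_mon]
  have zero: "\<zero>\<^bsub>?G\<^esub> = fr M \<pi> S 0 (prod g S ^ k)" for k
    using localization_zero[OF rep(1)] fr_0[OF rep power_mon] by simp
  show "\<zero>\<^bsub>?G\<^esub> \<in> carrier ?G" unfolding zero[of 0] by (rule in_c)
  fix x assume "x \<in> carrier ?G"
  then obtain a k where a: "x = fr M \<pi> S a (prod g S ^ k)" using localization_carrier[OF rep] by auto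
  show "\<zero>\<^bsub>?G\<^esub> \<oplus>\<^bsub>?G\<^esub> x = x" unfolding a zero[of k] add by simp
  have "fr M \<pi> S (- a) (prod g S ^ k) \<oplus>\<^bsub>?G\<^esub> x = \<zero>\<^bsub>?G\<^esub>" unfolding a zero[of k] add by simp
  thus "\<exists>y\<in>carrier ?G. y \<oplus>\<^bsub>?G\<^esub> x = \<zero>\<^bsub>?G\<^esub>" using in_c by blast
qed

end

section \<open>Identification of germs with Cech cochains\<close>

context presentation
begin

lemma cech_index_eq: "cech_index xs i = idx i"
  by (simp add: cech_index_def idx_def length_xs)

lemma idx_subset: "S \<in> idx i \<Longrightarrow> S \<subseteq> {..<r}"
  by (simp add: idx_def)

lemma finite_idx: "finite (idx i)"
  by (rule finite_subset[of _ "Pow {..<r}"]) (auto simp: idx_def)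

definition level :: "nat \<Rightarrow> 'p cochain \<Rightarrow> nat" where
  "level i c = (SOME k0. reg i k0 c)"

text \<open>The Cech cochain represented by a germ, evaluated at an arbitrarily chosen level of
  regularity; \<open>Phi_apply\<close> shows that all larger levels give the same fractions.\<close>

definition \<Phi> :: "('a, 'b, 'n) module_scheme \<Rightarrow> ('p \<Rightarrow> 'b) \<Rightarrow> nat \<Rightarrow> 'p cochain \<Rightarrow> nat set \<Rightarrow> ('b \<times> 'a) set" where
  "\<Phi> M \<pi> i c = (\<lambda>S\<in>idx i. fr M \<pi> S (c (level i c) S) (prod g S ^ level i c))"

lemma Phi_apply:
  assumes rep: "rep M \<pi> L" and c: "c \<in> E i"
  shows "\<exists>k0. \<forall>k\<ge>k0. \<Phi> M \<pi> i c = (\<lambda>S\<in>idx i. fr M \<pi> S (c k S) (prod g S ^ k))"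
proof -
  have reg: "reg i (level i c) c" using c unfolding level_def E_def by (auto intro: someI)
  have "\<Phi> M \<pi> i c = (\<lambda>S\<in>idx i. fr M \<pi> S (c k S) (prod g S ^ k))" if k: "level i c \<le> k" for k
    unfolding \<Phi>_def
  proof (rule restrict_ext)
    fix S assume S: "S \<in> idx i"
    have "c k S = prod g S ^ (k - level i c) * c (level i c) S" by (rule reg_power[OF reg k S])
    moreover have "prod g S ^ k = prod g S ^ (k - level i c) * prod g S ^ level i c"
      using k by (simp flip: power_add)
    ultimately show "fr M \<pi> S (c (level i c) S) (prod g S ^ level i c) = fr M \<pi> S (c k S) (prod g S ^ k)"
      using fr_cancel[OF rep idx_subset[OF S] power_mon power_mon] by simp
  qed
  thus ?thesis by blast
qed

lemma Phi_ext:
  assumes rep: "rep M \<pi> L"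
  shows "\<Phi> M \<pi> i (ext K a) = (\<lambda>S\<in>idx i. fr M \<pi> S (a S) (prod g S ^ K))"
proof -
  obtain k0 where "\<And>k. k \<ge> k0 \<Longrightarrow> \<Phi> M \<pi> i (ext K a) = (\<lambda>S\<in>idx i. fr M \<pi> S (ext K a k S) (prod g S ^ k))"
    using Phi_apply[OF rep E_regI[OF reg_ext]] by blast
  hence "\<Phi> M \<pi> i (ext K a) = (\<lambda>S\<in>idx i. fr M \<pi> S (ext K a (k0 + K) S) (prod g S ^ (k0 + K)))" by simp
  also have "\<dots> = (\<lambda>S\<in>idx i. fr M \<pi> S (a S) (prod g S ^ K))"
    using fr_cancel[OF rep idx_subset power_mon power_mon] by (intro restrict_ext) (simp add: ext_def power_add)
  finally show ?thesis .
qed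

lemma Phi_add:
  assumes rep: "rep M \<pi> L" and a: "a \<in> E i" and b: "b \<in> E i"
  shows "\<Phi> M \<pi> i (a + b) = \<Phi> M \<pi> i a \<oplus>\<^bsub>cech_module A xs M i\<^esub> \<Phi> M \<pi> i b"
proof -
  obtain k1 k2 k3 where
    "\<And>k. k \<ge> k1 \<Longrightarrow> \<Phi> M \<pi> i a = (\<lambda>S\<in>idx i. fr M \<pi> S (a k S) (prod g S ^ k))"
    "\<And>k. k \<ge> k2 \<Longrightarrow> \<Phi> M \<pi> i b = (\<lambda>S\<in>idx i. fr M \<pi> S (b k S) (prod g S ^ k))"
    "\<And>k. k \<ge> k3 \<Longrightarrow> \<Phi> M \<pi> i (a + b) = (\<lambda>S\<in>idx i. fr M \<pi> S ((a + b) k S) (prod g S ^ k))"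
    using Phi_apply[OF rep a] Phi_apply[OF rep b] Phi_apply[OF rep subm_add[OF subm_E a b]] by blast
  from this[of "k1 + k2 + k3"] show ?thesis
    by (auto simp: cech_module_def cech_index_eq fr_add[OF rep idx_subset power_mon] intro!: restrict_ext)
qed

text \<open>A numerator vanishes in the localization when a monomial multiple of it lies in
  \<open>L\<close>. Monomials divide powers of \<open>prod g S\<close>, and going up in level
  multiplies by such powers; since there are finitely many \<open>S\<close>, one level serves
  all.\<close>

lemma Phi_eq:
  assumes rep: "rep M \<pi> L" and a: "a \<in> E i" and b: "b \<in> E i"
  shows "\<Phi> M \<pi> i a = \<Phi> M \<pi> i b \<longleftrightarrow> a - b \<in> CC i L"
proof -
  obtain k1 k2 k3 where k: 
    "\<And>k. k \<ge> k1 \<Longrightarrow> \<Phi> M \<pi> i a = (\<lambda>S\<in>idx i. fr M \<pi> S (a k S) (prod g S ^ k))"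
    "\<And>k. k \<ge> k2 \<Longrightarrow> \<Phi> M \<pi> i b = (\<lambda>S\<in>idx i. fr M \<pi> S (b k S) (prod g S ^ k))"
    and reg: "reg i k3 (a - b)"
    using Phi_apply[OF rep a] Phi_apply[OF rep b] subm_diff[OF subm_E a b] unfolding E_def by blast
  note L = rep_idl[OF rep]
  have restrict_eq: "(\<lambda>S\<in>idx i. f S) = (\<lambda>S\<in>idx i. f' S) \<longleftrightarrow> (\<forall>S\<in>idx i. f S = f' S)"
    for f f' :: "nat set \<Rightarrow> ('b \<times> 'a) set"
    by (metis restrict_apply' restrict_ext)
  have eq: "\<Phi> M \<pi> i a = \<Phi> M \<pi> i b \<longleftrightarrow> (\<forall>S\<in>idx i. \<exists>u\<in>mon S. u * (prod g S ^ k * (a - b) k S) \<in> L)"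
    if "k \<ge> k1" "k \<ge> k2" for k
    unfolding k(1)[OF that(1)] k(2)[OF that(2)] restrict_eq
    using fr_eq[OF rep idx_subset power_mon power_mon] by (simp add: right_diff_distrib)
  show ?thesis
  proof
    assume "\<Phi> M \<pi> i a = \<Phi> M \<pi> i b"
    define k where "k = k1 + k2 + k3"
    have "\<exists>N. prod g S ^ N * (prod g S ^ k * (a - b) k S) \<in> L" if S: "S \<in> idx i" for S
    proof -
      obtain u where u: "u \<in> mon S" "u * (prod g S ^ k * (a - b) k S) \<in> L"
        using eq[of k] \<open>\<Phi> M \<pi> i a = \<Phi> M \<pi> i b\<close> S by (auto simp: k_def)
      obtain v N where v: "v * u = prod g S ^ N" using mon_dvd_power[OF idx_finite[OF S] u(1)] by blast
      have "v * (u * (prod g S ^ k * (a - b) k S)) \<in> L" by (rule idl_mult[OF L u(2)])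
      thus ?thesis using v by (metis mult.assoc)
    qed
    then obtain N where N: "\<And>S. S \<in> idx i \<Longrightarrow> prod g S ^ N S * (prod g S ^ k * (a - b) k S) \<in> L" by metis
    \<comment> \<open>The difference \<open>l - k\<close> provides the factor
      \<open>prod g S ^ k\<close> left by cross-multiplication together with
      \<open>prod g S ^ N S\<close> for every \<open>S\<close> at once.\<close>
    define l where "l = k + (k + sum N (idx i))"
    have "(a - b) l S \<in> L" if S: "S \<in> idx i" for S
    proof -
      have "N S \<le> sum N (idx i)" using S finite_idx by (intro member_le_sum) auto
      hence "prod g S ^ (l - k) = prod g S ^ (sum N (idx i) - N S) * (prod g S ^ N S * prod g S ^ k)"
        by (simp add: l_def add.commute flip: power_add)
      moreover have "(a - b) l S = prod g S ^ (l - k) * (a - b) k S"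
        using reg_power[OF reg_mono[OF reg, of k], of l S] S by (simp add: k_def l_def)
      ultimately have "(a - b) l S = prod g S ^ (sum N (idx i) - N S) * (prod g S ^ N S * (prod g S ^ k * (a - b) k S))"
        by (simp only: mult.assoc)
      thus ?thesis using idl_mult[OF L N[OF S]] by simp
    qed
    thus "a - b \<in> CC i L" using reg_mono[OF reg, of l] by (intro CC_regI[of i l] L) (auto simp: l_def k_def)
  next
    assume "a - b \<in> CC i L"
    then obtain k4 where k4: "\<And>k S. k \<ge> k4 \<Longrightarrow> S \<in> idx i \<Longrightarrow> (a - b) k S \<in> L" unfolding CC_def by blast
    define k where "k = k1 + k2 + k4"
    have "1 * (prod g S ^ k * (a - b) k S) \<in> L" if "S \<in> idx i" for S
      using idl_mult[OF L k4[OF _ that, of k]] by (simp add: k_def)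
    hence "\<forall>S\<in>idx i. \<exists>u\<in>mon S. u * (prod g S ^ k * (a - b) k S) \<in> L" using one_mon by blast
    moreover have "k \<ge> k1" "k \<ge> k2" by (simp_all add: k_def)
    ultimately show "\<Phi> M \<pi> i a = \<Phi> M \<pi> i b" using eq by blast
  qed
qed

lemma Phi_0: "rep M \<pi> L \<Longrightarrow> \<Phi> M \<pi> i 0 = \<zero>\<^bsub>cech_module A xs M i\<^esub>"
  unfolding \<Phi>_def
  by (auto simp: cech_module_def cech_index_eq localization_zero[of M \<pi> L] fr_0[OF _ idx_subset power_mon]
      intro!: restrict_ext)

lemma fr_closed: "rep M \<pi> L \<Longrightarrow> S \<subseteq> {..<r} \<Longrightarrow> fr M \<pi> S a (prod g S ^ k) \<in> carrier (cech_loc A xs M S)"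
  using localization_carrier by blast

lemma Phi_carrier:
  assumes rep: "rep M \<pi> L"
  shows "\<Phi> M \<pi> i ` E i = carrier (cech_module A xs M i)"
proof (intro equalityI subsetI)
  fix f assume "f \<in> \<Phi> M \<pi> i ` E i"
  thus "f \<in> carrier (cech_module A xs M i)"
    unfolding \<Phi>_def cech_module_def by (auto simp: cech_index_eq intro!: fr_closed[OF rep idx_subset])
next
  fix f assume "f \<in> carrier (cech_module A xs M i)"
  hence f: "f \<in> (\<Pi>\<^sub>E S\<in>idx i. carrier (cech_loc A xs M S))" by (simp add: cech_module_def cech_index_eq)
  have "\<exists>a k. f S = fr M \<pi> S a (prod g S ^ k)" if "S \<in> idx i" for S
    using PiE_mem[OF f that] localization_carrier[OF rep idx_subset[OF that]] by auto
  then obtain a k where ak: "\<And>S. S \<in> idx i \<Longrightarrow> f S = fr M \<pi> S (a S) (prod g S ^ k S)" by metis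
  define K where "K = sum k (idx i)"
  have "f S = fr M \<pi> S (prod g S ^ (K - k S) * a S) (prod g S ^ K)" if S: "S \<in> idx i" for S
  proof -
    have "k S \<le> K" unfolding K_def using S finite_idx by (intro member_le_sum) auto
    hence "prod g S ^ K = prod g S ^ (K - k S) * prod g S ^ k S" by (simp flip: power_add)
    thus ?thesis using ak[OF S] fr_cancel[OF rep idx_subset[OF S] power_mon power_mon] by simp
  qed
  hence "f = \<Phi> M \<pi> i (ext K (\<lambda>S. prod g S ^ (K - k S) * a S))"
    unfolding Phi_ext[OF rep] using PiE_arb[OF f] by (auto simp: restrict_def fun_eq_iff)
  thus "f \<in> \<Phi> M \<pi> i ` E i" using E_regI[OF reg_ext] by blast
qed

lemma Phi_fraction_map:
  assumes rep: "rep M \<pi> L" "rep M' \<pi>' L'" "L \<subseteq> L'" "\<And>a. h (\<pi> a) = \<pi>' a" and c: "c \<in> E i"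
  shows "(\<lambda>S\<in>cech_index xs i. fraction_map A (monomials A xs S) M' h id (\<Phi> M \<pi> i c S)) = \<Phi> M' \<pi>' i c"
  unfolding \<Phi>_def cech_index_eq
  by (rule restrict_ext) (simp add: fraction_map_fr[where h = h, OF rep(1-3) order.refl idx_subset rep(4) power_mon])

lemma cech_diff_Phi:
  assumes rep: "rep M \<pi> L" and c: "c \<in> E i"
  shows "cech_diff A xs M i (\<Phi> M \<pi> i c) = \<Phi> M \<pi> (Suc i) (dd c)"
proof -
  obtain k1 k2 where k1: 
    "\<And>k. k \<ge> k1 \<Longrightarrow> \<Phi> M \<pi> i c = (\<lambda>S\<in>idx i. fr M \<pi> S (c k S) (prod g S ^ k))"
    "\<And>k. k \<ge> k2 \<Longrightarrow> \<Phi> M \<pi> (Suc i) (dd c) = (\<lambda>S\<in>idx (Suc i). fr M \<pi> S (dd c k S) (prod g S ^ k))"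
    using Phi_apply[OF rep c] Phi_apply[OF rep dd_E[OF c]] by blast
  define k where "k = k1 + k2"
  have k: "\<Phi> M \<pi> i c = (\<lambda>S\<in>idx i. fr M \<pi> S (c k S) (prod g S ^ k))"
    "\<Phi> M \<pi> (Suc i) (dd c) = (\<lambda>S\<in>idx (Suc i). fr M \<pi> S (dd c k S) (prod g S ^ k))"
    using k1 by (simp_all add: k_def)
  show ?thesis unfolding k(2) cech_diff_def cech_index_eq
  proof (rule restrict_ext)
    fix S assume S: "S \<in> idx (Suc i)"
    note rep' = rep idx_subset[OF S]
    interpret G: abelian_group "cech_loc A xs M S" by (rule localization_abelian_group[OF rep'])
    define f where "f a = fr M \<pi> S a (prod g S ^ k)" for a
    have f: "f a \<in> carrier (cech_loc A xs M S)" "f 0 = \<zero>\<^bsub>cech_loc A xs M S\<^esub>"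
      "f (a + b) = f a \<oplus>\<^bsub>cech_loc A xs M S\<^esub> f b" for a b
      using localization_carrier[OF rep'] fr_0[OF rep' power_mon] localization_zero[OF rep]
        fr_add[OF rep' power_mon] unfolding f_def by auto
    define y where "y s = fraction_map A (monomials A xs S) M id id (\<Phi> M \<pi> i c (S - {s}))" for s
    have y: "y s = f (g s ^ k * c k (S - {s}))" if s: "s \<in> S" for s
    proof -
      have "y s = fr M \<pi> S (c k (S - {s})) (prod g (S - {s}) ^ k)"
        unfolding y_def using idx_remove[OF S s]
        by (simp add: k(1) fraction_map_fr[where h = id, OF rep rep order.refl _ rep'(2) _ power_mon])
      \<comment> \<open>Expanding by \<open>g s ^ k\<close> gives all summands the denominator
        \<open>prod g S ^ k\<close>; this is where the coefficient in \<open>koszul\<close> comes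
        from.\<close>
      also have "\<dots> = fr M \<pi> S (g s ^ k * c k (S - {s})) (g s ^ k * prod g (S - {s}) ^ k)"
      proof (rule fr_cancel[OF rep', symmetric])
        show "prod g (S - {s}) ^ k \<in> mon S" using power_mon mon_mono[OF _ idx_finite[OF S]] by blast
        have "prod g {s} ^ k \<in> mon S" using power_mon mon_mono[OF _ idx_finite[OF S]] s by blast
        thus "g s ^ k \<in> mon S" by simp
      qed
      also have "g s ^ k * prod g (S - {s}) ^ k = prod g S ^ k"
        using s idx_finite[OF S] by (simp add: prod.remove flip: power_mult_distrib)
      finally show ?thesis by (simp add: f_def)
    qed
    have "(if even (card {t\<in>S. t < s}) then y s else \<ominus>\<^bsub>cech_loc A xs M S\<^esub> y s)
        = f (sg S s * g s ^ k * c k (S - {s}))" if s: "s \<in> S" for s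
      using G.additive_minus[of f, OF f] by (simp add: y[OF s] sg_def)
    hence "(\<Oplus>\<^bsub>cech_loc A xs M S\<^esub>s\<in>S. if even (card {t\<in>S. t < s}) then y s else \<ominus>\<^bsub>cech_loc A xs M S\<^esub> y s)
        = (\<Oplus>\<^bsub>cech_loc A xs M S\<^esub>s\<in>S. f (sg S s * g s ^ k * c k (S - {s})))"
      by (intro G.finsum_cong') (auto simp: f)
    also have "\<dots> = f (\<Sum>s\<in>S. sg S s * g s ^ k * c k (S - {s}))"
      by (rule G.additive_finsum[of f, OF f idx_finite[OF S]])
    also have "\<dots> = fr M \<pi> S (dd c k S) (prod g S ^ k)" by (simp add: f_def dd_def koszul_def)
    finally show "(\<Oplus>\<^bsub>cech_loc A xs M S\<^esub>s\<in>S. let y = fraction_map A (monomials A xs S) M id id (\<Phi> M \<pi> i c (S - {s}))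
        in if even (card {t\<in>S. t < s}) then y else \<ominus>\<^bsub>cech_loc A xs M S\<^esub> y) = fr M \<pi> S (dd c k S) (prod g S ^ k)"
      unfolding Let_def y_def .
  qed
qed

lemma cech_cocycles_eq:
  assumes rep: "rep M \<pi> L"
  shows "cech_cocycles A xs M i = \<Phi> M \<pi> i ` Z i L"
proof -
  have "cech_diff A xs M i (\<Phi> M \<pi> i c) = \<zero>\<^bsub>cech_module A xs M (Suc i)\<^esub> \<longleftrightarrow> dd c \<in> CC (Suc i) L"
    if "c \<in> E i" for c
    using Phi_eq[OF rep dd_E[OF that] subm_0[OF subm_E]]
    by (simp add: cech_diff_Phi[OF rep that] Phi_0[OF rep])
  thus ?thesis unfolding cech_cocycles_def Z_def Phi_carrier[OF rep, symmetric] by auto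
qed

lemma cech_coboundaries_eq:
  assumes rep: "rep M \<pi> L"
  shows "cech_coboundaries A xs M i = \<Phi> M \<pi> i ` bd i"
proof (cases i)
  case 0
  thus ?thesis by (simp add: cech_coboundaries_def bd_def Phi_0[OF rep])
next
  case (Suc j)
  have "cech_diff A xs M j ` (\<Phi> M \<pi> j ` E j) = \<Phi> M \<pi> (Suc j) ` (dd ` E j)"
    unfolding image_image by (intro image_cong refl cech_diff_Phi[OF rep])
  thus ?thesis by (simp add: Suc cech_coboundaries_def bd_def Phi_carrier[OF rep])
qed

definition cls :: "('a, 'b, 'n) module_scheme \<Rightarrow> ('p \<Rightarrow> 'b) \<Rightarrow> nat \<Rightarrow> 'p cochain \<Rightarrow> (nat set \<Rightarrow> ('b \<times> 'a) set) set" where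
  "cls M \<pi> i c = (\<lambda>b. \<Phi> M \<pi> i (b + c)) ` bd i"

lemma coset_eq_cls:
  assumes rep: "rep M \<pi> L" and c: "c \<in> E i"
  shows "cech_coboundaries A xs M i +>\<^bsub>cech_module A xs M i\<^esub> \<Phi> M \<pi> i c = cls M \<pi> i c"
  using Phi_add[OF rep bd_E c]
  unfolding cech_coboundaries_eq[OF rep] cls_def a_r_coset_def r_coset_def by auto

lemma cls_eq:
  assumes rep: "rep M \<pi> L" and c: "c \<in> E i" "c' \<in> E i"
  shows "cls M \<pi> i c = cls M \<pi> i c' \<longleftrightarrow> c - c' \<in> B i L"
proof
  note L = rep_idl[OF rep]
  assume "cls M \<pi> i c = cls M \<pi> i c'"
  moreover have "\<Phi> M \<pi> i (0 + c) \<in> cls M \<pi> i c" unfolding cls_def using subm_0[OF subm_bd] by blast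
  ultimately obtain b where b: "b \<in> bd i" "\<Phi> M \<pi> i c = \<Phi> M \<pi> i (b + c')" unfolding cls_def by auto
  have "b + c' \<in> E i" using bd_E[OF b(1)] c subm_add[OF subm_E] by blast
  hence "c - (b + c') \<in> CC i L" using Phi_eq[OF rep c(1)] b(2) by blast
  from B_memI[OF b(1) this] show "c - c' \<in> B i L" by simp
next
  note L = rep_idl[OF rep]
  have sub: "cls M \<pi> i c \<subseteq> cls M \<pi> i c'" if c: "c \<in> E i" "c' \<in> E i" and B: "c - c' \<in> B i L" for c c'
  proof
    fix f assume "f \<in> cls M \<pi> i c"
    then obtain b where b: "b \<in> bd i" "f = \<Phi> M \<pi> i (b + c)" unfolding cls_def by blast
    obtain b' u where bu: "c - c' = b' + u" "b' \<in> bd i" "u \<in> CC i L" using B by (auto simp: B_def)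
    have bb: "b + b' \<in> bd i" using b bu subm_add[OF subm_bd] by blast
    have "(b + c) - ((b + b') + c') = u" using bu(1) by (simp add: algebra_simps)
    moreover have "b + c \<in> E i" "(b + b') + c' \<in> E i" using b bb bd_E c subm_add[OF subm_E] by blast+
    ultimately have "f = \<Phi> M \<pi> i ((b + b') + c')" using Phi_eq[OF rep] bu(3) b(2) by simp
    thus "f \<in> cls M \<pi> i c'" unfolding cls_def using bb by blast
  qed
  assume B: "c - c' \<in> B i L"
  have "c' - c \<in> B i L" using subm_minus[OF subm_B[OF L] B] by simp
  thus "cls M \<pi> i c = cls M \<pi> i c'" using sub B c by blast
qed

lemma cech_cohomology_carrier:
  assumes rep: "rep M \<pi> L"
  shows "carrier (cech_cohomology A xs M i) = cls M \<pi> i ` Z i L"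
proof -
  have "carrier (cech_cohomology A xs M i)
      = (\<lambda>f. cech_coboundaries A xs M i +>\<^bsub>cech_module A xs M i\<^esub> f) ` cech_cocycles A xs M i"
    by (auto simp: cech_cohomology_def quotient_module_def A_RCOSETS_def RCOSETS_def a_r_coset_def r_coset_def)
  also have "\<dots> = cls M \<pi> i ` Z i L"
    unfolding cech_cocycles_eq[OF rep] image_image using coset_eq_cls[OF rep Z_E] by (intro image_cong) auto
  finally show ?thesis .
qed

lemma cech_cohomology_zero:
  assumes rep: "rep M \<pi> L"
  shows "\<zero>\<^bsub>cech_cohomology A xs M i\<^esub> = cls M \<pi> i 0"
  by (simp add: cech_cohomology_def quotient_module_def cech_coboundaries_eq[OF rep] cls_def)

text \<open>The representative \<open>c\<close> is unchanged. Other members of the class differ from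
  it by absolute boundaries in \<open>bd i\<close>, which are coboundaries modulo every
  ideal.\<close>

lemma cech_cohomology_map_cls:
  assumes rep: "rep M \<pi> L" "rep M' \<pi>' L'" "L \<subseteq> L'" "\<And>a. h (\<pi> a) = \<pi>' a" and c: "c \<in> E i"
  shows "cech_cohomology_map A xs M' h id i (cls M \<pi> i c) = cls M' \<pi>' i c"
proof -
  have "cech_coboundaries A xs M' i +>\<^bsub>cech_module A xs M' i\<^esub>
      (\<lambda>S\<in>cech_index xs i. fraction_map A (monomials A xs S) M' h id (\<Phi> M \<pi> i (b + c) S)) = cls M' \<pi>' i c"
    if b: "b \<in> bd i" for b
  proof -
    have E: "b + c \<in> E i" using bd_E[OF b] c subm_add[OF subm_E] by blast
    have "cls M' \<pi>' i (b + c) = cls M' \<pi>' i c"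
      using bd_subset_B[OF rep_idl[OF rep(2)]] b by (subst cls_eq[OF rep(2) E c]) auto
    thus ?thesis
      unfolding Phi_fraction_map[where h = h, OF rep E] coset_eq_cls[OF rep(2) E] .
  qed
  moreover have "bd i \<noteq> {}" using subm_0[OF subm_bd] by blast
  ultimately show ?thesis
    unfolding cech_cohomology_map_def coset_map_def cls_def[of M] by simp
qed

end

section \<open>Presenting a ring by a polynomial ring\<close>

text \<open>The polynomials over the integers with the elements of \<open>'a\<close> as variables form a type of
  class \<open>comm_ring_1\<close>; evaluation maps them onto the given ring. Variables outside the carrier
  are sent to zero.\<close>

type_synonym 'a polys = "'a multiset \<Rightarrow>\<^sub>0 int"

context cring
begin

definition var_val :: "'a \<Rightarrow> 'a" where
  "var_val a = (if a \<in> carrier R then a else \<zero>)"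

definition mon_val :: "'a multiset \<Rightarrow> 'a" where
  "mon_val m = (\<Otimes>a\<in>set_mset m. var_val a [^] count m a)"

definition eval_poly :: "'a polys \<Rightarrow> 'a" where
  "eval_poly f = (\<Oplus>m\<in>Poly_Mapping.keys f. add_pow R (Poly_Mapping.lookup f m) (mon_val m))"

lemma var_val_closed: "var_val a \<in> carrier R"
  by (simp add: var_val_def)

lemma mon_val_closed: "mon_val m \<in> carrier R"
  unfolding mon_val_def by (intro finprod_closed) (auto simp: var_val_closed)

lemma mon_val_superset:
  assumes "finite U" "set_mset m \<subseteq> U"
  shows "mon_val m = (\<Otimes>a\<in>U. var_val a [^] count m a)"
  unfolding mon_val_def
  using assms by (intro finprod_mono_neutral_cong_left) (auto simp: var_val_closed not_in_iff Pi_def)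

lemma mon_val_add: "mon_val (m + n) = mon_val m \<otimes> mon_val n"
proof -
  define U where "U = set_mset (m + n)"
  have U: "finite U" "set_mset m \<subseteq> U" "set_mset n \<subseteq> U" "set_mset (m + n) \<subseteq> U" by (auto simp: U_def)
  have "mon_val (m + n) = (\<Otimes>a\<in>U. var_val a [^] count m a \<otimes> var_val a [^] count n a)"
    unfolding mon_val_superset[OF U(1,4)] by (simp add: nat_pow_mult var_val_closed)
  also have "\<dots> = mon_val m \<otimes> mon_val n"
    unfolding mon_val_superset[OF U(1,2)] mon_val_superset[OF U(1,3)]
    by (rule finprod_multf) (auto simp: var_val_closed)
  finally show ?thesis .
qed

lemma add_pow_0_int: "add_pow R (0::int) x = \<zero>"
  by (simp add: add_pow_def)

lemma eval_poly_superset: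
  assumes "finite U" "Poly_Mapping.keys f \<subseteq> U"
  shows "eval_poly f = (\<Oplus>m\<in>U. add_pow R (Poly_Mapping.lookup f m) (mon_val m))"
  unfolding eval_poly_def
  using assms
  by (intro add.finprod_mono_neutral_cong_left) (auto simp: mon_val_closed in_keys_iff Pi_def add_pow_0_int)

lemma eval_poly_closed: "eval_poly f \<in> carrier R"
  unfolding eval_poly_def by (intro finsum_closed) (auto simp: mon_val_closed)

lemma eval_poly_add: "eval_poly (f + h) = eval_poly f \<oplus> eval_poly h"
proof -
  define U where "U = Poly_Mapping.keys f \<union> Poly_Mapping.keys h"
  have U: "finite U" "Poly_Mapping.keys f \<subseteq> U" "Poly_Mapping.keys h \<subseteq> U" "Poly_Mapping.keys (f + h) \<subseteq> U"
    using Poly_Mapping.keys_add[of f h] by (auto simp: U_def)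
  have "eval_poly (f + h) = (\<Oplus>m\<in>U. add_pow R (Poly_Mapping.lookup f m) (mon_val m)
      \<oplus> add_pow R (Poly_Mapping.lookup h m) (mon_val m))"
    unfolding eval_poly_superset[OF U(1,4)] by (simp add: lookup_add add.int_pow_mult mon_val_closed)
  also have "\<dots> = eval_poly f \<oplus> eval_poly h"
    unfolding eval_poly_superset[OF U(1,2)] eval_poly_superset[OF U(1,3)]
    by (rule finsum_addf) (auto simp: mon_val_closed)
  finally show ?thesis .
qed

lemma eval_poly_single: "eval_poly (Poly_Mapping.single m k) = add_pow R k (mon_val m)"
  by (subst eval_poly_superset[of "{m}"]) (auto simp: mon_val_closed)

lemma eval_poly_1: "eval_poly 1 = \<one>"
  using eval_poly_single[of 0 1] by (simp add: mon_val_def)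

lemma poly_induct [case_names zero single add]:
  fixes f :: "'a polys"
  assumes "P 0" "\<And>m k. P (Poly_Mapping.single m k)" "\<And>f h. P f \<Longrightarrow> P h \<Longrightarrow> P (f + h)"
  shows "P f"
proof (induction f rule: update_induct)
  case const
  show ?case by (rule assms(1))
next
  case (update f m k)
  have "Poly_Mapping.update m k f = Poly_Mapping.single m k + f"
    using update.hyps(1) by (intro poly_mapping_eqI) (auto simp: lookup_update lookup_add lookup_single in_keys_iff when_def)
  thus ?case using assms(2,3) update by simp
qed

lemma eval_poly_0: "eval_poly 0 = \<zero>"
  by (simp add: eval_poly_def)

lemma eval_poly_mult: "eval_poly (f * h) = eval_poly f \<otimes> eval_poly h"
proof (induction f rule: poly_induct)
  case zero
  show ?case by (simp add: eval_poly_0 eval_poly_closed)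
next
  case (add f f')
  thus ?case by (simp add: distrib_right eval_poly_add l_distr eval_poly_closed)
next
  case (single m k)
  show ?case
  proof (induction h rule: poly_induct)
    case zero
    show ?case by (simp add: eval_poly_0 eval_poly_closed)
  next
    case (add f f')
    thus ?case by (simp add: distrib_left eval_poly_add r_distr eval_poly_closed)
  next
    case (single n l)
    show ?case
      by (simp add: mult_single eval_poly_single mon_val_add mon_val_closed add_pow_ldistr_int
          add_pow_rdistr_int add.int_pow_pow mult.commute)
  qed
qed

lemma range_eval_poly: "range eval_poly = carrier R"
proof -
  have "eval_poly (Poly_Mapping.single {#a#} 1) = a" if "a \<in> carrier R" for a
    using that by (simp add: eval_poly_single mon_val_def var_val_def)
  thus ?thesis using eval_poly_closed by (metis image_subset_iff rangeI subsetI subset_antisym)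
qed

end

section \<open>Ideals under a surjection\<close>

context surjection
begin

definition pre :: "'a set \<Rightarrow> 'p set" where
  "pre J = ev -` J"

abbreviation kern :: "'p set" where
  "kern \<equiv> pre {\<zero>}"

lemma mem_pre: "p \<in> pre J \<longleftrightarrow> ev p \<in> J"
  by (simp add: pre_def)

lemma ev_diff: "ev (a - b) = ev a \<ominus> ev b"
  using ev_add[of a "- b"] by (simp add: ev_minus a_minus_def)

lemma ev_surj: "x \<in> carrier A \<Longrightarrow> \<exists>p. ev p = x"
  using ev_range by (metis imageE)

lemma idl_pre:
  assumes "ideal J A"
  shows "idl (pre J)"
proof -
  interpret J: ideal J A by (rule assms)
  show ?thesis unfolding idl_def mem_pre ev_add ev_mult
    by (auto simp: mem_pre ev_0 J.I_l_closed ev_closed)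
qed

lemma idl_kern: "idl kern"
  by (rule idl_pre[OF zeroideal])

lemma kern_subset_pre:
  assumes "ideal J A"
  shows "kern \<subseteq> pre J"
proof -
  interpret J: ideal J A by (rule assms)
  show ?thesis by (auto simp: mem_pre)
qed

lemma ideal_image:
  assumes "idl L"
  shows "ideal (ev ` L) A"
proof (rule idealI)
  show "ring A" by (rule ring_axioms)
  show "subgroup (ev ` L) (add_monoid A)"
  proof (unfold_locales, goal_cases)
    case 1 thus ?case using ev_closed by auto
  next
    case (2 x y) thus ?case using idl_add[OF assms] by (auto simp flip: ev_add)
  next
    case 3 thus ?case using idl_0[OF assms] by (auto simp flip: ev_0)
  next
    case (4 x)
    then obtain a where "x = ev a" "a \<in> L" by blast
    hence "ev (- a) \<in> ev ` L" using idl_minus[OF assms] by blast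
    thus ?case using \<open>x = ev a\<close> by (simp add: ev_minus a_inv_def)
  qed
  fix a x assume "a \<in> ev ` L" "x \<in> carrier A"
  then obtain l p where "a = ev l" "l \<in> L" "x = ev p" using ev_surj by (metis imageE)
  thus "x \<otimes> a \<in> ev ` L" "a \<otimes> x \<in> ev ` L"
    using idl_mult[OF assms, of l p] idl_mult2[OF assms, of l p] by (auto simp flip: ev_mult)
qed

lemma pre_image:
  assumes "idl L" "kern \<subseteq> L"
  shows "pre (ev ` L) = L"
proof
  show "pre (ev ` L) \<subseteq> L"
  proof
    fix p assume "p \<in> pre (ev ` L)"
    then obtain l where l: "ev p = ev l" "l \<in> L" by (auto simp: mem_pre)
    have "p - l \<in> kern" using l(1) by (simp add: mem_pre ev_diff a_minus_def r_neg ev_closed)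
    hence "(p - l) + l \<in> L" using assms l(2) idl_add by blast
    thus "p \<in> L" by simp
  qed
qed (auto simp: mem_pre)

lemma image_pre: "J \<subseteq> carrier A \<Longrightarrow> ev ` pre J = J"
  using ev_surj by (force simp: mem_pre)

text \<open>A strictly ascending sequence above the kernel maps to a chain of ideals of
  \<open>A\<close> whose union is one of its members. Strictness survives the passage to
  \<open>A\<close>, because an ideal above the kernel is recovered from its image.\<close>

lemma noeth_kern:
  assumes "noetherian_ring A"
  shows "noeth kern"
  unfolding noeth_def wf_iff_no_infinite_down_chain
proof (rule notI, elim exE)
  fix f assume f0: "\<forall>i. (f (Suc i), f i) \<in> {(L', L). idl L \<and> idl L' \<and> kern \<subseteq> L \<and> L \<subset> L'}"
  have f: "idl (f i)" "kern \<subseteq> f i" "f i \<subset> f (Suc i)" for i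
    using f0[rule_format, of i] by simp_all
  have mono: "f i \<subseteq> f j" if "i \<le> j" for i j
    using lift_Suc_mono_le[of f, OF _ that] f(3) by blast
  have "subset.chain {I. ideal I A} (range (\<lambda>i. ev ` f i))"
    unfolding subset_chain_def
  proof (intro conjI ballI)
    show "range (\<lambda>i. ev ` f i) \<subseteq> {I. ideal I A}" using ideal_image[OF f(1)] by blast
    fix U V assume "U \<in> range (\<lambda>i. ev ` f i)" "V \<in> range (\<lambda>i. ev ` f i)"
    then obtain i j where ij: "U = ev ` f i" "V = ev ` f j" by blast
    show "U \<subseteq> V \<or> V \<subseteq> U" using mono[of i j] mono[of j i] linear[of i j] unfolding ij by blast
  qed
  hence "\<Union>(range (\<lambda>i. ev ` f i)) \<in> range (\<lambda>i. ev ` f i)"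
    using noetherian_ring.ideal_chain_is_trivial[OF assms] by blast
  then obtain n where n: "(\<Union>i. ev ` f i) = ev ` f n" by (rule rangeE)
  have "ev ` f (Suc n) \<subseteq> (\<Union>i. ev ` f i)" by (rule UN_upper) simp
  hence "ev ` f (Suc n) \<subseteq> ev ` f n" by (simp only: n)
  hence "pre (ev ` f (Suc n)) \<subseteq> pre (ev ` f n)" by (auto simp: pre_def)
  thus False using f(3)[of n] by (simp add: pre_image f(1,2))
qed

lemma image_foldl_adjoin: "ev ` foldl adjoin kern ys = genideal A (ev ` set ys)"
proof
  note L = foldl_adjoin[OF idl_kern, of ys]
  have sub: "ev ` set ys \<subseteq> carrier A" using ev_closed by blast
  note G = genideal_ideal[OF sub]
  show "genideal A (ev ` set ys) \<subseteq> ev ` foldl adjoin kern ys"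
    by (rule genideal_minimal[OF ideal_image]) (use L in auto)
  have "set ys \<subseteq> pre (genideal A (ev ` set ys))" using genideal_self[OF sub] by (auto simp: mem_pre)
  hence "foldl adjoin kern ys \<subseteq> pre (genideal A (ev ` set ys))"
    by (intro foldl_adjoin_least idl_pre kern_subset_pre G)
  thus "ev ` foldl adjoin kern ys \<subseteq> genideal A (ev ` set ys)" by (auto simp: mem_pre)
qed

lemma pre_genideal: "pre (genideal A (ev ` set ys)) = foldl adjoin kern ys"
  using pre_image[of "foldl adjoin kern ys"] foldl_adjoin[OF idl_kern, of ys]
  by (simp add: image_foldl_adjoin)

lemma regular_sequence_regseq:
  assumes "regular_sequence A (map ev ys)"
  shows "regseq kern ys"
proof (rule regseqI)
  fix i assume i: "i < length ys"
  define J where "J = foldl adjoin kern (take i ys)"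
  have J: "pre (genideal A (set (take i (map ev ys)))) = J" "idl J"
    using foldl_adjoin[OF idl_kern] by (simp_all add: take_map pre_genideal J_def)
  have "a \<in> J" if "ys ! i * a \<in> J" for a
    using assms i that ev_closed unfolding regular_sequence_def J(1)[symmetric] mem_pre ev_mult by auto
  thus "colon (foldl adjoin kern (take i ys)) (ys ! i) = foldl adjoin kern (take i ys)"
    using subset_colon[OF J(2)] unfolding J_def[symmetric] by (auto simp: colon_def)
qed

lemma powers_pre:
  assumes "noetherian_ring A" and I: "ideal I A"
  shows "powers kern (\<lambda>n. pre (I [^]\<^bsub>ideals_set A\<^esub> (n :: nat)))"
proof -
  interpret S: semiring "ideals_set A" by (rule ideals_set_is_semiring)
  have carr: "I \<in> carrier (ideals_set A)" using I by (simp add: ideals_set_def)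
  have In: "ideal (I [^]\<^bsub>ideals_set A\<^esub> n) A" for n :: nat
    using S.nat_pow_closed[OF carr, of n] by (simp add: ideals_set_def)
  have mult: "I [^]\<^bsub>ideals_set A\<^esub> (m + n) = (I [^]\<^bsub>ideals_set A\<^esub> m) \<cdot> (I [^]\<^bsub>ideals_set A\<^esub> n)" for m n :: nat
    using S.nat_pow_mult[OF carr, of m n] by (simp add: ideals_set_def)
  show ?thesis
  proof
    show "noeth kern" by (rule noeth_kern[OF assms(1)])
    show "idl (pre (I [^]\<^bsub>ideals_set A\<^esub> n))" "kern \<subseteq> pre (I [^]\<^bsub>ideals_set A\<^esub> n)" for n :: nat
      by (rule idl_pre[OF In], rule kern_subset_pre[OF In])
    show "pre (I [^]\<^bsub>ideals_set A\<^esub> (0 :: nat)) = UNIV"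
      using ev_closed by (auto simp: mem_pre ideals_set_def nat_pow_def)
    show "a * b \<in> pre (I [^]\<^bsub>ideals_set A\<^esub> (m + n))"
      if "a \<in> pre (I [^]\<^bsub>ideals_set A\<^esub> m)" "b \<in> pre (I [^]\<^bsub>ideals_set A\<^esub> n)" for a b and m n :: nat
      using that by (simp add: mem_pre mult ev_mult ideal_prod.prod)
  next
    fix Q :: "'p set" and m n :: nat
    assume Q: "idl Q" "kern \<subseteq> Q" and prodQ: "\<And>a b. a \<in> pre (I [^]\<^bsub>ideals_set A\<^esub> m) \<Longrightarrow>
      b \<in> pre (I [^]\<^bsub>ideals_set A\<^esub> n) \<Longrightarrow> a * b \<in> Q"
    have "x \<in> ev ` Q" if "x \<in> (I [^]\<^bsub>ideals_set A\<^esub> m) \<cdot> (I [^]\<^bsub>ideals_set A\<^esub> n)" for x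
      using that
    proof (induction rule: ideal_prod.induct)
      case (prod i j)
      obtain a where a: "ev a = i" using ev_surj[OF ideal.Icarr[OF In prod.hyps(1)]] by blast
      obtain b where b: "ev b = j" using ev_surj[OF ideal.Icarr[OF In prod.hyps(2)]] by blast
      have "a * b \<in> Q" using prod.hyps a b by (intro prodQ) (simp_all add: mem_pre)
      hence "ev (a * b) \<in> ev ` Q" by blast
      thus ?case by (simp add: ev_mult a b)
    next
      case (sum x y)
      thus ?case using idl_add[OF Q(1)] by (auto simp flip: ev_add)
    qed
    hence "pre (I [^]\<^bsub>ideals_set A\<^esub> (m + n)) \<subseteq> pre (ev ` Q)" unfolding mult by (auto simp: mem_pre)
    thus "pre (I [^]\<^bsub>ideals_set A\<^esub> (m + n)) \<subseteq> Q" by (simp add: pre_image[OF Q])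
  qed
qed

text \<open>The chain condition takes the place of Zorn's lemma: an ideal maximal among the proper
  ones above \<open>J\<close> has a maximal ideal as image, and \<open>\<mm>\<close> is the only
  one.\<close>

lemma proper_ideal_subset_maximal:
  assumes A: "noetherian_local_ring A \<mm>" and J: "ideal J A" "J \<noteq> carrier A"
  shows "J \<subseteq> \<mm>"
proof -
  have one: "1 \<notin> pre J'" if "ideal J' A" "J' \<noteq> carrier A" for J'
    using ideal.one_imp_carrier[OF that(1)] that(2) by (auto simp: mem_pre ev_1)
  obtain L where L: "L \<in> {L. idl L \<and> kern \<subseteq> L \<and> pre J \<subseteq> L \<and> 1 \<notin> L}"
    and Lmax: "\<And>L'. L' \<in> {L. idl L \<and> kern \<subseteq> L \<and> pre J \<subseteq> L \<and> 1 \<notin> L} \<Longrightarrow> L \<subseteq> L' \<Longrightarrow> L' = L"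
  proof (rule noeth_max[OF noeth_kern, of "pre J" "{L. idl L \<and> kern \<subseteq> L \<and> pre J \<subseteq> L \<and> 1 \<notin> L}"])
    show "noetherian_ring A" using A by (simp add: noetherian_local_ring_def)
    show "pre J \<in> {L. idl L \<and> kern \<subseteq> L \<and> pre J \<subseteq> L \<and> 1 \<notin> L}"
      using idl_pre[OF J(1)] kern_subset_pre[OF J(1)] one[OF J] by blast
  qed (blast, rule that)
  have pre_L: "pre (ev ` L) = L" using L by (intro pre_image) auto
  have "maximalideal (ev ` L) A"
  proof (rule maximalidealI)
    show "ideal (ev ` L) A" using L by (intro ideal_image) auto
    show "carrier A \<noteq> ev ` L" using pre_L L ev_closed[of 1] by (auto simp: pre_def)
    fix J' assume J': "ideal J' A" "ev ` L \<subseteq> J'" "J' \<subseteq> carrier A"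
    have sub: "L \<subseteq> pre J'" using J'(2) by (auto simp: mem_pre)
    show "J' = ev ` L \<or> J' = carrier A"
    proof (cases "J' = carrier A")
      case False
      have "pre J' = L"
        using L sub idl_pre[OF J'(1)] one[OF J'(1) False] by (intro Lmax) auto
      thus ?thesis using image_pre[OF J'(3)] by simp
    qed simp
  qed
  hence "ev ` L = \<mm>" using A by (simp add: noetherian_local_ring_def)
  moreover have "J \<subseteq> ev ` L"
    using L image_pre[of J] ideal.Icarr[OF J(1)] by blast
  ultimately show ?thesis by simp
qed

lemma ring_module_simps:
  "carrier (ring_module A) = carrier A" "ring.add (ring_module A) = ring.add A"
  "ring.zero (ring_module A) = \<zero>" "smult (ring_module A) = monoid.mult A"
  by (simp_all add: ring_module_def)

lemma ring_module_coset: "J +>\<^bsub>ring_module A\<^esub> x = J +> x"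
  by (simp add: a_r_coset_def' ring_module_simps)

lemma coset_mem:
  assumes "ideal J A"
  shows "ev a \<in> J +> ev b \<longleftrightarrow> a - b \<in> pre J"
proof -
  interpret J: ideal J A by (rule assms)
  show ?thesis using J.a_rcos_module_minus[OF ring_axioms ev_closed ev_closed] by (simp add: mem_pre ev_diff)
qed

lemma coset_eq:
  assumes "ideal J A"
  shows "J +> ev a = J +> ev b \<longleftrightarrow> a - b \<in> pre J"
proof -
  interpret J: ideal J A by (rule assms)
  show ?thesis unfolding coset_mem[OF assms, symmetric]
    using J.a_rcos_self[OF ev_closed] J.a_repr_independence'[OF _ ev_closed] by metis
qed

lemma coset_map_coset:
  assumes J: "ideal J A" "ideal J' A" and f: "\<And>c. f (ev c) = ev (f' c)"
    and f': "\<And>c. c - a \<in> pre J' \<Longrightarrow> f' c - f' a \<in> pre J"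
  shows "coset_map (ring_module A) J f (J' +> ev a) = J +> ev (f' a)"
proof -
  interpret J': ideal J' A by (rule J(2))
  have "J +> f z = J +> ev (f' a)" if "z \<in> J' +> ev a" for z
  proof -
    have "z \<in> carrier A" using that a_r_coset_subset_G[OF J'.a_subset ev_closed] by blast
    then obtain c where "z = ev c" using ev_surj by metis
    thus ?thesis using that f' by (simp add: f coset_eq[OF J(1)] coset_mem[OF J(2)])
  qed
  moreover have "ev a \<in> J' +> ev a" by (rule J'.a_rcos_self[OF ev_closed])
  ultimately show ?thesis unfolding coset_map_def ring_module_coset by auto
qed

end

context presentation
begin

lemma rep_ring_module: "rep (ring_module A) ev kern"
  by (auto simp: rep_def ring_module_simps ev_range ev_0 ev_add ev_mult idl_kern mem_pre ev_diff
      r_right_minus_eq ev_closed)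

lemma rep_quotient:
  assumes J: "ideal J A"
  shows "rep (quotient_module (ring_module A) J) (\<lambda>p. J +> ev p) (pre J)"
proof -
  interpret J: ideal J A by (rule J)
  have "a_rcosets\<^bsub>ring_module A\<^esub> J = (\<lambda>x. J +> x) ` range ev"
    by (auto simp: A_RCOSETS_def' ring_module_coset ring_module_simps ev_range)
  moreover have "J +> ev 0 = J" using a_coset_add_zero[OF J.a_subset] by (simp add: ev_0)
  moreover have "set_add (ring_module A) U V = U <+> V" for U V
    by (simp add: set_add_def' ring_module_simps)
  moreover have "coset_map (ring_module A) J (\<lambda>m. ev x \<otimes> m) (J +> ev a) = J +> ev (x * a)" for x a
    using coset_map_coset[OF J J, of "\<lambda>m. ev x \<otimes> m" "\<lambda>p. x * p"] idl_mult[OF idl_pre[OF J], of _ x]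
    by (simp add: ev_mult flip: right_diff_distrib)
  ultimately show ?thesis
    unfolding rep_def quotient_module_def
    by (simp add: image_image ev_add J.a_rcos_sum[OF ev_closed ev_closed] ring_module_simps coset_eq[OF J] idl_pre[OF J])
qed

end

section \<open>Depth, formal grade and Frobenius depth\<close>

locale local_surjection = surjection A ev
  for A :: "('a, 'm) ring_scheme" (structure) and ev :: "'p::comm_ring_1 \<Rightarrow> 'a" +
  fixes \<mm> I :: "'a set"
  assumes A: "noetherian_local_ring A \<mm>" and I: "ideal I A" "I \<noteq> carrier A"
begin

abbreviation gens :: "'a list" where
  "gens \<equiv> ideal_gens A \<mm>"

abbreviation gen :: "nat \<Rightarrow> 'p" where
  "gen s \<equiv> SOME p. ev p = gens ! s"

abbreviation In :: "nat \<Rightarrow> 'p set" where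
  "In n \<equiv> pre (I [^]\<^bsub>ideals_set A\<^esub> n)"

lemma noetherian: "noetherian_ring A"
  and maximal: "maximalideal \<mm> A"
  using A by (simp_all add: noetherian_local_ring_def)

lemma ideal_m: "ideal \<mm> A"
  by (rule maximalideal.axioms(1)[OF maximal])

lemma m_subset: "\<mm> \<subseteq> carrier A"
  using ideal.Icarr[OF ideal_m] by blast

lemma gens: "set gens \<subseteq> carrier A" "genideal A (set gens) = \<mm>"
proof -
  obtain S where "S \<subseteq> carrier A" "finite S" "\<mm> = genideal A S"
    using noetherian_ring.finetely_gen[OF noetherian ideal_m] by blast
  hence "\<exists>xs. set xs \<subseteq> carrier A \<and> genideal A (set xs) = \<mm>" using finite_list by metis
  hence "set gens \<subseteq> carrier A \<and> genideal A (set gens) = \<mm>" unfolding ideal_gens_def by (rule someI_ex)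
  thus "set gens \<subseteq> carrier A" "genideal A (set gens) = \<mm>" by auto
qed

lemma ev_gen: "s < length gens \<Longrightarrow> ev (gen s) = gens ! s"
  using gens(1) ev_surj[of "gens ! s"] by (intro someI_ex[of "\<lambda>p. ev p = gens ! s"]) (auto dest: nth_mem)

sublocale presentation A ev gen "length gens" gens
  by unfold_locales (simp_all add: ev_gen)

sublocale local_cech gen "length gens" kern In "pre \<mm>"
proof -
  interpret P: powers kern In by (rule powers_pre[OF noetherian I(1)])
  have I1: "I [^]\<^bsub>ideals_set A\<^esub> (1 :: nat) = I"
  proof -
    interpret S: semiring "ideals_set A" by (rule ideals_set_is_semiring)
    show ?thesis using S.nat_pow_eone[of I] I(1) by (simp add: ideals_set_def)
  qed
  show "local_cech gen (length gens) kern In (pre \<mm>)"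
  proof
    show "idl kern" "idl (pre \<mm>)" by (rule idl_kern, rule idl_pre[OF ideal_m])
    show "In 1 \<subseteq> pre \<mm>"
      using proper_ideal_subset_maximal[OF A I] unfolding I1 by (auto simp: mem_pre)
    show "gen j \<in> pre \<mm>" if "j < length gens" for j
      using genideal_self[OF gens(1)] that by (auto simp: mem_pre ev_gen gens(2))
  next
    fix Q assume Q: "idl Q" "kern \<subseteq> Q" "\<And>j. j < length gens \<Longrightarrow> gen j \<in> Q"
    have "set gens \<subseteq> ev ` Q"
    proof
      fix x assume "x \<in> set gens"
      then obtain j where "j < length gens" "x = gens ! j" by (metis in_set_conv_nth)
      thus "x \<in> ev ` Q" using Q(3) ev_gen by (metis imageI)
    qed
    hence "genideal A (set gens) \<subseteq> ev ` Q" by (rule genideal_minimal[OF ideal_image[OF Q(1)]])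
    hence "\<mm> \<subseteq> ev ` Q" by (simp only: gens(2))
    hence "pre \<mm> \<subseteq> pre (ev ` Q)" by (auto simp: mem_pre)
    thus "pre \<mm> \<subseteq> Q" by (simp add: pre_image[OF Q(1,2)])
  next
    fix a assume a: "a \<notin> pre \<mm>"
    \<comment> \<open>By maximality the image of \<open>pre \<mm> + a P\<close> is all of
      \<open>A\<close>. Writing 1 in this form determines the inverse \<open>b\<close> modulo
      \<open>\<mm>\<close>, up to the kernel, which lies in \<open>pre \<mm>\<close>.\<close>
    define L where "L = adjoin (pre \<mm>) a"
    have L: "idl L" "pre \<mm> \<subseteq> L" "a \<in> L"
      using idl_adjoin subset_adjoin self_mem_adjoin idl_pre[OF ideal_m] unfolding L_def by blast+
    have "ev ` L = \<mm> \<or> ev ` L = carrier A"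
    proof (rule maximalideal.I_maximal[OF maximal ideal_image[OF L(1)]])
      show "\<mm> \<subseteq> ev ` L" using L(2) image_pre[OF m_subset] by blast
      show "ev ` L \<subseteq> carrier A" using ev_closed by blast
    qed
    moreover have "ev a \<in> ev ` L" "ev a \<notin> \<mm>" using L(3) a by (simp_all add: mem_pre)
    ultimately have "ev 1 \<in> ev ` L" using ev_closed by auto
    then obtain l where l: "ev 1 = ev l" "l \<in> L" by blast
    then obtain m b where mb: "l = m + a * b" "m \<in> pre \<mm>" unfolding L_def adjoin_def by blast
    have "l - 1 \<in> kern" using l(1) by (simp add: mem_pre ev_diff r_right_minus_eq ev_closed)
    hence "l - 1 \<in> pre \<mm>" using kern_subset_pre[OF ideal_m] by blast
    hence "(l - 1) - m \<in> pre \<mm>" by (rule idl_diff[OF idl_pre[OF ideal_m] _ mb(2)])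
    moreover have "(l - 1) - m = b * a - 1" by (simp add: mb(1) algebra_simps)
    ultimately show "\<exists>b. b * a - 1 \<in> pre \<mm>" by metis
  qed
qed

lemma lift_list: "set zs \<subseteq> carrier A \<Longrightarrow> \<exists>ys. map ev ys = zs"
proof (induction zs)
  case (Cons z zs)
  obtain y where "ev y = z" using ev_surj[of z] Cons.prems by auto
  moreover obtain ys where "map ev ys = zs" using Cons by auto
  ultimately show ?case by (intro exI[of _ "y # ys"]) simp
qed simp

theorem depth_le_F_depth: "depth A \<mm> \<le> F_depth A \<mm> p e"
  unfolding depth_def F_depth_def
proof (rule Sup_least, rule Inf_greatest)
  fix d f assume "d \<in> {enat (length xs) | xs. regular_sequence A xs \<and> set xs \<subseteq> \<mm>}"
    and "f \<in> {enat i | i. \<forall>r. (frobenius_action A \<mm> p e i ^^ r) ` carrier (local_cohomology A \<mm> (ring_module A) i)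
       \<noteq> {\<zero>\<^bsub>local_cohomology A \<mm> (ring_module A) i\<^esub>}}"
  then obtain zs i where zs: "d = enat (length zs)" "regular_sequence A zs" "set zs \<subseteq> \<mm>" and f: "f = enat i"
    and i: "\<And>r. (frobenius_action A \<mm> p e i ^^ r) ` carrier (local_cohomology A \<mm> (ring_module A) i)
       \<noteq> {\<zero>\<^bsub>local_cohomology A \<mm> (ring_module A) i\<^esub>}" by blast
  obtain ys where ys: "map ev ys = zs" using lift_list zs(3) m_subset by blast
  have M: "set ys \<subseteq> pre \<mm>" using zs(3) ys by (auto simp: mem_pre image_subset_iff)
  have reg: "regseq kern ys" using regular_sequence_regseq zs(2) ys by blast
  have trivial: "carrier (local_cohomology A \<mm> (ring_module A) i) = {\<zero>\<^bsub>local_cohomology A \<mm> (ring_module A) i\<^esub>}"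
    if "Z i kern \<subseteq> B i kern"
  proof -
    have "cls (ring_module A) ev i c = cls (ring_module A) ev i 0" if "c \<in> Z i kern" for c
      using cls_eq[OF rep_ring_module Z_E[OF that] subm_0[OF subm_E]] that \<open>Z i kern \<subseteq> B i kern\<close> by auto
    hence "cls (ring_module A) ev i ` Z i kern = (\<lambda>_. cls (ring_module A) ev i 0) ` Z i kern"
      by (rule image_cong[OF refl])
    moreover have "0 \<in> Z i kern" by (rule subm_0[OF subm_Z[OF idl_kern]])
    ultimately show ?thesis
      unfolding local_cohomology_def cech_cohomology_carrier[OF rep_ring_module] cech_cohomology_zero[OF rep_ring_module]
      by (simp add: image_constant_conv) blast
  qed
  have "\<not> i < length ys"
  proof
    assume "i < length ys"
    from trivial[OF vanishing[OF idl_kern order.refl reg M this]] show False using i[of 0] by simp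
  qed
  thus "d \<le> f" using zs(1) f ys by auto
qed

theorem fgrade_le_depth: "fgrade A \<mm> I \<le> depth A \<mm>"
proof (cases "depth A \<mm>")
  case (enat t)
  define D where "D = {enat (length xs) | xs. regular_sequence A xs \<and> set xs \<subseteq> \<mm>}"
  have "enat t = Sup D" using enat by (simp add: depth_def D_def)
  have m_ne: "\<mm> \<noteq> carrier A" using maximalideal.I_notcarr[OF maximal] by blast
  have "genideal A {} \<subseteq> \<mm>" by (rule genideal_minimal[OF ideal_m]) simp
  hence "regular_sequence A []" using m_ne m_subset by (auto simp: regular_sequence_def)
  hence D: "D \<noteq> {}" unfolding D_def by (auto intro!: exI[of _ "[]"])
  \<comment> \<open>A nonempty set with a finite supremum in \<open>enat\<close> is finite and
    attains it, so a regular sequence of maximal length exists.\<close>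
  have "enat t \<in> D"
  proof -
    have "finite D" using \<open>enat t = Sup D\<close> by (auto simp: Sup_enat_def D split: if_splits)
    thus ?thesis using \<open>enat t = Sup D\<close> D Max_in by (simp add: Sup_enat_def)
  qed
  then obtain zs where zs: "t = length zs" "regular_sequence A zs" "set zs \<subseteq> \<mm>" by (auto simp: D_def)
  obtain ys where ys: "map ev ys = zs" using lift_list zs(3) m_subset by blast
  define J where "J = foldl adjoin kern ys"
  have J: "idl J" "kern \<subseteq> J" "pre (genideal A (set zs)) = J"
    using foldl_adjoin[OF idl_kern, of ys] pre_genideal[of ys] by (auto simp: J_def ys[symmetric])
  \<comment> \<open>An \<open>x\<close> that is regular modulo \<open>J\<close> could be appended to
    \<open>zs\<close> and would give a longer regular sequence in \<open>\<mm>\<close>.\<close>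
  have "\<exists>a. a \<notin> J \<and> x * a \<in> J" if x: "x \<in> pre \<mm>" for x
  proof (rule ccontr)
    assume contra: "\<not> ?thesis"
    have x': "ev x \<in> \<mm>" using x by (simp add: mem_pre)
    have "regular_sequence A (zs @ [ev x])"
      unfolding regular_sequence_def
    proof (intro conjI allI impI ballI)
      show "set (zs @ [ev x]) \<subseteq> carrier A" using zs(3) x' m_subset by auto
      have "genideal A (set (zs @ [ev x])) \<subseteq> \<mm>" by (rule genideal_minimal[OF ideal_m]) (use zs(3) x' in auto)
      thus "genideal A (set (zs @ [ev x])) \<noteq> carrier A" using m_ne m_subset by blast
      fix i a
      assume i: "i < length (zs @ [ev x])" and a: "a \<in> carrier A"
        and mem: "(zs @ [ev x]) ! i \<otimes> a \<in> genideal A (set (take i (zs @ [ev x])))"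
      show "a \<in> genideal A (set (take i (zs @ [ev x])))"
      proof (cases "i < length zs")
        case True
        thus ?thesis using zs(2) a mem by (auto simp: regular_sequence_def nth_append)
      next
        case False
        hence i: "i = length zs" using i by simp
        obtain b where b: "a = ev b" using ev_surj[OF a] by blast
        have "x * b \<in> J" using mem by (simp add: i b J(3)[symmetric] mem_pre ev_mult)
        hence "b \<in> J" using contra by blast
        thus ?thesis by (simp add: i b J(3)[symmetric] mem_pre)
      qed
    qed
    moreover have "set (zs @ [ev x]) \<subseteq> \<mm>" using zs(3) x' by simp
    ultimately have "enat (length (zs @ [ev x])) \<in> D" unfolding D_def by blast
    hence "enat (Suc t) \<le> Sup D" using zs(1) by (intro Sup_upper) simp
    thus False using \<open>enat t = Sup D\<close> by (metis Suc_n_not_le_n enat_ord_simps(1))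
  qed
  then obtain a where a: "a \<notin> J" "\<And>x. x \<in> pre \<mm> \<Longrightarrow> x * a \<in> J"
    using common_annihilator[OF noeth J(1,2) idl_M] by blast
  have "set ys \<subseteq> pre \<mm>" using zs(3) ys by (auto simp: mem_pre image_subset_iff)
  then obtain i z n where i: "i \<le> length ys" and z: "\<And>n. z n \<in> Z i (In n)" "\<And>n. z (Suc n) - z n \<in> B i (In n)"
    and n: "z n \<notin> B i (In n)"
    using formal_cohomology_nontrivial[of ys a] a regular_sequence_regseq zs(2) ys unfolding J_def by blast
  define \<pi> where "\<pi> n p = I [^]\<^bsub>ideals_set A\<^esub> (n :: nat) +> ev p" for n p
  have In: "ideal (I [^]\<^bsub>ideals_set A\<^esub> n) A" for n :: nat
  proof -
    interpret S: semiring "ideals_set A" by (rule ideals_set_is_semiring)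
    show ?thesis using S.nat_pow_closed[of I n] I(1) by (simp add: ideals_set_def)
  qed
  have rep: "rep (quotient_power A I n) (\<pi> n) (In n)" for n
    unfolding quotient_power_def \<pi>_def by (rule rep_quotient[OF In])
  define \<xi> where "\<xi> n = cls (quotient_power A I n) (\<pi> n) i (z n)" for n
  have "\<xi> \<in> formal_local_cohomology A \<mm> I i"
    unfolding formal_local_cohomology_def mem_Collect_eq
  proof (intro conjI allI)
    fix n
    show "\<xi> n \<in> carrier (local_cohomology A \<mm> (quotient_power A I n) i)"
      unfolding local_cohomology_def cech_cohomology_carrier[OF rep] \<xi>_def using z(1) by blast
    have sub: "In (Suc n) \<subseteq> In n" by (rule In_antimono) simp
    have proj: "power_projection A I n (\<pi> (Suc n) p) = \<pi> n p" for p
      unfolding power_projection_def \<pi>_def using sub by (intro coset_map_coset[OF In In, where f' = id, simplified]) auto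
    have "local_cohomology_map A \<mm> (quotient_power A I n) (power_projection A I n) i (\<xi> (Suc n))
        = cls (quotient_power A I n) (\<pi> n) i (z (Suc n))"
      unfolding local_cohomology_map_def \<xi>_def by (rule cech_cohomology_map_cls[OF rep rep sub proj Z_E[OF z(1)]])
    also have "\<dots> = \<xi> n"
      unfolding \<xi>_def using cls_eq[OF rep Z_E[OF z(1)] Z_E[OF z(1)]] z(2) by blast
    finally show "local_cohomology_map A \<mm> (quotient_power A I n) (power_projection A I n) i (\<xi> (Suc n)) = \<xi> n" .
  qed
  moreover have "\<xi> n \<noteq> \<zero>\<^bsub>local_cohomology A \<mm> (quotient_power A I n) i\<^esub>"
    unfolding local_cohomology_def cech_cohomology_zero[OF rep] \<xi>_def
    using cls_eq[OF rep Z_E[OF z(1)] subm_0[OF subm_E]] n by simp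
  ultimately have "formal_local_cohomology A \<mm> I i \<noteq> {\<lambda>n. \<zero>\<^bsub>local_cohomology A \<mm> (quotient_power A I n) i\<^esub>}"
    by auto
  hence "fgrade A \<mm> I \<le> enat i" unfolding fgrade_def by (intro Inf_lower) blast
  also have "\<dots> \<le> depth A \<mm>" using i zs(1) ys enat by auto
  finally show ?thesis .
qed simp

end

theorem theorem3p8:
  fixes A :: "('a, 'm) ring_scheme" and R :: "('b, 'n) ring_scheme"
    and \<mm> I :: "'a set" and \<nn> :: "'b set" and \<phi> :: "'b \<Rightarrow> 'a" and p e :: nat
  assumes "e \<ge> 1"
    and "noetherian_local_ring A \<mm>" and "contains_field_of_char A p" and "F_finite A p e"
    and "regular_local_ring R \<nn>" and "contains_field_of_char R p" and "F_finite R p e"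
    and "\<phi> \<in> ring_hom R A" and "\<phi> ` carrier R = carrier A"
    and "ideal I A" and "I \<noteq> carrier A"
  shows "fgrade A \<mm> I \<le> depth A \<mm> \<and> depth A \<mm> \<le> F_depth A \<mm> p e"
proof -
  have cring: "cring A" using assms(2) by (simp add: noetherian_local_ring_def)
  note eval = cring.range_eval_poly[OF cring] cring.eval_poly_1[OF cring]
    cring.eval_poly_add[OF cring] cring.eval_poly_mult[OF cring]
  have "local_surjection A (cring.eval_poly A) \<mm> I"
    by (intro local_surjection.intro surjection.intro surjection_axioms.intro local_surjection_axioms.intro
        cring eval assms(2,10,11))
  thus ?thesis
    using local_surjection.fgrade_le_depth local_surjection.depth_le_F_depth by blast
qed

end
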